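(* Let $\mathcal F$ be a Kähler foliation on a compact Riemannian manifold $(M,g_M)$. Assume that the transversal Ricci operator $\rho^\nabla$ is non-positive (at every point of $M$) and negative at some point. Then every infinitesimal automorphism $Y\in V(\mathcal F)$ such that $\bar Y$ is a transversally holomorphic field satisfies $Y\in\Gamma L$, i.e., $\bar Y=0$.
   Context: Setting. $(M,g_M)$ is a Riemannian manifold of dimension $n=p+q$ with a foliation $\mathcal F$ of codimension $q$ and a bundle-like metric $g_M$. $L\subset TM$ is the tangent bundle of $\mathcal F$, $Q=TM/L$ the normal bundle, $\pi:TM\to Q$ the projection, $\sigma:Q\to L^\perp$ the bundle isomorphism with $\pi\circ\sigma=\mathrm{id}$; $g_Q(s,t)=g_M(\sigma(s),\sigma(t))$ is the induced holonomy invariant metric on $Q$, and $Q$ is identified with $L^\perp$. For $s\in\Gamma Q$ put $Y_s=\sigma(s)$. The transversal Levi-Civita connection $\nabla$ in $Q$ is $\nabla_Xs=\pi([X,Y_s])$ for $X\in\Gamma L$ and $\nabla_Xs=\pi(\nabla^M_XY_s)$ for $X\in\Gamma L^\perp$, where $\nabla^M$ is the Levi-Civita connection of $g_M$; its curvature is $R^\nabla(X,Z)=[\nabla_X,\nabla_Z]-\nabla_{[X,Z]}$, which vanishes when one argument is in $L$. The transversal Ricci operator $\rho^\nabla:\Gamma Q\to\Gamma Q$ is $\rho^\nabla(s)=\sum_{a}R^\nabla(s,E_a)E_a$ for a local orthonormal basic frame $\{E_a\}$ of $Q$; "non-positive" and "negative" refer to the quadratic form $s\mapsto g_Q(\rho^\nabla(s),s)$.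 Kähler foliation: a foliation of even codimension $q=2m$ with bundle-like $g_M$, together with a holonomy invariant almost complex structure $J:Q\to Q$ such that $g_Q(JX,JZ)=g_Q(X,Z)$ for $X,Z\in\Gamma Q$ and $\nabla J=0$. Infinitesimal automorphisms. $V(\mathcal F)$ is the space of vector fields $Y$ on $M$ with $[Y,Z]\in\Gamma L$ for all $Z\in\Gamma L$ (infinitesimal automorphisms of $\mathcal F$); write $\bar Y=\pi(Y)$. For $Y\in V(\mathcal F)$, $\theta(Y)$ is the transverse Lie derivative, $\theta(Y)s=\pi([Y,Y_s])$ for $s\in\Gamma Q$, extended to tensors on $Q$ by the Leibniz rule, so $(\theta(Y)J)s=\theta(Y)(Js)-J\theta(Y)s$. For $Y\in V(\mathcal F)$, $\bar Y$ is a transversally holomorphic field if $\theta(Y)J=0$; equivalently, $\nabla_{JZ}\bar Y=J\nabla_Z\bar Y$ for all $Z\in\Gamma L^\perp$.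
   Formalization: The manifold M is assumed to be connected; for disconnected M the claim fails (a flat torus together with a hyperbolic surface, foliated by points). *)

theory Defs
  imports "HOL-Analysis.Analysis" "HOL-Library.Function_Algebras"
begin

text \<open>
  The manifold \<open>M\<close> is the whole type \<open>'a\<close>, a Hausdorff second countable space, and carries an atlas of
  charts into \<open>real ^ 'n\<close>, so \<open>n = CARD('n)\<close>.
  Tangent vectors at \<open>p\<close> are derivations on germs at \<open>p\<close> of smooth functions; they are added with the
  pointwise operations of \<open>Function_Algebras\<close>. Objects defined on an open set \<open>U\<close> only are represented
  by total functions whose values outside \<open>U\<close> are irrelevant.
\<close>

type_synonym ('a, 'n) chart = "'a set \<times> ('a \<Rightarrow> real ^ 'n)"
type_synonym 'a tvec = "('a \<Rightarrow> real) \<Rightarrow> real"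
type_synonym 'a vfield = "'a \<Rightarrow> 'a tvec"

primrec Ck_on ::
  "nat \<Rightarrow> ('e::euclidean_space \<Rightarrow> 'b::real_normed_vector) \<Rightarrow> 'e set \<Rightarrow> bool" where
  "Ck_on 0 f S \<longleftrightarrow> continuous_on S f"
| "Ck_on (Suc k) f S \<longleftrightarrow>
     (\<forall>x\<in>S. f differentiable (at x)) \<and> (\<forall>v. Ck_on k (\<lambda>x. frechet_derivative f (at x) v) S)"

text \<open>Only meaningful for open sets \<open>S\<close>.\<close>

definition smooth_on ::
  "('e::euclidean_space \<Rightarrow> 'b::real_normed_vector) \<Rightarrow> 'e set \<Rightarrow> bool" where
  "smooth_on f S \<longleftrightarrow> (\<forall>k. Ck_on k f S)"

definition is_chart :: "('a::topological_space, 'n::finite) chart \<Rightarrow> bool" where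
  "is_chart = (\<lambda>(U, \<phi>).
     open U \<and> open (\<phi> ` U) \<and> homeomorphism U (\<phi> ` U) \<phi> (inv_into U \<phi>))"

definition smooth_transition ::
  "('a, 'n::finite) chart \<Rightarrow> ('a, 'n) chart \<Rightarrow> bool" where
  "smooth_transition = (\<lambda>(U, \<phi>) (V, \<psi>). smooth_on (\<psi> \<circ> inv_into U \<phi>) (\<phi> ` (U \<inter> V)))"

definition smooth_atlas :: "('a::topological_space, 'n::finite) chart set \<Rightarrow> bool" where
  "smooth_atlas A \<longleftrightarrow>
     (\<forall>c\<in>A. is_chart c) \<and> (\<Union>c\<in>A. fst c) = UNIV \<and> (\<forall>c\<in>A. \<forall>d\<in>A. smooth_transition c d)"

definition trans_coord :: "'n::finite set \<Rightarrow> real ^ 'n \<Rightarrow> real ^ 'n" where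
  "trans_coord T v = (\<chi> i. if i \<in> T then v $ i else 0)"

definition tscale :: "real \<Rightarrow> 'a tvec \<Rightarrow> 'a tvec" where
  "tscale c v = (\<lambda>f. c * v f)"

context
  fixes A :: "('a::topological_space, 'n::finite) chart set"
begin

definition smooth_fun_on :: "'a set \<Rightarrow> ('a \<Rightarrow> real) \<Rightarrow> bool" where
  "smooth_fun_on W f \<longleftrightarrow> (\<forall>(U, \<phi>)\<in>A. smooth_on (f \<circ> inv_into U \<phi>) (\<phi> ` (U \<inter> W)))"

definition smooth_near :: "'a \<Rightarrow> ('a \<Rightarrow> real) \<Rightarrow> bool" where
  "smooth_near p f \<longleftrightarrow> (\<exists>W. open W \<and> p \<in> W \<and> smooth_fun_on W f)"

text \<open>
  A derivation vanishes on functions that are not smooth near \<open>p\<close>; this makes it determined by its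
  values on the functions that are. Locality (dependence on the germ only) follows from the Leibniz
  rule, because indicator functions of sets containing or avoiding a neighbourhood of \<open>p\<close> are
  smooth near \<open>p\<close>.
\<close>

definition tangent_space :: "'a \<Rightarrow> 'a tvec set" where
  "tangent_space p = {v.
     (\<forall>f. \<not> smooth_near p f \<longrightarrow> v f = 0) \<and>
     (\<forall>c f. smooth_near p f \<longrightarrow> v (\<lambda>x. c * f x) = c * v f) \<and>
     (\<forall>f h. smooth_near p f \<and> smooth_near p h \<longrightarrow>
        v (\<lambda>x. f x + h x) = v f + v h \<and>
        v (\<lambda>x. f x * h x) = f p * v h + h p * v f)}"

definition vector_fields :: "'a set \<Rightarrow> 'a vfield set" where
  "vector_fields U = {X.
     (\<forall>p\<in>U. X p \<in> tangent_space p) \<and>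
     (\<forall>W f. open W \<and> W \<subseteq> U \<and> smooth_fun_on W f \<longrightarrow> smooth_fun_on W (\<lambda>p. X p f))}"

definition lie_bracket :: "'a vfield \<Rightarrow> 'a vfield \<Rightarrow> 'a vfield" where
  "lie_bracket X Y p f =
     (if smooth_near p f then X p (\<lambda>x. Y x f) - Y p (\<lambda>x. X x f) else 0)"

definition riemannian_metric :: "('a \<Rightarrow> 'a tvec \<Rightarrow> 'a tvec \<Rightarrow> real) \<Rightarrow> bool" where
  "riemannian_metric g \<longleftrightarrow>
     (\<forall>p. \<forall>u\<in>tangent_space p. \<forall>v\<in>tangent_space p.
        g p u v = g p v u \<and>
        (\<forall>c. g p (tscale c u) v = c * g p u v) \<and>
        (\<forall>w\<in>tangent_space p. g p (u + w) v = g p u v + g p w v)) \<and>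
     (\<forall>p. \<forall>v\<in>tangent_space p. v \<noteq> 0 \<longrightarrow> g p v v > 0) \<and>
     (\<forall>U. open U \<longrightarrow> (\<forall>X\<in>vector_fields U. \<forall>Y\<in>vector_fields U.
        smooth_fun_on U (\<lambda>p. g p (X p) (Y p))))"

text \<open>
  The Levi-Civita connection, acting on vector fields over arbitrary open sets: the metric and
  torsion-free affine connection. It is unique on vector fields that are smooth near the
  point in question.
\<close>

definition is_levi_civita ::
  "('a \<Rightarrow> 'a tvec \<Rightarrow> 'a tvec \<Rightarrow> real) \<Rightarrow> ('a vfield \<Rightarrow> 'a vfield \<Rightarrow> 'a vfield) \<Rightarrow> bool" where
  "is_levi_civita g D \<longleftrightarrow> (\<forall>U. open U \<longrightarrow>
     (\<forall>X\<in>vector_fields U. \<forall>Y\<in>vector_fields U.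
        D X Y \<in> vector_fields U \<and>
        (\<forall>p\<in>U. D X Y p - D Y X p = lie_bracket X Y p) \<and>
        (\<forall>f. smooth_fun_on U f \<longrightarrow> (\<forall>p\<in>U.
           D (\<lambda>x. tscale (f x) (X x)) Y p = tscale (f p) (D X Y p) \<and>
           D X (\<lambda>x. tscale (f x) (Y x)) p = tscale (X p f) (Y p) + tscale (f p) (D X Y p))) \<and>
        (\<forall>Z\<in>vector_fields U. \<forall>p\<in>U.
           D (X + Z) Y p = D X Y p + D Z Y p \<and>
           D X (Y + Z) p = D X Y p + D X Z p \<and>
           X p (\<lambda>x. g x (Y x) (Z x)) = g p (D X Y p) (Z p) + g p (Y p) (D X Z p))))"

definition levi_civita ::
  "('a \<Rightarrow> 'a tvec \<Rightarrow> 'a tvec \<Rightarrow> real) \<Rightarrow> 'a vfield \<Rightarrow> 'a vfield \<Rightarrow> 'a vfield" where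
  "levi_civita g = (SOME D. is_levi_civita g D)"

text \<open>
  A foliation of codimension \<open>card T\<close> is a foliated atlas \<open>F\<close>: charts of the smooth structure given by
  \<open>A\<close>, with transverse coordinates those with index in \<open>T\<close>, such that locally the transverse
  coordinates of one chart are functions of the transverse coordinates of any other (transition maps
  \<open>(x, y) \<mapsto> (f (x, y), h y)\<close>). Smoothness of \<open>h\<close> is automatic. The plaques are the level sets of the
  transverse coordinates.
\<close>

definition foliation :: "'n set \<Rightarrow> ('a, 'n) chart set \<Rightarrow> bool" where
  "foliation T F \<longleftrightarrow>
     (\<forall>c\<in>F. is_chart c \<and> (\<forall>d\<in>A. smooth_transition c d \<and> smooth_transition d c)) \<and>
     (\<Union>c\<in>F. fst c) = UNIV \<and>
     (\<forall>(U, \<phi>)\<in>F. \<forall>(V, \<psi>)\<in>F. \<forall>p\<in>U \<inter> V. \<exists>W h. open W \<and> p \<in> W \<and> W \<subseteq> U \<inter> V \<and>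
        (\<forall>x\<in>W. trans_coord T (\<psi> x) = h (trans_coord T (\<phi> x))))"

context
  fixes T :: "'n set" and F :: "('a, 'n) chart set"
    and g :: "'a \<Rightarrow> 'a tvec \<Rightarrow> 'a tvec \<Rightarrow> real"
begin

definition L_space :: "'a \<Rightarrow> 'a tvec set" where
  "L_space p =
     {v \<in> tangent_space p. \<forall>(U, \<phi>)\<in>F. p \<in> U \<longrightarrow> (\<forall>i\<in>T. v (\<lambda>x. \<phi> x $ i) = 0)}"

text \<open>
  The normal bundle \<open>Q = TM/L\<close> is identified with the orthogonal complement of \<open>L\<close>: \<open>\<sigma>\<close> is the
  inclusion, \<open>\<pi>\<close> the orthogonal projection, \<open>Y\<^sub>s = s\<close>, and \<open>g\<^sub>Q\<close> the restriction of \<open>g\<close>.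
\<close>

definition Q_space :: "'a \<Rightarrow> 'a tvec set" where
  "Q_space p = {v \<in> tangent_space p. \<forall>w\<in>L_space p. g p v w = 0}"

definition nproj :: "'a \<Rightarrow> 'a tvec \<Rightarrow> 'a tvec" where
  "nproj p v = (THE w. w \<in> Q_space p \<and> v - w \<in> L_space p)"

definition L_sections :: "'a set \<Rightarrow> 'a vfield set" where
  "L_sections U = {X \<in> vector_fields U. \<forall>p\<in>U. X p \<in> L_space p}"

definition Q_sections :: "'a set \<Rightarrow> 'a vfield set" where
  "Q_sections U = {s \<in> vector_fields U. \<forall>p\<in>U. s p \<in> Q_space p}"

text \<open>\<open>V(F)\<close>, over an open set \<open>U\<close>.\<close>

definition inf_automorphisms :: "'a set \<Rightarrow> 'a vfield set" where
  "inf_automorphisms U =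
     {Y \<in> vector_fields U. \<forall>Z\<in>L_sections U. lie_bracket Y Z \<in> L_sections U}"

text \<open>Transverse Lie derivative \<open>\<theta>(Y)s\<close>.\<close>

definition trans_lie :: "'a vfield \<Rightarrow> 'a vfield \<Rightarrow> 'a vfield" where
  "trans_lie Y s p = nproj p (lie_bracket Y s p)"

text \<open>\<open>g\<close> is bundle-like: \<open>\<theta>(X)g\<^sub>Q = 0\<close> for all \<open>X \<in> \<Gamma>L\<close>.\<close>

definition bundle_like :: bool where
  "bundle_like \<longleftrightarrow>
     (\<forall>X\<in>L_sections UNIV. \<forall>s\<in>Q_sections UNIV. \<forall>t\<in>Q_sections UNIV. \<forall>p.
        X p (\<lambda>x. g x (s x) (t x)) - g p (trans_lie X s p) (t p) - g p (s p) (trans_lie X t p) = 0)"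

text \<open>
  The transversal Levi-Civita connection \<open>\<nabla>\<^sub>X s\<close>; a general \<open>X\<close> is decomposed into its components in
  \<open>L\<close> and in the orthogonal complement of \<open>L\<close>.
\<close>

definition trans_conn :: "'a vfield \<Rightarrow> 'a vfield \<Rightarrow> 'a vfield" where
  "trans_conn X s p =
     nproj p (lie_bracket (\<lambda>x. X x - nproj x (X x)) s p) +
     nproj p (levi_civita g (\<lambda>x. nproj x (X x)) s p)"

definition trans_curv :: "'a vfield \<Rightarrow> 'a vfield \<Rightarrow> 'a vfield \<Rightarrow> 'a vfield" where
  "trans_curv X Z s p =
     trans_conn X (trans_conn Z s) p - trans_conn Z (trans_conn X s) p
     - trans_conn (lie_bracket X Z) s p"

definition orthonormal_basic_frame :: "'a set \<Rightarrow> ('n \<Rightarrow> 'a vfield) \<Rightarrow> bool" where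
  "orthonormal_basic_frame U E \<longleftrightarrow> open U \<and>
     (\<forall>a\<in>T. E a \<in> Q_sections U \<and> E a \<in> inf_automorphisms U) \<and>
     (\<forall>p\<in>U. \<forall>a\<in>T. \<forall>b\<in>T. g p (E a p) (E b p) = (if a = b then 1 else 0))"

text \<open>
  The value at \<open>p\<close> of the transversal Ricci operator applied to \<open>s\<close>, computed in some frame defined
  near \<open>p\<close>; it does not depend on the frame.
\<close>

definition trans_ricci :: "'a vfield \<Rightarrow> 'a vfield" where
  "trans_ricci s p =
     (let E = (SOME E. \<exists>U. p \<in> U \<and> orthonormal_basic_frame U E)
      in \<Sum>a\<in>T. trans_curv s (E a) (E a) p)"

definition ricci_nonpos_at :: "'a \<Rightarrow> bool" where
  "ricci_nonpos_at p \<longleftrightarrow> (\<forall>s\<in>Q_sections UNIV. g p (trans_ricci s p) (s p) \<le> 0)"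

definition ricci_neg_at :: "'a \<Rightarrow> bool" where
  "ricci_neg_at p \<longleftrightarrow> (\<forall>s\<in>Q_sections UNIV. s p \<noteq> 0 \<longrightarrow> g p (trans_ricci s p) (s p) < 0)"

text \<open>\<open>(\<theta>(Y)J)s\<close>.\<close>

definition trans_lie_endo ::
  "('a \<Rightarrow> 'a tvec \<Rightarrow> 'a tvec) \<Rightarrow> 'a vfield \<Rightarrow> 'a vfield \<Rightarrow> 'a vfield" where
  "trans_lie_endo J Y s p = trans_lie Y (\<lambda>x. J x (s x)) p - J p (trans_lie Y s p)"

definition almost_complex_structure :: "('a \<Rightarrow> 'a tvec \<Rightarrow> 'a tvec) \<Rightarrow> bool" where
  "almost_complex_structure J \<longleftrightarrow>
     (\<forall>p. \<forall>v\<in>Q_space p.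
        J p v \<in> Q_space p \<and> J p (J p v) = - v \<and>
        (\<forall>c. J p (tscale c v) = tscale c (J p v)) \<and>
        (\<forall>w\<in>Q_space p. J p (v + w) = J p v + J p w)) \<and>
     (\<forall>U. open U \<longrightarrow> (\<forall>s\<in>Q_sections U. (\<lambda>x. J x (s x)) \<in> Q_sections U))"

definition kaehler_foliation :: "('a \<Rightarrow> 'a tvec \<Rightarrow> 'a tvec) \<Rightarrow> bool" where
  "kaehler_foliation J \<longleftrightarrow>
     foliation T F \<and> even (card T) \<and> bundle_like \<and>
     almost_complex_structure J \<and>
     (\<forall>X\<in>L_sections UNIV. \<forall>s\<in>Q_sections UNIV. \<forall>p. trans_lie_endo J X s p = 0) \<and>
     (\<forall>p. \<forall>v\<in>Q_space p. \<forall>w\<in>Q_space p. g p (J p v) (J p w) = g p v w) \<and>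
     (\<forall>X\<in>vector_fields UNIV. \<forall>s\<in>Q_sections UNIV. \<forall>p.
        trans_conn X (\<lambda>x. J x (s x)) p - J p (trans_conn X s p) = 0)"

definition transversally_holomorphic ::
  "('a \<Rightarrow> 'a tvec \<Rightarrow> 'a tvec) \<Rightarrow> 'a vfield \<Rightarrow> bool" where
  "transversally_holomorphic J Y \<longleftrightarrow>
     (\<forall>s\<in>Q_sections UNIV. \<forall>p. trans_lie_endo J Y s p = 0)"

end

end

end

theory Submission
  imports Defs
begin

text \<open>
  The proof is Bochner's method, with a maximum principle instead of an integration over \<open>M\<close>; this
  avoids the mean curvature of the leaves, which would enter an integral formula.

  Let \<open>N\<close> be the normal part of \<open>Y\<close> and \<open>f = g(N, N)\<close>. As \<open>Y\<close> is an infinitesimal automorphism, \<open>N\<close> is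
  parallel along the leaves (\<open>conn_L_IA\<close>), so \<open>f\<close> is constant along them. As \<open>Y\<close> is transversally
  holomorphic and \<open>\<nabla>\<close> is torsion-free with \<open>\<nabla>J = 0\<close>, one has \<open>\<nabla>\<^sub>J\<^sub>X N = J \<nabla>\<^sub>X N\<close> (\<open>conn_N_JS\<close>). Put
  \<open>H(X, Z) = \<nabla>\<^sub>X \<nabla>\<^sub>Z N - \<nabla>\<^sub>V N\<close> with \<open>V = \<nabla>\<^sub>X Z\<close>. Then \<open>H(X, JZ) = J H(X, Z)\<close>, and \<open>H(X, Z) - H(Z, X) = R(X, Z)N\<close>, so
  that \<open>H(JX, JX) = - H(X, X) + J R(JX, X)N\<close>. The Bianchi identity changes the last term into
  \<open>- R(N, X)X - R(N, JX)JX\<close>. Summation over an orthonormal frame, where \<open>E\<close> and \<open>JE\<close> give the same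
  traces, yields \<open>\<Sum> H(E\<^sub>a, E\<^sub>a) = - \<rho>(N)\<close> (\<open>weitzenboeck\<close>). With \<open>\<nabla>\<^sub>a\<close> for the derivative along \<open>E\<^sub>a\<close> it
  follows (\<open>bochner\<close>) that \<open>\<Sum> (E\<^sub>a E\<^sub>a f - (\<nabla>\<^sub>a E\<^sub>a) f) = 2 \<Sum> \<bar>\<nabla>\<^sub>a N\<bar>\<^sup>2 - 2 g(\<rho>(N), N)\<close>, which is nonnegative.

  The operator on the left only differentiates in normal directions, but squares of fields tangent
  to the leaves may be added to it, because these fields annihilate \<open>f\<close>. The result is elliptic on \<open>M\<close>,
  and by Hopf's strong maximum principle (\<open>strong_maximum_principle\<close>) the set where \<open>f\<close> attains its
  maximum is open. Since \<open>M\<close> is compact and connected, \<open>f\<close> is constant. So both terms on the right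
  vanish everywhere; where \<open>\<rho>\<close> is negative this forces \<open>N = 0\<close>, whence \<open>f = 0\<close> on all of \<open>M\<close>.

  Two existence results are indispensable, because the definitions of \<open>\<nabla>\<close> and \<open>\<rho>\<close> choose an object
  with the required properties: the Levi-Civita connection exists (\<open>levi_civita_exists\<close>, by the Koszul
  formula in local orthonormal frames), and orthonormal basic frames exist (\<open>basic_frame_exists\<close>, by
  Gram-Schmidt over the basic functions; here the metric has to be bundle-like). Both rest on the
  fact that derivations on germs are directional derivatives (\<open>TS_chart\<close>, from Hadamard's lemma).

  Conditions on \<open>g\<close> and \<open>J\<close> concern global sections, whereas frames are local. Bump functions mediate:
  local frames are extended to global sections, and the computations take place over the ring of
  smooth functions on \<open>M\<close>, where identities between fields are equations of functions.
\<close>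

section \<open>Smooth functions on Euclidean space\<close>

text \<open>
  The predicate \<open>Ck_on\<close> is a recursion over \<open>frechet_derivative\<close>, a total function that is only known
  where a derivative exists. The next three lemmas replace it by derivatives given explicitly; the
  closure properties below are inductions on the order with these as step.
\<close>

lemma Ck_on_cong:
  assumes "open S" "\<And>x. x \<in> S \<Longrightarrow> f x = h x" "Ck_on k f S"
  shows "Ck_on k h S"
  using assms(2,3)
proof (induction k arbitrary: f h)
  case 0
  then show ?case using continuous_on_cong[of S S f h] by simp
next
  case (Suc k)
  have d: "(h has_derivative frechet_derivative f (at x)) (at x)" if "x \<in> S" for x
    using Suc.prems that assms(1)
    by (auto intro: has_derivative_transform_within_open simp: frechet_derivative_works)
  have "frechet_derivative h (at x) = frechet_derivative f (at x)" if "x \<in> S" for x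
    using frechet_derivative_at[OF d[OF that]] by simp
  then have "Ck_on k (\<lambda>x. frechet_derivative h (at x) v) S" for v
    using Suc.IH[of "\<lambda>x. frechet_derivative f (at x) v"] Suc.prems by simp
  moreover have "\<forall>x\<in>S. h differentiable at x" using d differentiableI by blast
  ultimately show ?case by simp
qed

lemma Ck_on_SucI:
  assumes "open S" "\<And>x. x \<in> S \<Longrightarrow> (f has_derivative f' x) (at x)"
    "\<And>v. Ck_on k (\<lambda>x. f' x v) S"
  shows "Ck_on (Suc k) f S"
proof -
  have "f' x v = frechet_derivative f (at x) v" if "x \<in> S" for x v
    using frechet_derivative_at[OF assms(2)[OF that]] by simp
  then have "Ck_on k (\<lambda>x. frechet_derivative f (at x) v) S" for v
    using Ck_on_cong[OF assms(1) _ assms(3), of v "\<lambda>x. frechet_derivative f (at x) v"] by simp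
  moreover have "\<forall>x\<in>S. f differentiable at x" using assms(2) differentiableI by blast
  ultimately show ?thesis by simp
qed

lemma Ck_on_SucD:
  assumes "Ck_on (Suc k) f S" "x \<in> S"
  shows "(f has_derivative frechet_derivative f (at x)) (at x)"
  using assms by (simp add: frechet_derivative_works[symmetric])

lemma Ck_on_Suc_imp: "Ck_on (Suc k) f S \<Longrightarrow> Ck_on k f S"
proof (induction k arbitrary: f)
  case 0
  then show ?case
    by (auto intro!: continuous_at_imp_continuous_on differentiable_imp_continuous_within)
next
  case (Suc k)
  then show ?case by (metis Ck_on.simps(2))
qed

lemma Ck_on_subset: "Ck_on k f S \<Longrightarrow> S' \<subseteq> S \<Longrightarrow> Ck_on k f S'"
  by (induction k arbitrary: f) (auto intro: continuous_on_subset)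

lemma Ck_on_local:
  assumes "\<And>x. x \<in> S \<Longrightarrow> \<exists>S'. open S' \<and> x \<in> S' \<and> Ck_on k f S'"
  shows "Ck_on k f S"
  using assms
proof (induction k arbitrary: f)
  case 0
  have "isCont f x" if x: "x \<in> S" for x
  proof -
    obtain S' where "open S'" "x \<in> S'" "continuous_on S' f" using 0[OF x] by auto
    then show ?thesis by (simp add: continuous_on_eq_continuous_at)
  qed
  then show ?case by (simp add: continuous_at_imp_continuous_on)
next
  case (Suc k)
  show ?case
    unfolding Ck_on.simps
  proof (intro conjI ballI allI)
    show "f differentiable at x" if "x \<in> S" for x using Suc.prems[OF that] by auto
    show "Ck_on k (\<lambda>x. frechet_derivative f (at x) v) S" for v
      by (rule Suc.IH) (use Suc.prems in fastforce)
  qed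
qed

lemma Ck_on_const: "Ck_on k (\<lambda>x. c) S"
  by (induction k arbitrary: c) auto

lemma Ck_on_bounded_linear:
  assumes "open S" "bounded_linear l" "Ck_on k f S"
  shows "Ck_on k (\<lambda>x. l (f x)) S"
  using assms(3)
proof (induction k arbitrary: f)
  case 0
  then show ?case using assms(2) by (simp add: bounded_linear.continuous_on)
next
  case (Suc k)
  show ?case
    by (rule Ck_on_SucI[OF assms(1) bounded_linear.has_derivative[OF assms(2) Ck_on_SucD[OF Suc.prems]]])
      (use Suc in auto)
qed

lemma Ck_on_id: "open S \<Longrightarrow> Ck_on k (\<lambda>x. x) S"
  by (cases k) (auto intro!: Ck_on_SucI[where f' = "\<lambda>_ v. v"] Ck_on_const derivative_eq_intros)

lemma Ck_on_add:
  assumes "open S" "Ck_on k f S" "Ck_on k h S"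
  shows "Ck_on k (\<lambda>x. f x + h x) S"
  using assms(2,3)
proof (induction k arbitrary: f h)
  case 0
  then show ?case by (auto intro: continuous_intros)
next
  case (Suc k)
  show ?case
    by (rule Ck_on_SucI[OF assms(1) has_derivative_add[OF Ck_on_SucD[OF Suc.prems(1)] Ck_on_SucD[OF Suc.prems(2)]]])
      (use Suc in auto)
qed

lemma Ck_on_sum:
  assumes "open S" "\<And>i. i \<in> I \<Longrightarrow> Ck_on k (f i) S"
  shows "Ck_on k (\<lambda>x. \<Sum>i\<in>I. f i x) S"
  using assms(2)
  by (induction I rule: infinite_finite_induct) (auto intro: Ck_on_const Ck_on_add[OF assms(1)])

lemma Ck_on_mult:
  fixes f h :: "'e::euclidean_space \<Rightarrow> real"
  assumes "open S" "Ck_on k f S" "Ck_on k h S"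
  shows "Ck_on k (\<lambda>x. f x * h x) S"
  using assms(2,3)
proof (induction k arbitrary: f h)
  case 0
  then show ?case by (auto intro: continuous_intros)
next
  case (Suc k)
  show ?case
    by (rule Ck_on_SucI[OF assms(1) has_derivative_mult[OF Ck_on_SucD[OF Suc.prems(1)] Ck_on_SucD[OF Suc.prems(2)]]])
      (use Suc assms(1) Ck_on_Suc_imp[OF Suc.prems(1)] Ck_on_Suc_imp[OF Suc.prems(2)] in \<open>auto intro!: Ck_on_add\<close>)
qed

text \<open>
  The chain rule expresses a derivative of \<open>f \<circ> h\<close> through products of derivatives of \<open>h\<close> with
  the compositions of \<open>h\<close> and partial derivatives of \<open>f\<close>, so induction on the order applies.
\<close>

lemma Ck_on_compose:
  fixes f :: "'b::euclidean_space \<Rightarrow> real" and h :: "'e::euclidean_space \<Rightarrow> 'b"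
  assumes "open S" "open S'" "h ` S \<subseteq> S'" "Ck_on k f S'" "Ck_on k h S"
  shows "Ck_on k (\<lambda>x. f (h x)) S"
  using assms(4,5)
proof (induction k arbitrary: f)
  case 0
  then show ?case using continuous_on_compose2 assms(3) by auto
next
  case (Suc k)
  let ?D = "\<lambda>x v. \<Sum>b\<in>Basis. (frechet_derivative h (at x) v \<bullet> b) * frechet_derivative f (at (h x)) b"
  have "((\<lambda>x. f (h x)) has_derivative ?D x) (at x)" if x: "x \<in> S" for x
  proof -
    have f: "(f has_derivative frechet_derivative f (at (h x))) (at (h x))"
      using Ck_on_SucD[OF Suc.prems(1)] x assms(3) by auto
    interpret f: bounded_linear "frechet_derivative f (at (h x))"
      using f has_derivative_bounded_linear by blast
    have "frechet_derivative f (at (h x)) w = (\<Sum>b\<in>Basis. (w \<bullet> b) * frechet_derivative f (at (h x)) b)" for w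
    proof -
      have "frechet_derivative f (at (h x)) w = frechet_derivative f (at (h x)) (\<Sum>b\<in>Basis. (w \<bullet> b) *\<^sub>R b)"
        by (simp only: euclidean_representation)
      also have "\<dots> = (\<Sum>b\<in>Basis. (w \<bullet> b) * frechet_derivative f (at (h x)) b)"
        unfolding f.sum by (intro sum.cong refl) (simp only: f.scaleR real_scaleR_def)
      finally show ?thesis .
    qed
    then have "(\<lambda>v. frechet_derivative f (at (h x)) (frechet_derivative h (at x) v)) = ?D x" by blast
    then show ?thesis
      using has_derivative_compose[OF Ck_on_SucD[OF Suc.prems(2) x] f] by metis
  qed
  moreover have "Ck_on k (\<lambda>x. ?D x v) S" for v
  proof (intro Ck_on_sum Ck_on_mult assms(1))
    fix b :: 'b assume "b \<in> Basis"
    have "Ck_on k (\<lambda>x. frechet_derivative h (at x) v) S" using Suc.prems(2) by simp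
    then show "Ck_on k (\<lambda>x. frechet_derivative h (at x) v \<bullet> b) S"
      by (intro Ck_on_bounded_linear[OF assms(1) bounded_linear_inner_left])
    show "Ck_on k (\<lambda>x. frechet_derivative f (at (h x)) b) S"
      using Suc.prems Ck_on_Suc_imp[OF Suc.prems(2)] by (intro Suc.IH) auto
  qed
  ultimately show ?case by (intro Ck_on_SucI[OF assms(1), where f' = ?D])
qed

lemma Ck_on_Suc_real:
  fixes f :: "real \<Rightarrow> real"
  assumes "open S" "\<And>x. x \<in> S \<Longrightarrow> (f has_real_derivative f' x) (at x)" "Ck_on k f' S"
  shows "Ck_on (Suc k) f S"
  by (rule Ck_on_SucI[where f' = "\<lambda>x v. f' x * v"])
    (use assms in \<open>auto simp: has_field_derivative_def intro!: Ck_on_mult Ck_on_const\<close>)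

lemma Ck_on_inverse: "Ck_on k (inverse :: real \<Rightarrow> real) (- {0})"
proof (induction k)
  case 0
  then show ?case by (auto intro!: continuous_intros)
next
  case (Suc k)
  have "Ck_on k (\<lambda>x::real. (- 1) * (inverse x * inverse x)) (- {0})"
    by (intro Ck_on_mult Ck_on_const Suc) auto
  moreover have "(inverse has_real_derivative (- 1) * (inverse x * inverse x)) (at x)" if "x \<in> - {0}" for x :: real
    using that by (auto intro!: derivative_eq_intros)
  ultimately show ?case by (intro Ck_on_Suc_real[where f' = "\<lambda>x. (- 1) * (inverse x * inverse x)"]) auto
qed

lemma Ck_on_sqrt: "Ck_on k sqrt {0<..}"
proof (induction k)
  case 0
  then show ?case by (auto intro!: continuous_intros)
next
  case (Suc k)
  have "Ck_on k (\<lambda>x. inverse (sqrt x)) {0<..}"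
    by (rule Ck_on_compose[OF _ _ _ Ck_on_inverse Suc]) auto
  then have "Ck_on k (\<lambda>x. inverse (sqrt x) * (1/2)) {0<..}"
    by (intro Ck_on_mult Ck_on_const) auto
  then show ?case
    by (intro Ck_on_Suc_real[where f' = "\<lambda>x. inverse (sqrt x) * (1/2)"])
      (auto intro!: derivative_eq_intros)
qed

lemma Ck_on_exp: "Ck_on k (exp :: real \<Rightarrow> real) UNIV"
  by (induction k) (auto intro!: continuous_intros Ck_on_Suc_real[where f' = exp] simp del: Ck_on.simps(2))

lemma smooth_on_cong:
  "open S \<Longrightarrow> (\<And>x. x \<in> S \<Longrightarrow> f x = h x) \<Longrightarrow> smooth_on f S \<Longrightarrow> smooth_on h S"
  unfolding smooth_on_def using Ck_on_cong by blast

lemma smooth_on_subset: "smooth_on f S \<Longrightarrow> S' \<subseteq> S \<Longrightarrow> smooth_on f S'"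
  unfolding smooth_on_def using Ck_on_subset by blast

lemma smooth_on_local:
  assumes "\<And>x. x \<in> S \<Longrightarrow> \<exists>S'. open S' \<and> x \<in> S' \<and> smooth_on f S'"
  shows "smooth_on f S"
  unfolding smooth_on_def by (intro allI Ck_on_local) (metis assms smooth_on_def)

lemma smooth_on_has_derivative:
  "smooth_on f S \<Longrightarrow> x \<in> S \<Longrightarrow> (f has_derivative frechet_derivative f (at x)) (at x)"
  unfolding smooth_on_def using Ck_on_SucD by blast

lemma smooth_on_frechet_derivative:
  "smooth_on f S \<Longrightarrow> smooth_on (\<lambda>x. frechet_derivative f (at x) v) S"
  unfolding smooth_on_def by (metis Ck_on.simps(2))

lemma smooth_on_continuous: "smooth_on f S \<Longrightarrow> continuous_on S f"
  unfolding smooth_on_def by (metis Ck_on.simps(1))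

lemma smooth_on_const: "smooth_on (\<lambda>x. c) S"
  by (simp add: smooth_on_def Ck_on_const)

lemma smooth_on_bounded_linear:
  "open S \<Longrightarrow> bounded_linear l \<Longrightarrow> smooth_on f S \<Longrightarrow> smooth_on (\<lambda>x. l (f x)) S"
  by (simp add: smooth_on_def Ck_on_bounded_linear)

lemma smooth_on_id: "open S \<Longrightarrow> smooth_on (\<lambda>x. x) S"
  by (simp add: smooth_on_def Ck_on_id)

lemma smooth_on_add:
  "open S \<Longrightarrow> smooth_on f S \<Longrightarrow> smooth_on h S \<Longrightarrow> smooth_on (\<lambda>x. f x + h x) S"
  by (simp add: smooth_on_def Ck_on_add)

lemma smooth_on_mult:
  fixes f h :: "'e::euclidean_space \<Rightarrow> real"
  shows "open S \<Longrightarrow> smooth_on f S \<Longrightarrow> smooth_on h S \<Longrightarrow> smooth_on (\<lambda>x. f x * h x) S"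
  by (simp add: smooth_on_def Ck_on_mult)

lemma smooth_on_compose:
  fixes f :: "'b::euclidean_space \<Rightarrow> real"
  shows "open S \<Longrightarrow> open S' \<Longrightarrow> h ` S \<subseteq> S' \<Longrightarrow> smooth_on f S' \<Longrightarrow> smooth_on h S \<Longrightarrow>
    smooth_on (\<lambda>x. f (h x)) S"
  by (simp add: smooth_on_def Ck_on_compose)

lemma smooth_on_inverse: "smooth_on (inverse :: real \<Rightarrow> real) (- {0})"
  by (simp add: smooth_on_def Ck_on_inverse)

lemma smooth_on_sqrt: "smooth_on sqrt {0<..}"
  by (simp add: smooth_on_def Ck_on_sqrt)

lemma smooth_on_exp: "smooth_on (exp :: real \<Rightarrow> real) UNIV"
  by (simp add: smooth_on_def Ck_on_exp)

subsection \<open>A flat function and a smooth step\<close>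

text \<open>The powers of \<open>1/x\<close> in front of the exponential are those that arise on differentiating \<open>exp (-1/x)\<close>.\<close>

definition flat :: "nat \<Rightarrow> real \<Rightarrow> real" where
  "flat n x = (if x > 0 then inverse x ^ n * exp (- inverse x) else 0)"

lemma flat_tendsto_0: "(flat n \<longlongrightarrow> 0) (at 0)"
proof -
  have "((\<lambda>x::real. inverse x ^ n / exp (inverse x)) \<longlongrightarrow> 0) (at_right 0)"
    by (rule filterlim_compose[OF tendsto_power_div_exp_0 filterlim_inverse_at_top_right])
  moreover have "eventually (\<lambda>x. inverse x ^ n / exp (inverse x) = flat n x) (at_right 0)"
    by (auto simp: eventually_at_filter flat_def exp_minus field_simps)
  ultimately have "(flat n \<longlongrightarrow> 0) (at_right 0)" by (rule Lim_transform_eventually)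
  moreover have "(flat n \<longlongrightarrow> 0) (at_left 0)"
    by (rule Lim_transform_eventually[OF tendsto_const]) (auto simp: eventually_at_filter flat_def)
  ultimately show ?thesis using filterlim_split_at by blast
qed

text \<open>The functions \<open>flat n\<close> are closed under differentiation up to linear combinations.\<close>

lemma flat_derivative:
  "(flat n has_real_derivative flat (n + 2) x - n * flat (n + 1) x) (at x)"
proof -
  consider "x > 0" | "x < 0" | "x = 0" by linarith
  then show ?thesis
  proof cases
    case 1
    have d: "(inverse has_real_derivative - (inverse x * inverse x)) (at x)"
      using 1 by (auto intro!: derivative_eq_intros)
    have "((\<lambda>x. exp (- inverse x)) has_real_derivative exp (- inverse x) * (inverse x * inverse x)) (at x)"
      using 1 by (auto intro!: derivative_eq_intros d)
    note DERIV_mult[OF DERIV_power[OF d, of n] this]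
    moreover have "real n * inverse x ^ (n - Suc 0) * inverse x = real n * inverse x ^ n"
      by (cases n) auto
    ultimately have "((\<lambda>x. inverse x ^ n * exp (- inverse x)) has_real_derivative
        flat (n + 2) x - n * flat (n + 1) x) (at x)"
      using 1 by (elim DERIV_cong) (auto simp: flat_def algebra_simps power_add power2_eq_square)
    then show ?thesis
      by (rule has_field_derivative_transform_within_open[where S = "{0<..}"]) (use 1 in \<open>auto simp: flat_def\<close>)
  next
    case 2
    have "((\<lambda>x. 0) has_real_derivative flat (n + 2) x - n * flat (n + 1) x) (at x)"
      using 2 by (auto simp: flat_def)
    then show ?thesis
      by (rule has_field_derivative_transform_within_open[where S = "{..<0}"]) (use 2 in \<open>auto simp: flat_def\<close>)
  next
    case 3
    have "eventually (\<lambda>x. flat (n + 1) x = (flat n x - flat n 0) / (x - 0)) (at 0)"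
      by (auto simp: eventually_at_filter flat_def field_simps)
    then have "((\<lambda>x. (flat n x - flat n 0) / (x - 0)) \<longlongrightarrow> 0) (at 0)"
      by (rule Lim_transform_eventually[OF flat_tendsto_0])
    then show ?thesis using 3 by (simp add: has_field_derivative_iff) (simp add: flat_def)
  qed
qed

lemma smooth_on_flat: "smooth_on (flat n) UNIV"
proof -
  have "Ck_on k (flat n) UNIV" for k
  proof (induction k arbitrary: n)
    case 0
    then show ?case
      using DERIV_isCont[OF flat_derivative] by (auto intro!: continuous_at_imp_continuous_on)
  next
    case (Suc k)
    have "Ck_on k (\<lambda>x. flat (n + 2) x + (- real n) * flat (n + 1) x) UNIV"
      by (intro Ck_on_add Ck_on_mult Ck_on_const Suc) auto
    then show ?case using flat_derivative[of n] by (intro Ck_on_Suc_real[OF open_UNIV]) auto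
  qed
  then show ?thesis by (simp add: smooth_on_def)
qed

text \<open>
  The quotient \<open>a / (a + b)\<close> of two flat functions of which \<open>a\<close> vanishes for \<open>s \<ge> 2r\<close> and \<open>b\<close> for
  \<open>s \<le> r\<close>; there is no \<open>s\<close> where both vanish.
\<close>

lemma smooth_step:
  assumes "0 < (r::real)"
  obtains \<beta> where "smooth_on \<beta> UNIV" "\<And>s. s \<le> r \<Longrightarrow> \<beta> s = (1::real)" "\<And>s. s \<ge> 2 * r \<Longrightarrow> \<beta> s = 0"
proof
  let ?N = "\<lambda>s. flat 0 (2 * r + (- 1) * s)" and ?M = "\<lambda>s. flat 0 (s + (- r))"
  let ?\<beta> = "\<lambda>s. ?N s * inverse (?N s + ?M s)"
  have pos: "?N s + ?M s \<noteq> 0" for s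
  proof -
    have "?N s > 0 \<or> ?M s > 0" "?N s \<ge> 0" "?M s \<ge> 0" using assms by (auto simp: flat_def)
    then show ?thesis by linarith
  qed
  have N: "smooth_on ?N UNIV"
    by (intro smooth_on_compose[OF _ _ _ smooth_on_flat] smooth_on_add smooth_on_mult smooth_on_const
        smooth_on_id open_UNIV subset_UNIV)
  have M: "smooth_on ?M UNIV"
    by (intro smooth_on_compose[OF _ _ _ smooth_on_flat] smooth_on_add smooth_on_mult smooth_on_const
        smooth_on_id open_UNIV subset_UNIV)
  have "smooth_on (\<lambda>s. inverse (?N s + ?M s)) UNIV"
    by (rule smooth_on_compose[OF _ _ _ smooth_on_inverse])
      (use pos N M in \<open>auto intro!: smooth_on_add\<close>)
  then show "smooth_on ?\<beta> UNIV" using N by (intro smooth_on_mult) auto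
  show "?\<beta> s = 1" if "s \<le> r" for s
  proof -
    have "?M s = 0" using that by (auto simp: flat_def)
    then show ?thesis using pos[of s] by simp
  qed
  show "?\<beta> s = 0" if "s \<ge> 2 * r" for s using that by (auto simp: flat_def)
qed

subsection \<open>Hadamard's lemma\<close>

text \<open>
  Differentiation under the integral sign turns \<open>\<integral> t^j F(p + t(x - p)) dt\<close> into an integral of the
  same kind with \<open>j + 1\<close> and a derivative of \<open>F\<close>; carrying the weight \<open>t^j\<close> along lets the induction
  on the order of differentiability go through.
\<close>

lemma segment_integral_has_derivative:
  fixes F :: "'e::euclidean_space \<Rightarrow> real"
  assumes S: "open S" "convex S" "p \<in> S" and F: "smooth_on F S" and x: "x \<in> S"
  shows "((\<lambda>x. integral {0..1} (\<lambda>t. t ^ j * F (p + t *\<^sub>R (x - p)))) has_derivative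
    (\<lambda>v. integral {0..1} (\<lambda>t. t ^ (j + 1) * frechet_derivative F (at (p + t *\<^sub>R (x - p))) v))) (at x)"
proof -
  let ?F' = "\<lambda>y. frechet_derivative F (at y)"
  have seg: "p + t *\<^sub>R (x - p) \<in> S" if "x \<in> S" "t \<in> {0..1}" for x t
  proof -
    have "p + t *\<^sub>R (x - p) = (1 - t) *\<^sub>R p + t *\<^sub>R x" by (simp add: algebra_simps)
    then show ?thesis using S(2,3) that by (simp add: convexD_alt)
  qed
  have bl: "bounded_linear (?F' y)" if "y \<in> S" for y
    using smooth_on_has_derivative[OF F that] has_derivative_bounded_linear by blast
  \<comment> \<open>\<open>leibniz_rule\<close> asks for continuity in operator norm, which is checked on basis vectors\<close>
  define D where "D x t = Blinfun (\<lambda>v. t ^ (j + 1) * ?F' (p + t *\<^sub>R (x - p)) v)" for x and t :: real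
  have D: "blinfun_apply (D x t) = (\<lambda>v. t ^ (j + 1) * ?F' (p + t *\<^sub>R (x - p)) v)"
    if "x \<in> S" "t \<in> {0..1}" for x t
    unfolding D_def by (intro bounded_linear_Blinfun_apply bounded_linear_const_mult bl seg that)
  have cont_seg: "continuous_on (S \<times> {0..1}) (\<lambda>z. h (p + snd z *\<^sub>R (fst z - p)))"
    if "smooth_on h S" for h :: "'e \<Rightarrow> real"
    by (rule continuous_on_compose2[OF smooth_on_continuous[OF that]])
      (auto intro!: continuous_intros seg)
  have cont_D: "continuous_on (S \<times> {0..1}) (\<lambda>(x, t). D x t)"
    unfolding case_prod_beta
  proof (rule continuous_on_blinfun_componentwise)
    fix i :: 'e
    have "continuous_on (S \<times> {0..1}) (\<lambda>z. snd z ^ (j + 1) * ?F' (p + snd z *\<^sub>R (fst z - p)) i)"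
      by (intro continuous_intros cont_seg smooth_on_frechet_derivative F)
    then show "continuous_on (S \<times> {0..1}) (\<lambda>z. blinfun_apply (D (fst z) (snd z)) i)"
      by (rule continuous_on_eq) (use D in auto)
  qed
  have cont1: "continuous_on {0..1} (\<lambda>t. t ^ n * h (p + t *\<^sub>R (x - p)))"
    if "x \<in> S" "smooth_on h S" for x n and h :: "'e \<Rightarrow> real"
    by (intro continuous_intros continuous_on_compose2[OF smooth_on_continuous[OF that(2)]])
      (use seg that in auto)
  have "((\<lambda>x. integral (cbox 0 1) (\<lambda>t. t ^ j * F (p + t *\<^sub>R (x - p)))) has_derivative
      blinfun_apply (integral (cbox 0 1) (D x))) (at x within S)"
  proof (rule leibniz_rule[OF _ _ _ x S(2)])
    fix x t assume xt: "x \<in> S" "t \<in> cbox 0 (1::real)"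
    have F': "(F has_derivative ?F' (p + t *\<^sub>R (x - p))) (at (p + t *\<^sub>R (x - p)))"
      using smooth_on_has_derivative[OF F seg] xt by simp
    interpret bounded_linear "?F' (p + t *\<^sub>R (x - p))"
      using F' has_derivative_bounded_linear by blast
    have "((\<lambda>x. p + t *\<^sub>R (x - p)) has_derivative (\<lambda>v. t *\<^sub>R v)) (at x within S)"
      by (auto intro!: derivative_eq_intros)
    from has_derivative_compose[OF this F']
    have "((\<lambda>x. t ^ j * F (p + t *\<^sub>R (x - p))) has_derivative
        (\<lambda>v. t ^ j * ?F' (p + t *\<^sub>R (x - p)) (t *\<^sub>R v))) (at x within S)"
      by (intro has_derivative_mult_right) (simp add: o_def)
    moreover have "blinfun_apply (D x t) = (\<lambda>v. t ^ j * ?F' (p + t *\<^sub>R (x - p)) (t *\<^sub>R v))"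
      using xt by (auto simp: D scaleR)
    ultimately show "((\<lambda>x. t ^ j * F (p + t *\<^sub>R (x - p))) has_derivative blinfun_apply (D x t)) (at x within S)"
      by (simp only:)
  next
    show "(\<lambda>t. t ^ j * F (p + t *\<^sub>R (x - p))) integrable_on cbox 0 1" if "x \<in> S" for x
      using cont1[OF that F] by (intro integrable_continuous) auto
  next
    show "continuous_on (S \<times> cbox 0 1) (\<lambda>(x, t). D x t)" using cont_D by simp
  qed
  moreover have "blinfun_apply (integral (cbox 0 1) (D x)) v =
      integral {0..1} (\<lambda>t. t ^ (j + 1) * ?F' (p + t *\<^sub>R (x - p)) v)" for v
  proof -
    have "continuous_on {0..1} (\<lambda>t. D x t)"
      using continuous_on_compose2[OF cont_D, of "{0..1}" "\<lambda>t. (x, t)"] x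
      by (simp add: continuous_on_Pair image_subset_iff)
    then have "D x integrable_on cbox 0 1" by (intro integrable_continuous) simp
    then have "blinfun_apply (integral (cbox 0 1) (D x)) v = integral {0..1} (\<lambda>t. blinfun_apply (D x t) v)"
      by (simp add: blinfun_apply_integral)
    also have "\<dots> = integral {0..1} (\<lambda>t. t ^ (j + 1) * ?F' (p + t *\<^sub>R (x - p)) v)"
      using D x by (intro integral_cong) auto
    finally show ?thesis .
  qed
  then have "blinfun_apply (integral (cbox 0 1) (D x)) =
      (\<lambda>v. integral {0..1} (\<lambda>t. t ^ (j + 1) * ?F' (p + t *\<^sub>R (x - p)) v))"
    by (rule ext)
  ultimately show ?thesis
    using at_within_open[OF x S(1)] by simp
qed

lemma smooth_on_segment_integral:
  fixes F :: "'e::euclidean_space \<Rightarrow> real"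
  assumes S: "open S" "convex S" "p \<in> S" and F: "smooth_on F S"
  shows "smooth_on (\<lambda>x. integral {0..1} (\<lambda>t. F (p + t *\<^sub>R (x - p)))) S"
proof -
  have "Ck_on k (\<lambda>x. integral {0..1} (\<lambda>t. t ^ j * F (p + t *\<^sub>R (x - p)))) S" for k j
    using F
  proof (induction k arbitrary: F j)
    case 0
    then show ?case
      using segment_integral_has_derivative[OF S 0] has_derivative_continuous
      by (fastforce intro!: continuous_at_imp_continuous_on)
  next
    case (Suc k)
    show ?case
      by (rule Ck_on_SucI[OF S(1) segment_integral_has_derivative[OF S Suc.prems]])
        (auto intro!: Suc.IH smooth_on_frechet_derivative Suc.prems simp del: power_Suc)
  qed
  from this[of _ 0] show ?thesis by (simp add: smooth_on_def)
qed

text \<open>The coefficient functions are the means of the partial derivatives over the segment from \<open>p\<close> to \<open>x\<close>.\<close>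

lemma hadamard:
  fixes f :: "'e::euclidean_space \<Rightarrow> real"
  assumes S: "open S" "convex S" "p \<in> S" and f: "smooth_on f S"
  obtains h where "\<And>b. smooth_on (h b) S" "\<And>b. h b p = frechet_derivative f (at p) b"
    "\<And>x. x \<in> S \<Longrightarrow> f x = f p + (\<Sum>b\<in>Basis. ((x - p) \<bullet> b) * h b x)"
proof
  let ?h = "\<lambda>b x. integral {0..1} (\<lambda>t. frechet_derivative f (at (p + t *\<^sub>R (x - p))) b)"
  show "smooth_on (?h b) S" for b
    by (rule smooth_on_segment_integral[OF S smooth_on_frechet_derivative[OF f]])
  show "?h b p = frechet_derivative f (at p) b" for b by simp
  show "f x = f p + (\<Sum>b\<in>Basis. ((x - p) \<bullet> b) * ?h b x)" if x: "x \<in> S" for x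
  proof -
    have seg: "p + t *\<^sub>R (x - p) \<in> S" if "t \<in> {0..1}" for t
    proof -
      have "p + t *\<^sub>R (x - p) = (1 - t) *\<^sub>R p + t *\<^sub>R x" by (simp add: algebra_simps)
      then show ?thesis using S(2,3) that x by (simp add: convexD_alt)
    qed
    let ?D = "\<lambda>t. frechet_derivative f (at (p + t *\<^sub>R (x - p)))"
    have rep: "?D t (x - p) = (\<Sum>b\<in>Basis. ((x - p) \<bullet> b) * ?D t b)" if "t \<in> {0..1}" for t
    proof -
      interpret bounded_linear "?D t"
        using smooth_on_has_derivative[OF f seg[OF that]] has_derivative_bounded_linear by blast
      have "?D t (x - p) = ?D t (\<Sum>b\<in>Basis. ((x - p) \<bullet> b) *\<^sub>R b)"
        by (simp only: euclidean_representation)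
      also have "\<dots> = (\<Sum>b\<in>Basis. ((x - p) \<bullet> b) * ?D t b)"
        unfolding sum by (intro sum.cong refl) (simp only: scaleR real_scaleR_def)
      finally show ?thesis .
    qed
    have "((\<lambda>t. f (p + t *\<^sub>R (x - p))) has_vector_derivative ?D t (x - p)) (at t within {0..1})"
      if "t \<in> {0..1}" for t
    proof -
      have "((\<lambda>t. p + t *\<^sub>R (x - p)) has_derivative (\<lambda>s. s *\<^sub>R (x - p))) (at t within {0..1})"
        by (auto intro!: derivative_eq_intros)
      from has_derivative_compose[OF this smooth_on_has_derivative[OF f seg[OF that]]]
      moreover have "linear (?D t)"
        using smooth_on_has_derivative[OF f seg[OF that]]
        by (intro linear_frechet_derivative) (rule differentiableI)
      ultimately show ?thesis
        by (simp add: has_vector_derivative_def o_def linear_scale)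
    qed
    then have "((\<lambda>t. ?D t (x - p)) has_integral f x - f p) {0..1}"
      using fundamental_theorem_of_calculus[of 0 1 "\<lambda>t. f (p + t *\<^sub>R (x - p))"] by auto
    then have "f x - f p = integral {0..1} (\<lambda>t. ?D t (x - p))" by (simp add: integral_unique)
    also have "\<dots> = integral {0..1} (\<lambda>t. \<Sum>b\<in>Basis. ((x - p) \<bullet> b) * ?D t b)"
      by (intro integral_cong rep) 
    also have "\<dots> = (\<Sum>b\<in>Basis. integral {0..1} (\<lambda>t. ((x - p) \<bullet> b) * ?D t b))"
    proof (intro integral_sum finite_Basis integrable_on_cmult_left)
      fix b :: 'e
      have "continuous_on {0..1} (\<lambda>t. ?D t b)"
        by (rule continuous_on_compose2[OF smooth_on_continuous[OF smooth_on_frechet_derivative[OF f]]])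
          (use seg in \<open>auto intro!: continuous_intros\<close>)
      then have "(\<lambda>t. ?D t b) integrable_on {0..1}" by (rule integrable_continuous_interval)
      from integrable_on_cmult_left[OF this, of "(x - p) \<bullet> b"]
      show "(\<lambda>t. ((x - p) \<bullet> b) * ?D t b) integrable_on {0..1}" by simp
    qed
    finally show ?thesis by simp
  qed
qed

section \<open>Smooth functions, tangent vectors and vector fields\<close>

lemma linear_Basis_expansion:
  fixes f :: "'e::euclidean_space \<Rightarrow> real"
  assumes "linear f"
  shows "f w = (\<Sum>b\<in>Basis. (w \<bullet> b) * f b)"
proof -
  have "f w = f (\<Sum>b\<in>Basis. (w \<bullet> b) *\<^sub>R b)" by (simp only: euclidean_representation)
  also have "\<dots> = (\<Sum>b\<in>Basis. (w \<bullet> b) * f b)"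
    unfolding linear_sum[OF assms] by (simp add: linear_scale[OF assms])
  finally show ?thesis .
qed

lemma tscale_apply [simp]: "tscale c v f = c * v f"
  by (simp add: tscale_def)

lemma tscale_simps [simp]:
  "tscale 0 v = 0" "tscale 1 v = v" "tscale c 0 = 0" "tscale c (tscale d v) = tscale (c * d) v"
  "tscale c (- v) = tscale (- c) v" "- tscale c v = tscale (- c) v"
  by (auto simp: tscale_def)

lemma tscale_add: "tscale c (v + w) = tscale c v + tscale c w"
  by (auto simp: tscale_def algebra_simps)

lemma tscale_diff: "tscale c (v - w) = tscale c v - tscale c w"
  by (auto simp: tscale_def algebra_simps)

lemma tscale_left_add: "tscale (c + d) v = tscale c v + tscale d v"
  by (auto simp: tscale_def algebra_simps)

lemma tscale_left_diff: "tscale (c - d) v = tscale c v - tscale d v"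
  by (auto simp: tscale_def algebra_simps)

lemma sum_fun_apply: "(\<Sum>i\<in>I. X i) f = (\<Sum>i\<in>I. X i f)"
  by (induction I rule: infinite_finite_induct) auto

lemma tscale_sum: "tscale c (\<Sum>i\<in>I. X i) = (\<Sum>i\<in>I. tscale c (X i))"
  by (auto simp: sum_fun_apply sum_distrib_left)

lemma chart_facts:
  assumes "is_chart (U, \<phi>)"
  shows "open U" "open (\<phi> ` U)" "continuous_on U \<phi>" "continuous_on (\<phi> ` U) (inv_into U \<phi>)"
    "x \<in> U \<Longrightarrow> inv_into U \<phi> (\<phi> x) = x" "inj_on \<phi> U"
    "open W \<Longrightarrow> W \<subseteq> U \<Longrightarrow> open (\<phi> ` W)"
proof -
  have h: "homeomorphism U (\<phi> ` U) \<phi> (inv_into U \<phi>)" and o: "open U" "open (\<phi> ` U)"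
    using assms by (auto simp: is_chart_def)
  show "open U" "open (\<phi> ` U)" by (fact o)+
  show "continuous_on U \<phi>" "continuous_on (\<phi> ` U) (inv_into U \<phi>)"
    using homeomorphism_cont1[OF h] homeomorphism_cont2[OF h] by auto
  show inv: "inv_into U \<phi> (\<phi> x) = x" if "x \<in> U" for x
    using homeomorphism_apply1[OF h that] .
  show "inj_on \<phi> U" by (rule inj_on_inverseI[where g = "inv_into U \<phi>"]) (rule inv)
  show "open (\<phi> ` W)" if "open W" "W \<subseteq> U"
  proof -
    have "openin (top_of_set U) W" using that o by (simp add: openin_open_eq)
    from homeomorphism_imp_open_map[OF h this] show ?thesis
      using o by (simp add: openin_open_eq)
  qed
qed

lemma open_chart_preimage:
  assumes "is_chart (U, \<phi>)" "open B"
  shows "open {x \<in> U. \<phi> x \<in> B}"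
  using continuous_open_preimage[OF chart_facts(3,1)[OF assms(1)] assms(2)]
  by (simp add: vimage_def Int_def)

locale smooth_manifold =
  fixes A :: "('a::t2_space, 'n::finite) chart set"
  assumes atlas: "smooth_atlas A"
begin

abbreviation "SF \<equiv> smooth_fun_on A"
abbreviation "near \<equiv> smooth_near A"
abbreviation "TS \<equiv> tangent_space A"
abbreviation "VF \<equiv> vector_fields A"
abbreviation bracket :: "'a vfield \<Rightarrow> 'a vfield \<Rightarrow> 'a vfield" where "bracket \<equiv> lie_bracket A"
abbreviation fscale :: "('a \<Rightarrow> real) \<Rightarrow> 'a vfield \<Rightarrow> 'a vfield" where
  "fscale f X \<equiv> (\<lambda>x. tscale (f x) (X x))"

text \<open>
  Foliated charts need not belong to the atlas \<open>A\<close>. Coordinates are therefore taken in any chart with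
  smooth transitions from and to \<open>A\<close>.
\<close>

definition admissible :: "('a, 'n) chart \<Rightarrow> bool" where
  "admissible c \<longleftrightarrow> is_chart c \<and> (\<forall>d\<in>A. smooth_transition c d \<and> smooth_transition d c)"

lemma admissible_chart: "admissible c \<Longrightarrow> is_chart c"
  by (simp add: admissible_def)

lemma admissible_transition:
  assumes "admissible (U, \<phi>)" "(V, \<eta>) \<in> A"
  shows "smooth_on (\<lambda>y. \<eta> (inv_into U \<phi> y)) (\<phi> ` (U \<inter> V))"
    "smooth_on (\<lambda>y. \<phi> (inv_into V \<eta> y)) (\<eta> ` (V \<inter> U))"
proof -
  have "smooth_transition (U, \<phi>) (V, \<eta>)" "smooth_transition (V, \<eta>) (U, \<phi>)"
    using assms unfolding admissible_def by blast+
  then show "smooth_on (\<lambda>y. \<eta> (inv_into U \<phi> y)) (\<phi> ` (U \<inter> V))"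
    "smooth_on (\<lambda>y. \<phi> (inv_into V \<eta> y)) (\<eta> ` (V \<inter> U))"
    by (simp_all add: smooth_transition_def o_def)
qed

lemma admissible_atlas: "c \<in> A \<Longrightarrow> admissible c"
  using atlas by (auto simp: admissible_def smooth_atlas_def)

lemma atlas_chart_at: obtains V \<eta> where "(V, \<eta>) \<in> A" "x \<in> V"
proof -
  have "x \<in> (\<Union>c\<in>A. fst c)" using atlas by (simp add: smooth_atlas_def)
  then show ?thesis using that by auto
qed

lemma admissible_chart_at: obtains V \<eta> where "admissible (V, \<eta>)" "x \<in> V"
  using atlas_chart_at[of x] admissible_atlas by metis

lemma atlas_chart_facts:
  assumes "(V, \<eta>) \<in> A"
  shows "open V" "open (\<eta> ` V)" "continuous_on V \<eta>" "continuous_on (\<eta> ` V) (inv_into V \<eta>)"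
    "x \<in> V \<Longrightarrow> inv_into V \<eta> (\<eta> x) = x" "inj_on \<eta> V"
    "open W \<Longrightarrow> W \<subseteq> V \<Longrightarrow> open (\<eta> ` W)"
  using chart_facts[OF admissible_chart[OF admissible_atlas[OF assms]]] by auto

subsection \<open>Smooth functions\<close>

lemma SF_atlas:
  "SF W f \<longleftrightarrow> (\<forall>V \<eta>. (V, \<eta>) \<in> A \<longrightarrow> smooth_on (\<lambda>y. f (inv_into V \<eta> y)) (\<eta> ` (V \<inter> W)))"
  by (auto simp: smooth_fun_on_def o_def)

lemma open_chart_image: "(V, \<eta>) \<in> A \<Longrightarrow> open W \<Longrightarrow> open (\<eta> ` (V \<inter> W))"
  by (intro atlas_chart_facts(7)) (auto intro: atlas_chart_facts(1))

lemma SF_cong: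
  assumes "open W" "\<And>x. x \<in> W \<Longrightarrow> f x = h x" "SF W f"
  shows "SF W h"
  unfolding SF_atlas
proof (intro allI impI)
  fix V \<eta> assume c: "(V, \<eta>) \<in> A"
  show "smooth_on (\<lambda>y. h (inv_into V \<eta> y)) (\<eta> ` (V \<inter> W))"
    by (rule smooth_on_cong[where f = "\<lambda>y. f (inv_into V \<eta> y)"])
      (use assms c open_chart_image[OF c] in \<open>auto simp: SF_atlas atlas_chart_facts(5)[OF c]\<close>)
qed

lemma SF_subset: "SF W f \<Longrightarrow> W' \<subseteq> W \<Longrightarrow> SF W' f"
  unfolding SF_atlas using smooth_on_subset[OF _ image_mono[OF Int_mono[OF subset_refl]]] by metis

lemma SF_local:
  assumes "\<And>x. x \<in> W \<Longrightarrow> \<exists>W'. open W' \<and> x \<in> W' \<and> SF W' f"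
  shows "SF W f"
  unfolding SF_atlas
proof (intro allI impI smooth_on_local)
  fix V \<eta> y assume c: "(V, \<eta>) \<in> A" and y: "y \<in> \<eta> ` (V \<inter> W)"
  then obtain x W' where "x \<in> V" "y = \<eta> x" "open W'" "x \<in> W'" "SF W' f" using assms by blast
  then show "\<exists>S'. open S' \<and> y \<in> S' \<and> smooth_on (\<lambda>y. f (inv_into V \<eta> y)) S'"
    using c open_chart_image[OF c] by (intro exI[of _ "\<eta> ` (V \<inter> W')"]) (auto simp: SF_atlas)
qed

lemma SF_const: "SF W (\<lambda>x. c)"
  by (simp add: SF_atlas smooth_on_const)

lemma SF_add: "open W \<Longrightarrow> SF W f \<Longrightarrow> SF W h \<Longrightarrow> SF W (\<lambda>x. f x + h x)"
  unfolding SF_atlas by (auto intro!: smooth_on_add open_chart_image)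

lemma SF_mult: "open W \<Longrightarrow> SF W f \<Longrightarrow> SF W h \<Longrightarrow> SF W (\<lambda>x. f x * h x)"
  unfolding SF_atlas by (auto intro!: smooth_on_mult open_chart_image)

lemma SF_cmult: "open W \<Longrightarrow> SF W f \<Longrightarrow> SF W (\<lambda>x. c * f x)"
  by (rule SF_mult[OF _ SF_const])

lemma SF_uminus: "open W \<Longrightarrow> SF W f \<Longrightarrow> SF W (\<lambda>x. - f x)"
  using SF_cmult[of W f "-1"] by simp

lemma SF_diff: "open W \<Longrightarrow> SF W f \<Longrightarrow> SF W h \<Longrightarrow> SF W (\<lambda>x. f x - h x)"
  using SF_add[of W f "\<lambda>x. - h x"] SF_uminus by auto

lemma SF_sum: "open W \<Longrightarrow> (\<And>i. i \<in> I \<Longrightarrow> SF W (f i)) \<Longrightarrow> SF W (\<lambda>x. \<Sum>i\<in>I. f i x)"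
  by (induction I rule: infinite_finite_induct) (auto intro: SF_const SF_add)

lemma SF_compose:
  assumes "open W" "SF W f" "open S" "f ` W \<subseteq> S" "smooth_on h S"
  shows "SF W (\<lambda>x. h (f x))"
  unfolding SF_atlas
proof (intro allI impI)
  fix V \<eta> assume c: "(V, \<eta>) \<in> A"
  show "smooth_on (\<lambda>y. h (f (inv_into V \<eta> y))) (\<eta> ` (V \<inter> W))"
    by (rule smooth_on_compose[OF open_chart_image[OF c assms(1)] assms(3) _ assms(5)])
      (use assms(2,4) c in \<open>auto simp: SF_atlas atlas_chart_facts(5)[OF c]\<close>)
qed

lemma SF_inverse_sqrt:
  assumes "open W" "SF W f" "\<And>x. x \<in> W \<Longrightarrow> f x > 0"
  shows "SF W (\<lambda>x. inverse (sqrt (f x)))"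
proof -
  have "SF W (\<lambda>x. sqrt (f x))"
    by (rule SF_compose[OF assms(1,2) _ _ smooth_on_sqrt]) (use assms(3) in auto)
  then show ?thesis
    by (rule SF_compose[OF assms(1) _ _ _ smooth_on_inverse]) (use assms(3) in fastforce)+
qed

text \<open>
  Near each point the representations of \<open>f\<close> in two charts differ by a smooth transition map, so
  one chart covering \<open>W\<close> suffices.
\<close>

lemma SF_iff_chart:
  assumes adm: "admissible (U, \<phi>)" and W: "open W" "W \<subseteq> U"
  shows "SF W f \<longleftrightarrow> smooth_on (\<lambda>y. f (inv_into U \<phi> y)) (\<phi> ` W)"
proof
  note U = chart_facts[OF admissible_chart[OF adm]]
  assume f: "SF W f"
  show "smooth_on (\<lambda>y. f (inv_into U \<phi> y)) (\<phi> ` W)"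
  proof (rule smooth_on_local)
    fix y assume "y \<in> \<phi> ` W"
    then obtain x where x: "x \<in> W" "y = \<phi> x" by auto
    obtain V \<eta> where c: "(V, \<eta>) \<in> A" "x \<in> V" by (rule atlas_chart_at)
    note V = atlas_chart_facts[OF c(1)]
    let ?S = "\<phi> ` (V \<inter> W)"
    have o: "open ?S" using W V(1) by (intro U(7)) auto
    have t: "smooth_on (\<lambda>y. \<eta> (inv_into U \<phi> y)) ?S"
      using admissible_transition(1)[OF adm c(1)] by (rule smooth_on_subset) (use W(2) in auto)
    have "smooth_on (\<lambda>y. f (inv_into V \<eta> (\<eta> (inv_into U \<phi> y)))) ?S"
      by (rule smooth_on_compose[OF o open_chart_image[OF c(1) W(1)] _ _ t])
        (use f c(1) W U(5) in \<open>auto simp: SF_atlas subset_iff\<close>)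
    then have "smooth_on (\<lambda>y. f (inv_into U \<phi> y)) ?S"
      by (rule smooth_on_cong[OF o, rotated]) (use W V(5) U(5) in \<open>auto simp: subset_iff\<close>)
    then show "\<exists>S'. open S' \<and> y \<in> S' \<and> smooth_on (\<lambda>y. f (inv_into U \<phi> y)) S'"
      using o x c(2) by (intro exI[of _ ?S]) auto
  qed
next
  note U = chart_facts[OF admissible_chart[OF adm]]
  assume f: "smooth_on (\<lambda>y. f (inv_into U \<phi> y)) (\<phi> ` W)"
  show "SF W f"
    unfolding SF_atlas
  proof (intro allI impI)
    fix V \<eta> assume c: "(V, \<eta>) \<in> A"
    note V = atlas_chart_facts[OF c(1)]
    let ?S = "\<eta> ` (V \<inter> W)"
    have o: "open ?S" using W V(1) by (intro V(7)) auto
    have t: "smooth_on (\<lambda>y. \<phi> (inv_into V \<eta> y)) ?S"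
      using admissible_transition(2)[OF adm c] by (rule smooth_on_subset) (use W(2) in auto)
    have "smooth_on (\<lambda>y. f (inv_into U \<phi> (\<phi> (inv_into V \<eta> y)))) ?S"
      by (rule smooth_on_compose[OF o U(7)[OF W] _ f t]) (use V(5) in auto)
    then show "smooth_on (\<lambda>y. f (inv_into V \<eta> y)) ?S"
      by (rule smooth_on_cong[OF o, rotated]) (use W V(5) U(5) in \<open>auto simp: subset_iff\<close>)
  qed
qed

lemma SF_chart_compose:
  assumes adm: "admissible (U, \<phi>)" and W: "open W" "W \<subseteq> U" and h: "smooth_on h S" "\<phi> ` W \<subseteq> S"
  shows "SF W (\<lambda>x. h (\<phi> x))"
  unfolding SF_iff_chart[OF adm W]
  by (rule smooth_on_cong[OF chart_facts(7)[OF admissible_chart[OF adm] W] _ smooth_on_subset[OF h]])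
    (use W chart_facts(5)[OF admissible_chart[OF adm]] in \<open>auto simp: subset_iff\<close>)

lemma SF_coordinate: "admissible (U, \<phi>) \<Longrightarrow> open W \<Longrightarrow> W \<subseteq> U \<Longrightarrow> SF W (\<lambda>x. \<phi> x $ i)"
  by (rule SF_chart_compose[where S = UNIV and h = "\<lambda>y. y $ i"])
    (auto intro!: smooth_on_bounded_linear[OF _ _ smooth_on_id] bounded_linear_vec_nth)

lemma SF_continuous:
  assumes "open W" "SF W f"
  shows "continuous_on W f"
proof -
  have "isCont f x" if x: "x \<in> W" for x
  proof -
    obtain V \<eta> where c: "(V, \<eta>) \<in> A" "x \<in> V" by (rule atlas_chart_at)
    note V = atlas_chart_facts[OF c(1)]
    have "smooth_on (\<lambda>y. f (inv_into V \<eta> y)) (\<eta> ` (V \<inter> W))"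
      using assms(2) c(1) by (simp add: SF_atlas)
    from continuous_on_compose2[OF smooth_on_continuous[OF this] continuous_on_subset[OF V(3)], of "V \<inter> W"]
    have "continuous_on (V \<inter> W) (\<lambda>x. f (inv_into V \<eta> (\<eta> x)))" by auto
    then have "continuous_on (V \<inter> W) f" by (rule continuous_on_eq) (use V(5) in auto)
    then show ?thesis using c(2) x assms(1) V(1) by (simp add: continuous_on_eq_continuous_at open_Int)
  qed
  then show ?thesis by (simp add: continuous_at_imp_continuous_on)
qed

lemma nearI: "open W \<Longrightarrow> p \<in> W \<Longrightarrow> SF W f \<Longrightarrow> near p f"
  by (auto simp: smooth_near_def)

lemma nearE:
  assumes "near p f" "open U" "p \<in> U"
  obtains W where "open W" "p \<in> W" "W \<subseteq> U" "SF W f"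
proof -
  obtain W where W: "open W" "p \<in> W" "SF W f" using assms(1) by (auto simp: smooth_near_def)
  show ?thesis by (rule that[of "W \<inter> U"]) (use W assms in \<open>auto intro: SF_subset\<close>)
qed

lemma near_cong:
  assumes "open W" "p \<in> W" "\<And>x. x \<in> W \<Longrightarrow> f x = h x" "near p f"
  shows "near p h"
proof -
  obtain W' where W': "open W'" "p \<in> W'" "W' \<subseteq> W" "SF W' f" using nearE[OF assms(4,1,2)] .
  show ?thesis by (rule nearI[OF W'(1,2) SF_cong[OF W'(1) _ W'(4)]]) (use assms(3) W'(3) in auto)
qed

lemma near_common:
  assumes "near p f" "near p h"
  obtains W where "open W" "p \<in> W" "SF W f" "SF W h"
proof -
  obtain W where W: "open W" "p \<in> W" "SF W f" using nearE[OF assms(1) open_UNIV UNIV_I] .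
  obtain W' where W': "open W'" "p \<in> W'" "W' \<subseteq> W" "SF W' h" using nearE[OF assms(2) W(1,2)] .
  show ?thesis by (rule that[OF W'(1,2) SF_subset[OF W(3) W'(3)] W'(4)])
qed

lemma near_const: "near p (\<lambda>x. c)"
  by (rule nearI[of UNIV]) (auto intro: SF_const)

lemma near_add: "near p f \<Longrightarrow> near p h \<Longrightarrow> near p (\<lambda>x. f x + h x)"
  by (erule near_common, assumption) (blast intro: nearI SF_add)

lemma near_mult: "near p f \<Longrightarrow> near p h \<Longrightarrow> near p (\<lambda>x. f x * h x)"
  by (erule near_common, assumption) (blast intro: nearI SF_mult)

lemma near_cmult: "near p f \<Longrightarrow> near p (\<lambda>x. c * f x)"
  by (rule near_mult[OF near_const])

lemma near_diff: "near p f \<Longrightarrow> near p h \<Longrightarrow> near p (\<lambda>x. f x - h x)"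
  by (erule near_common, assumption) (blast intro: nearI SF_diff)

lemma near_sum: "(\<And>i. i \<in> I \<Longrightarrow> near p (f i)) \<Longrightarrow> near p (\<lambda>x. \<Sum>i\<in>I. f i x)"
  by (induction I rule: infinite_finite_induct) (auto intro: near_const near_add)

subsection \<open>Tangent vectors\<close>

lemma TS_nonsmooth: "v \<in> TS p \<Longrightarrow> \<not> near p f \<Longrightarrow> v f = 0"
  by (simp add: tangent_space_def)

lemma TS_cmult: "v \<in> TS p \<Longrightarrow> near p f \<Longrightarrow> v (\<lambda>x. c * f x) = c * v f"
  by (simp add: tangent_space_def)

lemma TS_add: "v \<in> TS p \<Longrightarrow> near p f \<Longrightarrow> near p h \<Longrightarrow> v (\<lambda>x. f x + h x) = v f + v h"
  by (simp add: tangent_space_def)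

lemma TS_mult: "v \<in> TS p \<Longrightarrow> near p f \<Longrightarrow> near p h \<Longrightarrow> v (\<lambda>x. f x * h x) = f p * v h + h p * v f"
  by (simp add: tangent_space_def)

lemma TS_diff: "v \<in> TS p \<Longrightarrow> near p f \<Longrightarrow> near p h \<Longrightarrow> v (\<lambda>x. f x - h x) = v f - v h"
  using TS_add[of v p f "\<lambda>x. - 1 * h x"] TS_cmult[of v p h "- 1"] near_cmult[of p h "- 1"] by simp

lemma TS_const: "v \<in> TS p \<Longrightarrow> v (\<lambda>x. c) = 0"
  using TS_mult[of v p "\<lambda>x. 1" "\<lambda>x. 1"] TS_cmult[of v p "\<lambda>x. 1" c] near_const[of p 1] by simp

lemma TS_sum:
  "v \<in> TS p \<Longrightarrow> (\<And>i. i \<in> I \<Longrightarrow> near p (f i)) \<Longrightarrow> v (\<lambda>x. \<Sum>i\<in>I. f i x) = (\<Sum>i\<in>I. v (f i))"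
proof (induction I rule: infinite_finite_induct)
  case (insert i I)
  then show ?case using TS_add[of v p "f i" "\<lambda>x. \<Sum>i\<in>I. f i x"] near_sum[of I p f] by simp
qed (simp_all add: TS_const)

text \<open>
  Derivations are local: multiplying by the indicator \<open>e\<close> of a neighbourhood changes nothing,
  because \<open>e\<close> is idempotent and so is killed by any derivation.
\<close>

lemma TS_cong:
  assumes v: "v \<in> TS p" and W: "open W" "p \<in> W" and eq: "\<And>x. x \<in> W \<Longrightarrow> f x = h x"
  shows "v f = v h"
proof (cases "near p f")
  case True
  then have h: "near p h" using near_cong[OF W, of f h] eq by blast
  let ?e = "indicator W :: 'a \<Rightarrow> real"
  have e: "near p ?e" by (rule near_cong[OF W _ near_const[of p 1]]) simp
  have "v (\<lambda>x. ?e x * ?e x) = 2 * v ?e" using TS_mult[OF v e e] W by simp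
  moreover have "(\<lambda>x. ?e x * ?e x) = ?e" by (auto simp: indicator_def)
  ultimately have "v ?e = 0" by simp
  then have "v f = v (\<lambda>x. f x * ?e x)" "v h = v (\<lambda>x. h x * ?e x)"
    using TS_mult[OF v True e] TS_mult[OF v h e] W by auto
  moreover have "(\<lambda>x. f x * ?e x) = (\<lambda>x. h x * ?e x)" using eq by (auto simp: indicator_def)
  ultimately show ?thesis by simp
next
  case False
  then have "\<not> near p h" using near_cong[OF W, of h f] eq by auto
  then show ?thesis using False TS_nonsmooth[OF v] by simp
qed

lemma TS_cong_near:
  assumes v: "v \<in> TS p" and U: "open U" "p \<in> U" and f: "near p f" "near p f'"
    and eq: "\<And>x. x \<in> U \<Longrightarrow> near x f \<Longrightarrow> near x f' \<Longrightarrow> h x = h' x"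
  shows "v h = v h'"
proof -
  obtain W where W: "open W" "p \<in> W" "W \<subseteq> U" "SF W f" using nearE[OF f(1) U] .
  obtain W' where W': "open W'" "p \<in> W'" "W' \<subseteq> W" "SF W' f'" using nearE[OF f(2) W(1,2)] .
  show ?thesis
    by (rule TS_cong[OF v W'(1,2)], rule eq)
      (use W W' nearI[OF W(1)] nearI[OF W'(1)] in blast)+
qed

lemma TS_zero: "0 \<in> TS p"
  by (simp add: tangent_space_def)

lemma TS_plus: "v \<in> TS p \<Longrightarrow> w \<in> TS p \<Longrightarrow> v + w \<in> TS p"
  by (auto simp: tangent_space_def algebra_simps)

lemma TS_scale: "v \<in> TS p \<Longrightarrow> tscale c v \<in> TS p"
  by (auto simp: tangent_space_def algebra_simps)

lemma TS_uminus: "v \<in> TS p \<Longrightarrow> - v \<in> TS p"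
  using TS_scale[of v p "- 1"] by (simp add: tscale_def fun_Compl_def)

lemma TS_minus: "v \<in> TS p \<Longrightarrow> w \<in> TS p \<Longrightarrow> v - w \<in> TS p"
  using TS_plus[OF _ TS_uminus, of v p w] by simp

lemma TS_sum_mem: "(\<And>i. i \<in> I \<Longrightarrow> v i \<in> TS p) \<Longrightarrow> (\<Sum>i\<in>I. v i) \<in> TS p"
  by (induction I rule: infinite_finite_induct) (auto intro: TS_zero TS_plus)

definition vcoord :: "('a \<Rightarrow> real ^ 'n) \<Rightarrow> 'a tvec \<Rightarrow> real ^ 'n" where
  "vcoord \<phi> v = (\<chi> i. v (\<lambda>x. \<phi> x $ i))"

lemma vcoord_Basis: "b \<in> Basis \<Longrightarrow> vcoord \<phi> v \<bullet> b = v (\<lambda>x. \<phi> x \<bullet> b)"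
  by (auto simp: Basis_vec_def inner_axis vcoord_def)

lemma SF_coordinate_Basis:
  "admissible (U, \<phi>) \<Longrightarrow> open W \<Longrightarrow> W \<subseteq> U \<Longrightarrow> b \<in> Basis \<Longrightarrow> SF W (\<lambda>x. \<phi> x \<bullet> b)"
  by (auto simp: Basis_vec_def inner_axis intro: SF_coordinate)

text \<open>By Hadamard's lemma a tangent vector is the directional derivative along its coordinates.\<close>

lemma TS_chart:
  assumes adm: "admissible (U, \<phi>)" and p: "p \<in> U" and v: "v \<in> TS p" and f: "near p f"
  shows "v f = frechet_derivative (\<lambda>y. f (inv_into U \<phi> y)) (at (\<phi> p)) (vcoord \<phi> v)"
proof -
  note c = admissible_chart[OF adm]
  note U = chart_facts[OF c]
  obtain W where W: "open W" "p \<in> W" "W \<subseteq> U" "SF W f" using nearE[OF f U(1) p] .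
  let ?F = "\<lambda>y. f (inv_into U \<phi> y)"
  have F: "smooth_on ?F (\<phi> ` W)" using SF_iff_chart[OF adm W(1,3)] W(4) by simp
  obtain r where r: "r > 0" "ball (\<phi> p) r \<subseteq> \<phi> ` W"
    using U(7)[OF W(1,3)] W(2) by (metis image_eqI open_contains_ball)
  let ?B = "ball (\<phi> p) r"
  obtain h where h: "\<And>b. smooth_on (h b) ?B" "\<And>b. h b (\<phi> p) = frechet_derivative ?F (at (\<phi> p)) b"
    "\<And>y. y \<in> ?B \<Longrightarrow> ?F y = ?F (\<phi> p) + (\<Sum>b\<in>Basis. ((y - \<phi> p) \<bullet> b) * h b y)"
    using hadamard[OF open_ball convex_ball _ smooth_on_subset[OF F r(2)], of "\<phi> p"] r(1) by auto
  define W' where "W' = {x \<in> U. \<phi> x \<in> ?B}"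
  have W': "open W'" "p \<in> W'" "W' \<subseteq> U" "\<phi> ` W' \<subseteq> ?B"
    unfolding W'_def using open_chart_preimage[OF c open_ball] p r(1) by auto
  have hs: "near p (\<lambda>x. h b (\<phi> x))" for b
    by (rule nearI[OF W'(1,2) SF_chart_compose[OF adm W'(1,3) h(1) W'(4)]])
  have xs: "near p (\<lambda>x. \<phi> x \<bullet> b)" if "b \<in> Basis" for b
    by (rule nearI[OF W'(1,2) SF_coordinate_Basis[OF adm W'(1,3) that]])
  have ys: "near p (\<lambda>x. (\<phi> x - \<phi> p) \<bullet> b)" if "b \<in> Basis" for b
    using near_diff[OF xs[OF that] near_const[of p "\<phi> p \<bullet> b"]] by (simp add: inner_diff_left)
  have vy: "v (\<lambda>x. (\<phi> x - \<phi> p) \<bullet> b) = vcoord \<phi> v \<bullet> b" if "b \<in> Basis" for b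
    using TS_diff[OF v xs[OF that] near_const[of p "\<phi> p \<bullet> b"]] that TS_const[OF v]
    by (simp add: inner_diff_left vcoord_Basis)
  have "v f = v (\<lambda>x. f p + (\<Sum>b\<in>Basis. ((\<phi> x - \<phi> p) \<bullet> b) * h b (\<phi> x)))"
  proof (rule TS_cong[OF v W'(1,2)])
    fix x assume "x \<in> W'"
    then have "x \<in> U" "\<phi> x \<in> ?B" by (auto simp: W'_def)
    then show "f x = f p + (\<Sum>b\<in>Basis. ((\<phi> x - \<phi> p) \<bullet> b) * h b (\<phi> x))"
      using h(3)[of "\<phi> x"] U(5) p by simp
  qed
  also have "\<dots> = (\<Sum>b\<in>Basis. v (\<lambda>x. ((\<phi> x - \<phi> p) \<bullet> b) * h b (\<phi> x)))"
  proof -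
    let ?g = "\<lambda>b x. ((\<phi> x - \<phi> p) \<bullet> b) * h b (\<phi> x)"
    have n: "near p (?g b)" if "b \<in> Basis" for b
      by (rule near_mult[OF ys[OF that] hs])
    have "v (\<lambda>x. f p + (\<Sum>b\<in>Basis. ?g b x)) = v (\<lambda>x. f p) + v (\<lambda>x. \<Sum>b\<in>Basis. ?g b x)"
      by (intro TS_add[OF v near_const] near_sum n)
    also have "v (\<lambda>x. \<Sum>b\<in>Basis. ?g b x) = (\<Sum>b\<in>Basis. v (?g b))"
      by (intro TS_sum[OF v] n)
    finally show ?thesis using TS_const[OF v] by simp
  qed
  also have "\<dots> = (\<Sum>b\<in>Basis. (vcoord \<phi> v \<bullet> b) * frechet_derivative ?F (at (\<phi> p)) b)"
    using TS_mult[OF v ys hs] vy h(2) by (intro sum.cong) auto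
  also have "\<dots> = frechet_derivative ?F (at (\<phi> p)) (vcoord \<phi> v)"
    using smooth_on_has_derivative[OF F] W(2)
    by (intro linear_Basis_expansion[symmetric] linear_frechet_derivative) (auto intro: differentiableI)
  finally show ?thesis .
qed

text \<open>In particular, coordinates separate tangent vectors; this is how equality of vectors is proved below.\<close>

lemma TS_eqI:
  assumes "admissible (U, \<phi>)" "p \<in> U" "v \<in> TS p" "w \<in> TS p" "\<And>i. v (\<lambda>x. \<phi> x $ i) = w (\<lambda>x. \<phi> x $ i)"
  shows "v = w"
proof
  fix f
  have "vcoord \<phi> v = vcoord \<phi> w" using assms(5) by (simp add: vcoord_def)
  then show "v f = w f"
    using TS_chart[OF assms(1,2)] assms(3,4) TS_nonsmooth by (cases "near p f") metis+
qed

lemma near_chart_derivative: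
  assumes adm: "admissible (U, \<phi>)" and p: "p \<in> U" and f: "near p f"
  shows "((\<lambda>y. f (inv_into U \<phi> y)) has_derivative
    frechet_derivative (\<lambda>y. f (inv_into U \<phi> y)) (at (\<phi> p))) (at (\<phi> p))"
proof -
  note U = chart_facts[OF admissible_chart[OF adm]]
  obtain W where W: "open W" "p \<in> W" "W \<subseteq> U" "SF W f" using nearE[OF f U(1) p] .
  then show ?thesis
    using SF_iff_chart[OF adm W(1,3)] by (intro smooth_on_has_derivative) auto
qed

text \<open>The chain rule, used below for inverse square roots and for exponentials of functions on \<open>M\<close>.\<close>

lemma TS_compose:
  assumes v: "v \<in> TS p" and f: "near p f" and hf: "near p (\<lambda>x. h (f x))"
    and h: "(h has_real_derivative h') (at (f p))"
  shows "v (\<lambda>x. h (f x)) = h' * v f"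
proof -
  obtain U \<phi> where adm: "admissible (U, \<phi>)" and p: "p \<in> U" by (rule admissible_chart_at)
  have e: "f (inv_into U \<phi> (\<phi> p)) = f p"
    using chart_facts(5)[OF admissible_chart[OF adm] p] by simp
  have "((\<lambda>y. h (f (inv_into U \<phi> y))) has_derivative
      (\<lambda>u. h' * frechet_derivative (\<lambda>y. f (inv_into U \<phi> y)) (at (\<phi> p)) u)) (at (\<phi> p))"
    by (rule has_derivative_compose[OF near_chart_derivative[OF adm p f], of h "(*) h'"])
      (use h e in \<open>simp add: has_field_derivative_def\<close>)
  from frechet_derivative_at[OF this] show ?thesis
    using TS_chart[OF adm p v f] TS_chart[OF adm p v hf] by metis
qed

text \<open>
  The derivation with constant coordinates \<open>\<xi>\<close>. The value \<open>0\<close> on functions that are not smooth is what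
  membership in \<open>tangent_space\<close> demands.
\<close>

definition chart_vector :: "('a, 'n) chart \<Rightarrow> real ^ 'n \<Rightarrow> 'a vfield" where
  "chart_vector c \<xi> p f = (if near p f
     then frechet_derivative (\<lambda>y. f (inv_into (fst c) (snd c) y)) (at (snd c p)) \<xi> else 0)"

lemma chart_vector_TS:
  assumes adm: "admissible (U, \<phi>)" and p: "p \<in> U"
  shows "chart_vector (U, \<phi>) \<xi> p \<in> TS p"
  unfolding tangent_space_def
proof (intro CollectI conjI allI impI)
  note D = near_chart_derivative[OF adm p]
  have e: "f (inv_into U \<phi> (\<phi> p)) = f p" for f :: "'a \<Rightarrow> real"
    using chart_facts(5)[OF admissible_chart[OF adm] p] by simp
  show "chart_vector (U, \<phi>) \<xi> p f = 0" if "\<not> near p f" for f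
    using that by (simp add: chart_vector_def)
  show "chart_vector (U, \<phi>) \<xi> p (\<lambda>x. c * f x) = c * chart_vector (U, \<phi>) \<xi> p f" if "near p f" for c f
    using that near_cmult[OF that] frechet_derivative_at[OF has_derivative_mult_right[OF D[OF that], of c], symmetric]
    by (simp add: chart_vector_def)
  fix f h assume *: "near p f \<and> near p h"
  show "chart_vector (U, \<phi>) \<xi> p (\<lambda>x. f x + h x) =
      chart_vector (U, \<phi>) \<xi> p f + chart_vector (U, \<phi>) \<xi> p h"
    using * near_add frechet_derivative_at[OF has_derivative_add[OF D D], of f h, symmetric]
    by (simp add: chart_vector_def)
  show "chart_vector (U, \<phi>) \<xi> p (\<lambda>x. f x * h x) =
      f p * chart_vector (U, \<phi>) \<xi> p h + h p * chart_vector (U, \<phi>) \<xi> p f"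
    using * near_mult frechet_derivative_at[OF has_derivative_mult[OF D D], of f h, symmetric]
    by (simp add: chart_vector_def e)
qed

lemma chart_vector_coord:
  assumes adm: "admissible (U, \<phi>)" and p: "p \<in> U"
  shows "chart_vector (U, \<phi>) \<xi> p (\<lambda>x. \<phi> x $ i) = \<xi> $ i"
proof -
  note U = chart_facts[OF admissible_chart[OF adm]]
  have "((\<lambda>y. \<phi> (inv_into U \<phi> y) $ i) has_derivative (\<lambda>u. u $ i)) (at (\<phi> p))"
    by (rule has_derivative_transform_within_open[OF bounded_linear_imp_has_derivative U(2)])
      (use p U(5) in \<open>auto intro: bounded_linear_vec_nth\<close>)
  from frechet_derivative_at[OF this, symmetric] show ?thesis
    using nearI[OF U(1) p SF_coordinate[OF adm U(1)]] by (simp add: chart_vector_def)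
qed

subsection \<open>Vector fields\<close>

lemma VF_TS: "X \<in> VF U \<Longrightarrow> p \<in> U \<Longrightarrow> X p \<in> TS p"
  by (simp add: vector_fields_def)

lemma VF_SF: "X \<in> VF U \<Longrightarrow> open W \<Longrightarrow> W \<subseteq> U \<Longrightarrow> SF W f \<Longrightarrow> SF W (\<lambda>p. X p f)"
  by (simp add: vector_fields_def)

lemma VF_near:
  assumes "X \<in> VF U" "open U" "p \<in> U" "near p f"
  shows "near p (\<lambda>x. X x f)"
proof -
  obtain W where "open W" "p \<in> W" "W \<subseteq> U" "SF W f" using nearE[OF assms(4,2,3)] .
  then show ?thesis using VF_SF[OF assms(1)] nearI by metis
qed

lemma VF_subset: "X \<in> VF U \<Longrightarrow> W \<subseteq> U \<Longrightarrow> X \<in> VF W"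
  by (auto simp: vector_fields_def)

lemma VF_local:
  assumes "\<And>p. p \<in> U \<Longrightarrow> \<exists>W. open W \<and> p \<in> W \<and> X \<in> VF W"
  shows "X \<in> VF U"
  unfolding vector_fields_def
proof (intro CollectI conjI ballI allI impI)
  show "X p \<in> TS p" if "p \<in> U" for p using assms[OF that] VF_TS by blast
  fix W f assume W: "open W \<and> W \<subseteq> U \<and> SF W f"
  show "SF W (\<lambda>p. X p f)"
  proof (rule SF_local)
    fix p assume p: "p \<in> W"
    then obtain W' where W': "open W'" "p \<in> W'" "X \<in> VF W'" using assms W by blast
    have "SF (W \<inter> W') (\<lambda>p. X p f)"
      using W W' by (intro VF_SF[OF W'(3)]) (auto intro: SF_subset)
    then show "\<exists>W'. open W' \<and> p \<in> W' \<and> SF W' (\<lambda>p. X p f)"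
      using W W' p by (intro exI[of _ "W \<inter> W'"]) auto
  qed
qed

lemma VF_cong:
  assumes "\<And>x. x \<in> U \<Longrightarrow> X x = Y x" "X \<in> VF U"
  shows "Y \<in> VF U"
  unfolding vector_fields_def
proof (intro CollectI conjI ballI allI impI)
  show "Y p \<in> TS p" if "p \<in> U" for p using assms that VF_TS by metis
  fix W f assume W: "open W \<and> W \<subseteq> U \<and> SF W f"
  then have "SF W (\<lambda>p. X p f)" using VF_SF[OF assms(2)] by blast
  then show "SF W (\<lambda>p. Y p f)" by (rule SF_cong[rotated 2]) (use W assms(1) in \<open>auto simp: subset_iff\<close>)
qed

lemma VF_zero: "0 \<in> VF U"
  by (auto simp: vector_fields_def TS_zero SF_const)

lemma VF_add: "X \<in> VF U \<Longrightarrow> Y \<in> VF U \<Longrightarrow> X + Y \<in> VF U"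
  unfolding vector_fields_def by (auto intro: TS_plus SF_add)

lemma VF_scale: "SF U f \<Longrightarrow> X \<in> VF U \<Longrightarrow> fscale f X \<in> VF U"
  unfolding vector_fields_def by (auto intro: TS_scale SF_mult SF_subset)

lemma VF_diff: "X \<in> VF U \<Longrightarrow> Y \<in> VF U \<Longrightarrow> X - Y \<in> VF U"
  unfolding vector_fields_def by (auto intro: TS_minus SF_diff)

lemma VF_sum: "(\<And>i. i \<in> I \<Longrightarrow> X i \<in> VF U) \<Longrightarrow> (\<Sum>i\<in>I. X i) \<in> VF U"
  by (induction I rule: infinite_finite_induct) (auto intro: VF_zero VF_add)

lemma chart_vector_VF:
  assumes adm: "admissible (U, \<phi>)"
  shows "chart_vector (U, \<phi>) \<xi> \<in> VF U"
  unfolding vector_fields_def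
proof (intro CollectI conjI ballI allI impI)
  show "chart_vector (U, \<phi>) \<xi> p \<in> TS p" if "p \<in> U" for p using chart_vector_TS[OF adm that] .
  note U = chart_facts[OF admissible_chart[OF adm]]
  fix W f assume "open W \<and> W \<subseteq> U \<and> SF W f"
  then have W: "open W" "W \<subseteq> U" "SF W f" by auto
  have "smooth_on (\<lambda>y. frechet_derivative (\<lambda>y. f (inv_into U \<phi> y)) (at y) \<xi>) (\<phi> ` W)"
    using SF_iff_chart[OF adm W(1,2)] W(3) by (intro smooth_on_frechet_derivative) simp
  then have "SF W (\<lambda>x. frechet_derivative (\<lambda>y. f (inv_into U \<phi> y)) (at (\<phi> x)) \<xi>)"
    by (rule SF_chart_compose[OF adm W(1,2)]) simp
  then show "SF W (\<lambda>p. chart_vector (U, \<phi>) \<xi> p f)"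
    by (rule SF_cong[OF W(1), rotated]) (use nearI[OF W(1) _ W(3)] in \<open>simp add: chart_vector_def\<close>)
qed

lemma TS_expansion:
  assumes adm: "admissible (U, \<phi>)" and p: "p \<in> U" and v: "v \<in> TS p"
  shows "v = (\<Sum>i\<in>UNIV. tscale (v (\<lambda>x. \<phi> x $ i)) (chart_vector (U, \<phi>) (axis i 1) p))"
proof (rule TS_eqI[OF adm p v])
  show "(\<Sum>i\<in>UNIV. tscale (v (\<lambda>x. \<phi> x $ i)) (chart_vector (U, \<phi>) (axis i 1) p)) \<in> TS p"
    by (intro TS_sum_mem TS_scale chart_vector_TS adm p)
  show "v (\<lambda>x. \<phi> x $ j) = (\<Sum>i\<in>UNIV. tscale (v (\<lambda>x. \<phi> x $ i)) (chart_vector (U, \<phi>) (axis i 1) p)) (\<lambda>x. \<phi> x $ j)" for j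
    by (simp add: sum_fun_apply chart_vector_coord[OF adm p] axis_def if_distrib cong: if_cong)
qed

text \<open>Identities for a metric can be tested on fields instead of vectors, because every vector extends.\<close>

lemma VF_through:
  assumes "v \<in> TS p"
  obtains U X where "open U" "p \<in> U" "X \<in> VF U" "X p = v"
proof -
  obtain U \<phi> where adm: "admissible (U, \<phi>)" and p: "p \<in> U" by (rule admissible_chart_at)
  have "chart_vector (U, \<phi>) (vcoord \<phi> v) p = v"
    by (rule TS_eqI[OF adm p chart_vector_TS[OF adm p] assms])
      (simp add: chart_vector_coord[OF adm p] vcoord_def)
  then show ?thesis
    using that[OF _ p chart_vector_VF[OF adm]] chart_facts(1)[OF admissible_chart[OF adm]] by metis
qed

subsection \<open>The Lie bracket\<close>

lemma bracket_apply: "near p f \<Longrightarrow> bracket X Y p f = X p (\<lambda>x. Y x f) - Y p (\<lambda>x. X x f)"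
  by (simp add: lie_bracket_def)

lemma bracket_TS:
  assumes X: "X \<in> VF U" and Y: "Y \<in> VF U" and U: "open U" "p \<in> U"
  shows "bracket X Y p \<in> TS p"
  unfolding tangent_space_def
proof (intro CollectI conjI allI impI)
  note Xp = VF_TS[OF X U(2)] and Yp = VF_TS[OF Y U(2)]
  note nX = VF_near[OF X U] and nY = VF_near[OF Y U]
  show "bracket X Y p f = 0" if "\<not> near p f" for f using that by (simp add: lie_bracket_def)
  note locX = TS_cong_near[OF Xp U] and locY = TS_cong_near[OF Yp U]
  {
    fix c f assume f: "near p f"
    have "X p (\<lambda>x. Y x (\<lambda>x. c * f x)) = X p (\<lambda>x. c * Y x f)"
      by (rule locX[OF f f]) (use TS_cmult VF_TS[OF Y] in blast)
    moreover have "Y p (\<lambda>x. X x (\<lambda>x. c * f x)) = Y p (\<lambda>x. c * X x f)"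
      by (rule locY[OF f f]) (use TS_cmult VF_TS[OF X] in blast)
    ultimately show "bracket X Y p (\<lambda>x. c * f x) = c * bracket X Y p f"
      using f near_cmult[OF f] by (simp add: bracket_apply TS_cmult[OF Xp nY] TS_cmult[OF Yp nX] algebra_simps)
  }
  fix f h assume "near p f \<and> near p h"
  then have f: "near p f" and h: "near p h" by auto
  have "X p (\<lambda>x. Y x (\<lambda>x. f x + h x)) = X p (\<lambda>x. Y x f + Y x h)"
    by (rule locX[OF f h]) (use TS_add VF_TS[OF Y] in blast)
  moreover have "Y p (\<lambda>x. X x (\<lambda>x. f x + h x)) = Y p (\<lambda>x. X x f + X x h)"
    by (rule locY[OF f h]) (use TS_add VF_TS[OF X] in blast)
  ultimately show "bracket X Y p (\<lambda>x. f x + h x) = bracket X Y p f + bracket X Y p h"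
    using f h near_add[OF f h]
    by (simp add: bracket_apply TS_add[OF Xp nY nY] TS_add[OF Yp nX nX] algebra_simps)
  have "X p (\<lambda>x. Y x (\<lambda>x. f x * h x)) = X p (\<lambda>x. f x * Y x h + h x * Y x f)"
    by (rule locX[OF f h]) (use TS_mult VF_TS[OF Y] in blast)
  moreover have "Y p (\<lambda>x. X x (\<lambda>x. f x * h x)) = Y p (\<lambda>x. f x * X x h + h x * X x f)"
    by (rule locY[OF f h]) (use TS_mult VF_TS[OF X] in blast)
  ultimately show "bracket X Y p (\<lambda>x. f x * h x) = f p * bracket X Y p h + h p * bracket X Y p f"
    using f h near_mult[OF f h]
    by (simp add: bracket_apply TS_add[OF Xp near_mult near_mult] TS_add[OF Yp near_mult near_mult]
        nX nY TS_mult[OF Xp _ nY] TS_mult[OF Yp _ nX] algebra_simps)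
qed

lemma bracket_VF:
  assumes X: "X \<in> VF U" and Y: "Y \<in> VF U" and U: "open U"
  shows "bracket X Y \<in> VF U"
  unfolding vector_fields_def
proof (intro CollectI conjI ballI allI impI)
  show "bracket X Y p \<in> TS p" if "p \<in> U" for p using bracket_TS[OF X Y U that] .
  fix W f assume "open W \<and> W \<subseteq> U \<and> SF W f"
  then have W: "open W" "W \<subseteq> U" "SF W f" by auto
  have "SF W (\<lambda>p. X p (\<lambda>x. Y x f) - Y p (\<lambda>x. X x f))"
    by (intro SF_diff VF_SF[OF X] VF_SF[OF Y] W)
  then show "SF W (\<lambda>p. bracket X Y p f)"
    by (rule SF_cong[OF W(1), rotated]) (use nearI[OF W(1) _ W(3)] in \<open>simp add: bracket_apply\<close>)
qed

lemma bracket_antisym: "bracket X Y p = - bracket Y X p"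
  by (auto simp: lie_bracket_def)

lemma bracket_cong:
  assumes "open W" "p \<in> W" "X \<in> VF W" "Y \<in> VF W" "\<And>x. x \<in> W \<Longrightarrow> X x = X' x" "\<And>x. x \<in> W \<Longrightarrow> Y x = Y' x"
  shows "bracket X Y p = bracket X' Y' p"
proof
  fix f
  have "X p (\<lambda>x. Y x f) = X p (\<lambda>x. Y' x f)" "Y p (\<lambda>x. X x f) = Y p (\<lambda>x. X' x f)"
    using assms by (intro TS_cong[OF VF_TS[OF assms(3)] assms(1,2)] TS_cong[OF VF_TS[OF assms(4)] assms(1,2)]; simp)+
  then show "bracket X Y p f = bracket X' Y' p f"
    using assms by (simp add: lie_bracket_def)
qed

lemma bracket_add_left:
  assumes "X \<in> VF U" "Z \<in> VF U" "Y \<in> VF U" "open U" "p \<in> U"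
  shows "bracket (X + Z) Y p = bracket X Y p + bracket Z Y p"
  by (rule ext)
    (use assms in \<open>simp add: lie_bracket_def TS_add[OF VF_TS[OF assms(3,5)]] VF_near[OF assms(1,4,5)] VF_near[OF assms(2,4,5)]\<close>)

lemma bracket_add_right:
  assumes "X \<in> VF U" "Z \<in> VF U" "Y \<in> VF U" "open U" "p \<in> U"
  shows "bracket Y (X + Z) p = bracket Y X p + bracket Y Z p"
  using bracket_add_left[OF assms] bracket_antisym[of Y "X + Z" p] bracket_antisym[of Y X p]
    bracket_antisym[of Y Z p] by simp

lemma bracket_scale_right:
  assumes "X \<in> VF U" "Y \<in> VF U" "SF U f" "open U" "p \<in> U"
  shows "bracket X (fscale f Y) p = tscale (X p f) (Y p) + tscale (f p) (bracket X Y p)"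
proof
  fix h
  have f: "near p f" using assms nearI by blast
  have "X p (\<lambda>x. f x * Y x h) = f p * X p (\<lambda>x. Y x h) + Y p h * X p f" if "near p h"
    using TS_mult[OF VF_TS[OF assms(1,5)] f VF_near[OF assms(2,4,5) that]] .
  then show "bracket X (fscale f Y) p h = (tscale (X p f) (Y p) + tscale (f p) (bracket X Y p)) h"
    using TS_nonsmooth[OF VF_TS[OF assms(2,5)]] by (simp add: lie_bracket_def algebra_simps)
qed

lemma bracket_scale_left:
  assumes "X \<in> VF U" "Y \<in> VF U" "SF U f" "open U" "p \<in> U"
  shows "bracket (fscale f X) Y p = tscale (f p) (bracket X Y p) - tscale (Y p f) (X p)"
  using bracket_scale_right[OF assms(2,1,3-5)] bracket_antisym[of "fscale f X" Y p] bracket_antisym[of X Y p]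
  by (simp add: tscale_def fun_eq_iff)

text \<open>
  Applied to a function the sum consists of twelve threefold derivatives that cancel. Locality of
  derivations justifies replacing \<open>[Y, Z]f\<close> by its defining expression under another field.
\<close>

lemma jacobi:
  assumes X: "X \<in> VF U" and Y: "Y \<in> VF U" and Z: "Z \<in> VF U" and U: "open U" "p \<in> U"
  shows "bracket X (bracket Y Z) p + bracket Y (bracket Z X) p + bracket Z (bracket X Y) p = 0"
proof
  fix f
  have a: "V p (\<lambda>x. bracket V' V'' x f) = V p (\<lambda>x. V' x (\<lambda>x. V'' x f)) - V p (\<lambda>x. V'' x (\<lambda>x. V' x f))"
    if f: "near p f" and V: "V \<in> VF U" "V' \<in> VF U" "V'' \<in> VF U" for V V' V''
  proof -
    obtain W where W: "open W" "p \<in> W" "W \<subseteq> U" "SF W f" using nearE[OF f U] .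
    have "V p (\<lambda>x. bracket V' V'' x f) = V p (\<lambda>x. V' x (\<lambda>x. V'' x f) - V'' x (\<lambda>x. V' x f))"
      by (rule TS_cong[OF VF_TS[OF V(1) U(2)] W(1,2)]) (use nearI[OF W(1) _ W(4)] in \<open>simp add: bracket_apply\<close>)
    then show ?thesis
      by (simp add: TS_diff[OF VF_TS[OF V(1) U(2)]] VF_near[OF V(2) U] VF_near[OF V(3) U] f)
  qed
  show "(bracket X (bracket Y Z) p + bracket Y (bracket Z X) p + bracket Z (bracket X Y) p) f = 0 f"
  proof (cases "near p f")
    case True
    have b: "bracket V V' p (\<lambda>x. V'' x f) = V p (\<lambda>x. V' x (\<lambda>x. V'' x f)) - V' p (\<lambda>x. V x (\<lambda>x. V'' x f))"
      if "V'' \<in> VF U" for V V' V''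
      using VF_near[OF that U True] by (rule bracket_apply)
    show ?thesis
      using X Y Z by (simp add: bracket_apply[OF True] a[OF True] b)
  next
    case False
    then show ?thesis by (simp add: lie_bracket_def)
  qed
qed

subsection \<open>Bump functions\<close>

text \<open>
  The closed set \<open>K\<close> inside \<open>U\<close> makes \<open>\<kappa>\<close> times a field on \<open>U\<close> smooth on all of \<open>M\<close>, whatever the
  field is outside \<open>U\<close>.
\<close>

definition bump :: "'a set \<Rightarrow> 'a set \<Rightarrow> ('a \<Rightarrow> real) \<Rightarrow> bool" where
  "bump U W \<kappa> \<longleftrightarrow> SF UNIV \<kappa> \<and> open W \<and> W \<subseteq> U \<and> (\<forall>x\<in>W. \<kappa> x = 1) \<and>
     (\<exists>K. closed K \<and> K \<subseteq> U \<and> (\<forall>x. x \<notin> K \<longrightarrow> \<kappa> x = 0))"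

text \<open>
  A smooth step applied to the squared distance from the centre in a chart. The support is compact
  in the chart domain and hence closed in \<open>M\<close>, because \<open>M\<close> is a Hausdorff space.
\<close>

lemma bump_exists:
  assumes "open U" "p \<in> U"
  obtains W \<kappa> where "bump U W \<kappa>" "p \<in> W"
proof -
  obtain V \<phi> where adm: "admissible (V, \<phi>)" and pV: "p \<in> V" by (rule admissible_chart_at)
  note c = admissible_chart[OF adm]
  note V = chart_facts[OF c]
  define U' where "U' = U \<inter> V"
  have U': "open U'" "p \<in> U'" "U' \<subseteq> V" using assms pV V(1) by (auto simp: U'_def)
  obtain R where R: "R > 0" "cball (\<phi> p) R \<subseteq> \<phi> ` U'"
    using V(7)[OF U'(1,3)] U'(2) by (metis image_eqI open_contains_cball)
  define r where "r = R\<^sup>2 / 2"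
  have r: "r > 0" "2 * r = R\<^sup>2" using R by (auto simp: r_def)
  obtain \<beta> where \<beta>: "smooth_on \<beta> UNIV" "\<And>s. s \<le> r \<Longrightarrow> \<beta> s = (1::real)" "\<And>s. s \<ge> 2 * r \<Longrightarrow> \<beta> s = 0"
    using smooth_step[OF r(1)] by blast
  define sq where "sq y = (y - \<phi> p) \<bullet> (y - \<phi> p)" for y
  define \<kappa> where "\<kappa> x = (if x \<in> U' then \<beta> (sq (\<phi> x)) else 0)" for x
  define K where "K = inv_into V \<phi> ` cball (\<phi> p) R"
  have "continuous_on (cball (\<phi> p) R) (inv_into V \<phi>)"
    using V(4) R(2) U'(3) by (elim continuous_on_subset) auto
  then have "closed K"
    unfolding K_def by (intro compact_imp_closed compact_continuous_image) auto
  have "K \<subseteq> U'"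
  proof
    fix x assume "x \<in> K"
    then obtain y where "y \<in> cball (\<phi> p) R" "x = inv_into V \<phi> y" by (auto simp: K_def)
    then show "x \<in> U'" using R(2) V(5) U'(3) by (metis (no_types, lifting) imageE subsetD)
  qed
  have off: "\<kappa> x = 0" if "x \<notin> K" for x
  proof (cases "x \<in> U'")
    case True
    then have "inv_into V \<phi> (\<phi> x) = x" using V(5) U'(3) by auto
    then have "\<phi> x \<notin> cball (\<phi> p) R" using that unfolding K_def by (metis image_eqI)
    then have "R \<le> norm (\<phi> x - \<phi> p)" by (simp add: dist_norm norm_minus_commute)
    then have "R\<^sup>2 \<le> (norm (\<phi> x - \<phi> p))\<^sup>2" using R(1) by (intro power_mono) auto
    then have "sq (\<phi> x) \<ge> R\<^sup>2" by (simp add: sq_def power2_norm_eq_inner)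
    then show ?thesis using \<beta>(3) r(2) by (simp add: \<kappa>_def)
  qed (simp add: \<kappa>_def)
  \<comment> \<open>a form of \<open>sq\<close> in which the closure rules for smooth functions apply\<close>
  have sq_sum: "sq y = (\<Sum>b\<in>Basis. ((y \<bullet> b) + (- (\<phi> p \<bullet> b))) * ((y \<bullet> b) + (- (\<phi> p \<bullet> b))))" for y
  proof -
    have "sq y = (\<Sum>b\<in>Basis. ((y - \<phi> p) \<bullet> b) * ((y - \<phi> p) \<bullet> b))"
      unfolding sq_def by (rule euclidean_inner)
    then show ?thesis by (simp add: inner_diff_left)
  qed
  have "smooth_on sq UNIV"
    unfolding sq_sum[abs_def] smooth_on_def
    by (intro allI Ck_on_sum Ck_on_mult Ck_on_add Ck_on_const Ck_on_bounded_linear[OF _ bounded_linear_inner_left] Ck_on_id)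
      auto
  then have "smooth_on (\<lambda>y. \<beta> (sq y)) UNIV"
    by (intro smooth_on_compose[OF _ _ _ \<beta>(1)]) auto
  then have "SF U' (\<lambda>x. \<beta> (sq (\<phi> x)))" by (intro SF_chart_compose[OF adm U'(1,3)]) auto
  then have s1: "SF U' \<kappa>" by (rule SF_cong[OF U'(1), rotated]) (simp add: \<kappa>_def)
  have s2: "SF (- K) \<kappa>"
    by (rule SF_cong[OF _ _ SF_const[of _ 0]]) (use \<open>closed K\<close> off in auto)
  have "SF UNIV \<kappa>"
  proof (rule SF_local)
    fix x show "\<exists>W'. open W' \<and> x \<in> W' \<and> SF W' \<kappa>"
    proof (cases "x \<in> U'")
      case True
      then show ?thesis using s1 U'(1) by blast
    next
      case False
      then have "x \<in> - K" using \<open>K \<subseteq> U'\<close> by blast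
      then show ?thesis using s2 \<open>closed K\<close> open_Compl by blast
    qed
  qed
  define W where "W = {x \<in> V. \<phi> x \<in> {y. sq y < r}} \<inter> U'"
  have "open {y. sq y < r}" unfolding sq_def by (intro open_Collect_less continuous_intros)
  from open_chart_preimage[OF c this] have W: "open W" unfolding W_def by (rule open_Int[OF _ U'(1)])
  have "bump U W \<kappa>"
    unfolding bump_def
  proof (intro conjI)
    show "W \<subseteq> U" "\<forall>x\<in>W. \<kappa> x = 1" using \<beta>(2) by (auto simp: W_def U'_def \<kappa>_def)
    show "\<exists>K. closed K \<and> K \<subseteq> U \<and> (\<forall>x. x \<notin> K \<longrightarrow> \<kappa> x = 0)"
      using \<open>closed K\<close> \<open>K \<subseteq> U'\<close> off by (intro exI[of _ K]) (auto simp: U'_def)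
  qed (fact \<open>SF UNIV \<kappa>\<close> W)+
  moreover have "p \<in> W" using U' pV r(1) by (auto simp: W_def sq_def)
  ultimately show ?thesis by (rule that)
qed

lemma bump_scale_VF:
  assumes b: "bump U W \<kappa>" and U: "open U" and X: "X \<in> VF U"
  shows "fscale \<kappa> X \<in> VF UNIV"
proof (rule VF_local)
  obtain K where K: "closed K" "K \<subseteq> U" "\<And>x. x \<notin> K \<Longrightarrow> \<kappa> x = 0" using b by (auto simp: bump_def)
  have "SF U \<kappa>" using b SF_subset[of UNIV \<kappa> U] by (simp add: bump_def)
  then have 1: "fscale \<kappa> X \<in> VF U" by (rule VF_scale[OF _ X])
  have 2: "fscale \<kappa> X \<in> VF (- K)" by (rule VF_cong[OF _ VF_zero]) (use K in auto)
  show "\<exists>W. open W \<and> p \<in> W \<and> fscale \<kappa> X \<in> VF W" for p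
  proof (cases "p \<in> U")
    case True
    then show ?thesis using 1 U by blast
  next
    case False
    then have "p \<in> - K" using K(2) by blast
    then show ?thesis using 2 K(1) open_Compl by blast
  qed
qed

lemma bump_zero: "bump U W \<kappa> \<Longrightarrow> x \<notin> U \<Longrightarrow> \<kappa> x = 0"
  by (auto simp: bump_def)

end

section \<open>Orthonormal frames and the Levi-Civita connection\<close>

definition spanned :: "'i set \<Rightarrow> ('i \<Rightarrow> 'a tvec) \<Rightarrow> 'a tvec \<Rightarrow> bool" where
  "spanned I e v \<longleftrightarrow> (\<exists>c. v = (\<Sum>i\<in>I. tscale (c i) (e i)))"

lemma spanned_zero: "spanned I e 0"
  by (auto simp: spanned_def intro!: exI[of _ "\<lambda>_. 0"])

lemma spanned_add:
  assumes "spanned I e v" "spanned I e w"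
  shows "spanned I e (v + w)"
proof -
  obtain a b where "v = (\<Sum>i\<in>I. tscale (a i) (e i))" "w = (\<Sum>i\<in>I. tscale (b i) (e i))"
    using assms by (auto simp: spanned_def)
  then show ?thesis
    by (auto simp: spanned_def tscale_left_add sum.distrib intro!: exI[of _ "\<lambda>i. a i + b i"])
qed

lemma spanned_scale: "spanned I e v \<Longrightarrow> spanned I e (tscale c v)"
proof -
  assume "spanned I e v"
  then obtain a where "v = (\<Sum>i\<in>I. tscale (a i) (e i))" by (auto simp: spanned_def)
  then show ?thesis by (auto simp: spanned_def tscale_sum intro!: exI[of _ "\<lambda>i. c * a i"])
qed

lemma spanned_sum: "(\<And>j. j \<in> S \<Longrightarrow> spanned I e (v j)) \<Longrightarrow> spanned I e (\<Sum>j\<in>S. v j)"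
  by (induction S rule: infinite_finite_induct) (auto intro: spanned_zero spanned_add)

lemma spanned_member: "finite I \<Longrightarrow> i \<in> I \<Longrightarrow> spanned I e (e i)"
  unfolding spanned_def
  by (rule exI[of _ "\<lambda>j. if j = i then 1 else 0"])
    (simp add: if_distrib[of "\<lambda>c. tscale c _"] cong: if_cong)

lemma spanned_mono:
  assumes "finite J" "I \<subseteq> J" "spanned I e v"
  shows "spanned J e v"
proof -
  obtain c where "v = (\<Sum>i\<in>I. tscale (c i) (e i))" using assms(3) by (auto simp: spanned_def)
  then show ?thesis
    using assms(1,2) by (auto intro!: spanned_sum spanned_scale spanned_member)
qed

lemma spanned_trans:
  assumes "spanned I e v" "\<And>i. i \<in> I \<Longrightarrow> spanned J e' (e i)"
  shows "spanned J e' v"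
  using assms unfolding spanned_def[of I e v] by (auto intro: spanned_sum spanned_scale)

locale riemannian_manifold = smooth_manifold A
  for A :: "('a::t2_space, 'n::finite) chart set" +
  fixes g :: "'a \<Rightarrow> 'a tvec \<Rightarrow> 'a tvec \<Rightarrow> real"
  assumes metric: "riemannian_metric A g"
begin

lemma g_sym: "u \<in> TS p \<Longrightarrow> v \<in> TS p \<Longrightarrow> g p u v = g p v u"
  using metric by (simp add: riemannian_metric_def)

lemma g_scale_left: "u \<in> TS p \<Longrightarrow> v \<in> TS p \<Longrightarrow> g p (tscale c u) v = c * g p u v"
  using metric by (simp add: riemannian_metric_def)

lemma g_add_left: "u \<in> TS p \<Longrightarrow> w \<in> TS p \<Longrightarrow> v \<in> TS p \<Longrightarrow> g p (u + w) v = g p u v + g p w v"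
  using metric by (simp add: riemannian_metric_def)

lemma g_pos: "v \<in> TS p \<Longrightarrow> v \<noteq> 0 \<Longrightarrow> g p v v > 0"
  using metric by (simp add: riemannian_metric_def)

lemma g_scale_right: "u \<in> TS p \<Longrightarrow> v \<in> TS p \<Longrightarrow> g p u (tscale c v) = c * g p u v"
  using g_scale_left[of v p u c] g_sym TS_scale by metis

lemma g_add_right: "u \<in> TS p \<Longrightarrow> w \<in> TS p \<Longrightarrow> v \<in> TS p \<Longrightarrow> g p v (u + w) = g p v u + g p v w"
  using g_add_left[of u p w v] g_sym TS_plus by metis

lemma g_zero_left: "v \<in> TS p \<Longrightarrow> g p 0 v = 0"
  using g_scale_left[of v p v 0] by simp

lemma g_zero_right: "v \<in> TS p \<Longrightarrow> g p v 0 = 0"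
  using g_zero_left g_sym TS_zero by metis

lemma g_uminus_left: "u \<in> TS p \<Longrightarrow> v \<in> TS p \<Longrightarrow> g p (- u) v = - g p u v"
proof -
  have "- u = tscale (- 1) u" by (auto simp: tscale_def)
  then show "u \<in> TS p \<Longrightarrow> v \<in> TS p \<Longrightarrow> g p (- u) v = - g p u v" by (simp add: g_scale_left)
qed

lemma g_diff_left: "u \<in> TS p \<Longrightarrow> w \<in> TS p \<Longrightarrow> v \<in> TS p \<Longrightarrow> g p (u - w) v = g p u v - g p w v"
  using g_add_left[of u p "- w" v] TS_uminus[of w p] by (simp add: g_uminus_left)

lemma g_diff_right: "u \<in> TS p \<Longrightarrow> w \<in> TS p \<Longrightarrow> v \<in> TS p \<Longrightarrow> g p v (u - w) = g p v u - g p v w"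
  using g_diff_left[of u p w v] g_sym TS_minus by metis

lemma g_sum_left:
  "(\<And>i. i \<in> I \<Longrightarrow> u i \<in> TS p) \<Longrightarrow> v \<in> TS p \<Longrightarrow> g p (\<Sum>i\<in>I. u i) v = (\<Sum>i\<in>I. g p (u i) v)"
  by (induction I rule: infinite_finite_induct) (auto simp: g_zero_left g_add_left TS_sum_mem)

lemma g_sum_right:
  assumes "\<And>i. i \<in> I \<Longrightarrow> u i \<in> TS p" "v \<in> TS p"
  shows "g p v (\<Sum>i\<in>I. u i) = (\<Sum>i\<in>I. g p v (u i))"
proof -
  have "g p v (\<Sum>i\<in>I. u i) = (\<Sum>i\<in>I. g p (u i) v)"
    using g_sum_left[OF assms] g_sym[OF assms(2) TS_sum_mem[of I u p, OF assms(1)]] by simp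
  also have "\<dots> = (\<Sum>i\<in>I. g p v (u i))" by (intro sum.cong refl g_sym assms)
  finally show ?thesis .
qed

lemma g_nonneg: "v \<in> TS p \<Longrightarrow> g p v v \<ge> 0"
  using g_pos[of v p] g_zero_left[OF TS_zero] by (cases "v = 0") auto

lemma g_eq_0_iff: "v \<in> TS p \<Longrightarrow> g p v v = 0 \<longleftrightarrow> v = 0"
  using g_pos[of v p] g_zero_left[OF TS_zero] by fastforce

text \<open>Positivity makes the metric nondegenerate.\<close>

lemma g_eqI:
  assumes "u \<in> TS p" "v \<in> TS p" "\<And>w. w \<in> TS p \<Longrightarrow> g p u w = g p v w"
  shows "u = v"
proof -
  have "g p (u - v) (u - v) = 0"
    using assms TS_minus[OF assms(1,2)] by (simp add: g_diff_left)
  then show ?thesis using g_eq_0_iff[OF TS_minus[OF assms(1,2)]] by simp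
qed

abbreviation gg :: "'a vfield \<Rightarrow> 'a vfield \<Rightarrow> 'a \<Rightarrow> real" where
  "gg X Y \<equiv> (\<lambda>x. g x (X x) (Y x))"

lemma gg_SF: "X \<in> VF U \<Longrightarrow> Y \<in> VF U \<Longrightarrow> open U \<Longrightarrow> SF U (gg X Y)"
  using metric by (simp add: riemannian_metric_def)

lemma gg_near: "X \<in> VF U \<Longrightarrow> Y \<in> VF U \<Longrightarrow> open U \<Longrightarrow> p \<in> U \<Longrightarrow> near p (gg X Y)"
  by (rule nearI[OF _ _ gg_SF])

subsection \<open>Orthonormal families\<close>

definition orthonormal :: "'a \<Rightarrow> 'i set \<Rightarrow> ('i \<Rightarrow> 'a tvec) \<Rightarrow> bool" where
  "orthonormal p I e \<longleftrightarrow> finite I \<and> (\<forall>i\<in>I. e i \<in> TS p) \<and>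
     (\<forall>i\<in>I. \<forall>j\<in>I. g p (e i) (e j) = (if i = j then 1 else 0))"

definition proj :: "'a \<Rightarrow> 'i set \<Rightarrow> ('i \<Rightarrow> 'a tvec) \<Rightarrow> 'a tvec \<Rightarrow> 'a tvec" where
  "proj p I e v = (\<Sum>i\<in>I. tscale (g p v (e i)) (e i))"

lemma spanned_TS: "orthonormal p I e \<Longrightarrow> spanned I e v \<Longrightarrow> v \<in> TS p"
  by (auto simp: orthonormal_def spanned_def intro!: TS_sum_mem TS_scale)

lemma proj_spanned: "spanned I e (proj p I e v)"
  by (auto simp: spanned_def proj_def)

lemma orthonormal_coeff:
  assumes "orthonormal p I e" "j \<in> I"
  shows "g p (\<Sum>i\<in>I. tscale (c i) (e i)) (e j) = c j"
proof -
  have "g p (\<Sum>i\<in>I. tscale (c i) (e i)) (e j) = (\<Sum>i\<in>I. c i * (if i = j then 1 else 0))"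
    using assms by (subst g_sum_left) (auto simp: orthonormal_def TS_scale g_scale_left intro!: sum.cong)
  also have "\<dots> = c j"
    using assms by (simp add: orthonormal_def if_distrib cong: if_cong)
  finally show ?thesis .
qed

lemma proj_fix: "orthonormal p I e \<Longrightarrow> spanned I e v \<Longrightarrow> proj p I e v = v"
  unfolding proj_def spanned_def by (auto simp: orthonormal_coeff intro!: sum.cong)

lemma proj_TS: "orthonormal p I e \<Longrightarrow> proj p I e v \<in> TS p"
  by (rule spanned_TS[OF _ proj_spanned])

lemma proj_orthogonal:
  assumes "orthonormal p I e" "v \<in> TS p" "j \<in> I"
  shows "g p (v - proj p I e v) (e j) = 0"
proof -
  have "e j \<in> TS p" using assms by (simp add: orthonormal_def)
  then show ?thesis
    using orthonormal_coeff[OF assms(1,3), of "\<lambda>i. g p v (e i)"]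
    unfolding g_diff_left[OF assms(2) proj_TS[OF assms(1)] \<open>e j \<in> TS p\<close>] by (simp add: proj_def)
qed

lemma orthogonal_spanned:
  assumes "v \<in> TS p" "\<And>i. i \<in> I \<Longrightarrow> e i \<in> TS p" "\<And>i. i \<in> I \<Longrightarrow> g p v (e i) = 0" "spanned I e w"
  shows "g p v w = 0"
  using assms by (auto simp: spanned_def g_sum_right TS_scale g_scale_right)

lemma parseval:
  assumes "orthonormal p I e" "v \<in> TS p" "w \<in> TS p" "spanned I e v"
  shows "g p v w = (\<Sum>i\<in>I. g p v (e i) * g p w (e i))"
proof -
  have e: "\<And>i. i \<in> I \<Longrightarrow> e i \<in> TS p" using assms(1) by (simp add: orthonormal_def)
  have "g p v w = g p (proj p I e v) w" using proj_fix[OF assms(1,4)] by simp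
  also have "\<dots> = (\<Sum>i\<in>I. g p v (e i) * g p w (e i))"
    unfolding proj_def using e assms(3)
    by (subst g_sum_left) (auto simp: TS_scale g_scale_left g_sym[of w] intro!: sum.cong)
  finally show ?thesis .
qed

lemma bessel:
  assumes "orthonormal p I e" "v \<in> TS p"
  shows "g p (v - proj p I e v) (v - proj p I e v) = g p v v - (\<Sum>i\<in>I. (g p v (e i))\<^sup>2)"
proof -
  note P = proj_TS[OF assms(1), of v] and D = TS_minus[OF assms(2) proj_TS[OF assms(1), of v]]
  have e: "\<And>i. i \<in> I \<Longrightarrow> e i \<in> TS p" using assms(1) by (simp add: orthonormal_def)
  have "g p (v - proj p I e v) (proj p I e v) = 0"
    by (rule orthogonal_spanned[OF D e _ proj_spanned]) (auto intro: proj_orthogonal[OF assms])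
  then have "g p (v - proj p I e v) (v - proj p I e v) = g p (v - proj p I e v) v"
    by (simp add: g_diff_right[OF assms(2) P D])
  also have "\<dots> = g p v v - g p (proj p I e v) v" by (simp add: g_diff_left[OF assms(2) P assms(2)])
  also have "g p (proj p I e v) v = (\<Sum>i\<in>I. (g p v (e i))\<^sup>2)"
    unfolding proj_def using e assms(2)
    by (subst g_sum_left) (auto simp: TS_scale g_scale_left g_sym[of v] power2_eq_square intro!: sum.cong)
  finally show ?thesis .
qed

text \<open>
  Two orthonormal families with the same index set and one contained in the span of the other have
  the same span: summing the defects \<open>1 - \<Sum>\<^sub>i g(b\<^sub>j, e\<^sub>i)\<^sup>2 \<ge> 0\<close> over \<open>j\<close> gives
  \<open>card I - \<Sum>\<^sub>i g(e\<^sub>i, e\<^sub>i) = 0\<close>, so every defect vanishes.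
\<close>

lemma orthonormal_complete:
  assumes b: "orthonormal p I b" and e: "orthonormal p I e"
    and eb: "\<And>i. i \<in> I \<Longrightarrow> spanned I b (e i)" and w: "spanned I b w"
  shows "spanned I e w"
proof (rule spanned_trans[OF w])
  have fin: "finite I" and bT: "\<And>i. i \<in> I \<Longrightarrow> b i \<in> TS p" and eT: "\<And>i. i \<in> I \<Longrightarrow> e i \<in> TS p"
    and b1: "\<And>i. i \<in> I \<Longrightarrow> g p (b i) (b i) = 1" and e1: "\<And>i. i \<in> I \<Longrightarrow> g p (e i) (e i) = 1"
    using b e by (auto simp: orthonormal_def)
  let ?d = "\<lambda>j. 1 - (\<Sum>i\<in>I. (g p (b j) (e i))\<^sup>2)"
  have d: "?d j = g p (b j - proj p I e (b j)) (b j - proj p I e (b j))" if "j \<in> I" for j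
    using bessel[OF e bT[OF that]] b1[OF that] by simp
  have "(\<Sum>j\<in>I. \<Sum>i\<in>I. (g p (b j) (e i))\<^sup>2) = (\<Sum>i\<in>I. \<Sum>j\<in>I. (g p (b j) (e i))\<^sup>2)"
    by (rule sum.swap)
  also have "\<dots> = (\<Sum>i\<in>I. g p (e i) (e i))"
    using parseval[OF b eT eT eb] g_sym[OF bT eT] by (intro sum.cong) (auto simp: power2_eq_square)
  finally have "(\<Sum>j\<in>I. ?d j) = 0" using e1 by (simp add: sum_subtractf)
  moreover have nn: "?d j \<ge> 0" if "j \<in> I" for j
    unfolding d[OF that] by (intro g_nonneg TS_minus bT that proj_TS[OF e])
  ultimately have "?d j = 0" if "j \<in> I" for j
    using sum_nonneg_eq_0_iff[OF fin, of ?d] that by auto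
  then show "spanned I e (b j)" if "j \<in> I" for j
    using d[OF that] g_eq_0_iff[OF TS_minus[OF bT[OF that] proj_TS[OF e]]] that
      proj_spanned[of I e p "b j"] by simp
qed

text \<open>
  Gram-Schmidt orthonormalisation inside a class \<open>P\<close> of vector fields that is a module over a class
  \<open>R\<close> of functions. It is used for all vector fields with all smooth functions, for sections of \<open>L\<close>,
  and for basic sections of \<open>Q\<close> with basic functions.
\<close>

lemma gram_schmidt:
  fixes X :: "'i \<Rightarrow> 'a vfield"
  assumes P_TS: "\<And>Y x. P Y \<Longrightarrow> x \<in> U \<Longrightarrow> Y x \<in> TS x"
    and P_zero: "P 0" and P_add: "\<And>Y Z. P Y \<Longrightarrow> P Z \<Longrightarrow> P (Y + Z)"
    and P_scale: "\<And>r Y. R r \<Longrightarrow> P Y \<Longrightarrow> P (fscale r Y)"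
    and R_g: "\<And>Y Z. P Y \<Longrightarrow> P Z \<Longrightarrow> R (gg Y Z)"
    and R_uminus: "\<And>r. R r \<Longrightarrow> R (\<lambda>x. - r x)"
    and R_inverse_sqrt: "\<And>r. R r \<Longrightarrow> (\<forall>x\<in>U. r x > 0) \<Longrightarrow> R (\<lambda>x. inverse (sqrt (r x)))"
    and S: "finite S" and PX: "\<And>i. i \<in> S \<Longrightarrow> P (X i)"
    and indep: "\<And>x c. x \<in> U \<Longrightarrow> (\<Sum>i\<in>S. tscale (c i) (X i x)) = 0 \<Longrightarrow> \<forall>i\<in>S. c i = 0"
  obtains E where "\<And>i. i \<in> S \<Longrightarrow> P (E i)" "\<And>x. x \<in> U \<Longrightarrow> orthonormal x S (\<lambda>i. E i x)"
    "\<And>x i. x \<in> U \<Longrightarrow> i \<in> S \<Longrightarrow> spanned S (\<lambda>i. E i x) (X i x)"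
proof -
  have P_sum: "P (\<Sum>j\<in>J. Y j)" if "\<And>j. j \<in> J \<Longrightarrow> P (Y j)" for J and Y :: "'i \<Rightarrow> 'a vfield"
    using that by (induction J rule: infinite_finite_induct) (auto intro: P_zero P_add)
  have "\<exists>E. (\<forall>i\<in>S. P (E i)) \<and> (\<forall>x\<in>U. orthonormal x S (\<lambda>i. E i x) \<and>
      (\<forall>i\<in>S. spanned S (\<lambda>i. E i x) (X i x) \<and> spanned S (\<lambda>i. X i x) (E i x)))"
    using S PX indep
  proof (induction S rule: finite_induct)
    case empty
    then show ?case by (auto simp: orthonormal_def)
  next
    case (insert i S)
    have ind: "\<forall>i\<in>S. c i = 0" if "x \<in> U" "(\<Sum>i\<in>S. tscale (c i) (X i x)) = 0" for x c
    proof -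
      have "(\<Sum>j\<in>insert i S. tscale ((c(i := 0)) j) (X j x)) = (\<Sum>j\<in>S. tscale (c j) (X j x))"
        using insert.hyps by (auto intro!: sum.cong)
      then have "\<forall>j\<in>insert i S. (c(i := 0)) j = 0" using insert.prems(2)[OF that(1)] that(2) by metis
      then show ?thesis using insert.hyps(2) by (metis fun_upd_other insertI2)
    qed
    have "\<exists>E. (\<forall>i\<in>S. P (E i)) \<and> (\<forall>x\<in>U. orthonormal x S (\<lambda>i. E i x) \<and>
        (\<forall>i\<in>S. spanned S (\<lambda>i. E i x) (X i x) \<and> spanned S (\<lambda>i. X i x) (E i x)))"
      by (rule insert.IH) (use insert.prems(1) ind in blast)+
    then obtain E where "(\<forall>i\<in>S. P (E i)) \<and> (\<forall>x\<in>U. orthonormal x S (\<lambda>i. E i x) \<and>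
        (\<forall>i\<in>S. spanned S (\<lambda>i. E i x) (X i x) \<and> spanned S (\<lambda>i. X i x) (E i x)))" ..
    then have E: "\<And>i. i \<in> S \<Longrightarrow> P (E i)" "\<And>x. x \<in> U \<Longrightarrow> orthonormal x S (\<lambda>i. E i x)"
      "\<And>x i. x \<in> U \<Longrightarrow> i \<in> S \<Longrightarrow> spanned S (\<lambda>i. E i x) (X i x)"
      "\<And>x i. x \<in> U \<Longrightarrow> i \<in> S \<Longrightarrow> spanned S (\<lambda>i. X i x) (E i x)"
      by blast+
    have Xi: "P (X i)" using insert.prems by simp
    \<comment> \<open>\<open>Y\<close> is nowhere zero: otherwise \<open>X i x\<close> would be a combination of the \<open>E j x\<close> and so of the \<open>X j x\<close>\<close>
    define Y where "Y = X i + (\<Sum>j\<in>S. fscale (\<lambda>x. - gg (X i) (E j) x) (E j))"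
    have PY: "P Y" unfolding Y_def by (intro P_add P_sum P_scale R_uminus R_g Xi E(1))
    have Yx: "Y x = X i x - proj x S (\<lambda>j. E j x) (X i x)" for x
      by (simp add: Y_def proj_def fun_eq_iff sum_fun_apply sum_negf)
    have Yne: "Y x \<noteq> 0" if x: "x \<in> U" for x
    proof
      assume "Y x = 0"
      then have "spanned S (\<lambda>i. E i x) (X i x)" using proj_spanned Yx by (metis eq_iff_diff_eq_0)
      then have "spanned S (\<lambda>i. X i x) (X i x)" by (rule spanned_trans) (rule E(4)[OF x])
      then obtain c where c: "X i x = (\<Sum>j\<in>S. tscale (c j) (X j x))" by (auto simp: spanned_def)
      have "(\<Sum>j\<in>insert i S. tscale (((\<lambda>j. - c j)(i := 1)) j) (X j x)) =
          X i x + (\<Sum>j\<in>S. tscale (- c j) (X j x))"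
        using insert.hyps by (subst sum.insert) (auto intro!: sum.cong)
      also have "\<dots> = 0" using c by (simp add: fun_eq_iff sum_fun_apply sum_negf)
      finally show False using insert.prems(2)[OF x] by fastforce
    qed
    let ?N = "gg Y Y"
    have N: "?N x > 0" if "x \<in> U" for x using g_pos[OF P_TS[OF PY that] Yne[OF that]] .
    define Ei where "Ei = fscale (\<lambda>x. inverse (sqrt (?N x))) Y"
    have PEi: "P Ei" unfolding Ei_def using N by (intro P_scale R_inverse_sqrt R_g PY) auto
    let ?E = "E(i := Ei)"
    have PE: "P (?E j)" if "j \<in> insert i S" for j using that E(1) PEi by auto
    have ortho: "orthonormal x (insert i S) (\<lambda>j. ?E j x)" if x: "x \<in> U" for x
    proof -
      have Y0: "g x (Ei x) (E j x) = 0" if j: "j \<in> S" for j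
        using proj_orthogonal[OF E(2)[OF x] P_TS[OF Xi x] j] unfolding Yx[symmetric]
        by (simp add: Ei_def g_scale_left[OF P_TS[OF PY x] P_TS[OF E(1)[OF j] x]])
      have "g x (Ei x) (Ei x) = inverse (sqrt (?N x)) * (inverse (sqrt (?N x)) * ?N x)"
        by (simp add: Ei_def g_scale_left g_scale_right P_TS[OF PY x] TS_scale)
      also have "\<dots> = 1" using N[OF x] by (simp add: field_simps)
      finally have "g x (Ei x) (Ei x) = 1" .
      then show ?thesis
        using E(2)[OF x] Y0 g_sym[OF P_TS[OF PEi x] P_TS[OF E(1) x]] P_TS[OF PE x] insert.hyps
        by (auto simp: orthonormal_def)
    qed
    have mono: "spanned (insert i S) (\<lambda>j. ?E j x) v" if "spanned S (\<lambda>j. E j x) v" for x v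
    proof -
      have "spanned S (\<lambda>j. ?E j x) v"
        using that insert.hyps unfolding spanned_def by (metis (mono_tags, lifting) fun_upd_other sum.cong)
      then show ?thesis using insert.hyps by (intro spanned_mono[of "insert i S" S]) auto
    qed
    have monoX: "spanned (insert i S) (\<lambda>j. X j x) v" if "spanned S (\<lambda>j. X j x) v" for x v
      using that insert.hyps by (intro spanned_mono[of "insert i S" S]) auto
    have mem: "spanned (insert i S) (\<lambda>j. ?E j x) (Ei x)" "spanned (insert i S) (\<lambda>j. X j x) (X i x)" for x
      using spanned_member[of "insert i S" i "\<lambda>j. ?E j x"] spanned_member[of "insert i S" i "\<lambda>j. X j x"]
        insert.hyps by auto
    have "spanned (insert i S) (\<lambda>j. ?E j x) (X i x)" if x: "x \<in> U" for x
    proof -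
      have "X i x = proj x S (\<lambda>j. E j x) (X i x) + tscale (sqrt (?N x)) (Ei x)"
        using N[OF x] by (simp add: Ei_def Yx)
      moreover have "spanned (insert i S) (\<lambda>j. ?E j x)
          (proj x S (\<lambda>j. E j x) (X i x) + tscale (sqrt (?N x)) (Ei x))"
        by (intro spanned_add mono proj_spanned spanned_scale mem)
      ultimately show ?thesis by simp
    qed
    moreover have "spanned (insert i S) (\<lambda>j. X j x) (Ei x)" if x: "x \<in> U" for x
    proof -
      have "Y x = X i x + tscale (- 1) (proj x S (\<lambda>j. E j x) (X i x))"
        by (simp add: Yx fun_eq_iff)
      moreover have "spanned (insert i S) (\<lambda>j. X j x) (proj x S (\<lambda>j. E j x) (X i x))"
        by (intro monoX spanned_trans[OF proj_spanned] E(4)[OF x])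
      ultimately show ?thesis
        unfolding Ei_def using mem by (auto intro!: spanned_scale spanned_add)
    qed
    ultimately show ?case
      using PE ortho mono[OF E(3)] monoX[OF E(4)] insert.hyps
      by (intro exI[of _ ?E]) auto
  qed
  then show ?thesis using that by blast
qed

lemma gram_schmidt_VF:
  fixes X :: "'i \<Rightarrow> 'a vfield"
  assumes "open U" "finite S" "\<And>i. i \<in> S \<Longrightarrow> X i \<in> VF U"
    and "\<And>x c. x \<in> U \<Longrightarrow> (\<Sum>i\<in>S. tscale (c i) (X i x)) = 0 \<Longrightarrow> \<forall>i\<in>S. c i = 0"
  obtains E where "\<And>i. i \<in> S \<Longrightarrow> E i \<in> VF U" "\<And>x. x \<in> U \<Longrightarrow> orthonormal x S (\<lambda>i. E i x)"
    "\<And>x i. x \<in> U \<Longrightarrow> i \<in> S \<Longrightarrow> spanned S (\<lambda>i. E i x) (X i x)"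
  by (rule gram_schmidt[where P = "\<lambda>Y. Y \<in> VF U" and R = "SF U" and U = U and S = S and X = X])
    (use assms that in \<open>auto intro: VF_TS VF_zero VF_add VF_scale gg_SF SF_uminus SF_inverse_sqrt\<close>)

lemma chart_vector_independent:
  assumes adm: "admissible (U, \<phi>)" and x: "x \<in> U"
    and 0: "(\<Sum>i\<in>S. tscale (c i) (chart_vector (U, \<phi>) (axis i 1) x)) = 0" and S: "j \<in> S"
  shows "c j = 0"
proof -
  have "(\<Sum>i\<in>S. tscale (c i) (chart_vector (U, \<phi>) (axis i 1) x)) (\<lambda>x. \<phi> x $ j) = c j"
    using S by (simp add: sum_fun_apply chart_vector_coord[OF adm x] axis_def if_distrib cong: if_cong)
  then show ?thesis using 0 by simp
qed

lemma orthonormal_frame_exists: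
  obtains U and E :: "'n \<Rightarrow> 'a vfield" where "open U" "p \<in> U" "\<And>i. E i \<in> VF U"
    "\<And>x. x \<in> U \<Longrightarrow> orthonormal x UNIV (\<lambda>i. E i x)"
    "\<And>x v. x \<in> U \<Longrightarrow> v \<in> TS x \<Longrightarrow> spanned UNIV (\<lambda>i. E i x) v"
proof -
  obtain U \<phi> where adm: "admissible (U, \<phi>)" and p: "p \<in> U" by (rule admissible_chart_at)
  note U = chart_facts(1)[OF admissible_chart[OF adm]]
  obtain E :: "'n \<Rightarrow> 'a vfield" where E: "\<And>i. i \<in> UNIV \<Longrightarrow> E i \<in> VF U" "\<And>x. x \<in> U \<Longrightarrow> orthonormal x UNIV (\<lambda>i. E i x)"
    "\<And>x i. x \<in> U \<Longrightarrow> i \<in> UNIV \<Longrightarrow> spanned UNIV (\<lambda>i. E i x) (chart_vector (U, \<phi>) (axis i 1) x)"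
  proof (rule gram_schmidt_VF[OF U, of "UNIV :: 'n set" "\<lambda>i. chart_vector (U, \<phi>) (axis i 1)"])
    show "\<forall>i\<in>UNIV. c i = 0" if "x \<in> U" "(\<Sum>i\<in>UNIV. tscale (c i) (chart_vector (U, \<phi>) (axis i 1) x)) = 0" for x c
      using chart_vector_independent[OF adm that] by blast
  qed (simp, rule chart_vector_VF[OF adm], rule that)
  have "spanned UNIV (\<lambda>i. E i x) v" if "x \<in> U" "v \<in> TS x" for x v
    by (subst TS_expansion[OF adm that]) (intro spanned_sum spanned_scale E(3) that UNIV_I)
  then show ?thesis using that[OF U p, of E] E by simp
qed

subsection \<open>The Koszul formula\<close>

text \<open>
  This is \<open>2 g(\<nabla>\<^sub>X Y, Z)\<close> for the Levi-Civita connection. It is linear over functions in \<open>X\<close> and in \<open>Z\<close>,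
  and satisfies a Leibniz rule in \<open>Y\<close>.
\<close>

definition koszul :: "'a vfield \<Rightarrow> 'a vfield \<Rightarrow> 'a vfield \<Rightarrow> 'a \<Rightarrow> real" where
  "koszul X Y Z p = X p (gg Y Z) + Y p (gg X Z) - Z p (gg X Y) +
     g p (bracket X Y p) (Z p) - g p (bracket X Z p) (Y p) - g p (bracket Y Z p) (X p)"

context
  fixes U :: "'a set" assumes U: "open U"
begin

lemma TS_gg_sym:
  assumes "v \<in> TS p" "p \<in> U" "X \<in> VF U" "Y \<in> VF U"
  shows "v (gg X Y) = v (gg Y X)"
  by (rule TS_cong[OF assms(1) U assms(2)]) (auto intro: g_sym VF_TS[OF assms(3)] VF_TS[OF assms(4)])

lemma TS_gg_add_left:
  assumes "v \<in> TS p" "p \<in> U" "X \<in> VF U" "Y \<in> VF U" "Z \<in> VF U"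
  shows "v (\<lambda>x. g x (X x + Y x) (Z x)) = v (gg X Z) + v (gg Y Z)"
proof -
  have "v (\<lambda>x. g x (X x + Y x) (Z x)) = v (\<lambda>x. gg X Z x + gg Y Z x)"
    by (rule TS_cong[OF assms(1) U assms(2)]) (use assms VF_TS in \<open>auto intro: g_add_left\<close>)
  then show ?thesis using TS_add[OF assms(1)] gg_near[OF _ _ U assms(2)] assms by simp
qed

lemma TS_gg_scale_left:
  assumes "v \<in> TS p" "p \<in> U" "SF U f" "Y \<in> VF U" "Z \<in> VF U"
  shows "v (gg (fscale f Y) Z) = v f * gg Y Z p + f p * v (gg Y Z)"
proof -
  have "v (gg (fscale f Y) Z) = v (\<lambda>x. f x * gg Y Z x)"
    by (rule TS_cong[OF assms(1) U assms(2)]) (use assms VF_TS in \<open>auto intro: g_scale_left\<close>)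
  then show ?thesis
    using TS_mult[OF assms(1) nearI[OF U assms(2,3)] gg_near[OF assms(4,5) U assms(2)]] by simp
qed

lemma TS_gg_add_right:
  assumes "v \<in> TS p" "p \<in> U" "X \<in> VF U" "Y \<in> VF U" "Z \<in> VF U"
  shows "v (\<lambda>x. g x (Z x) (X x + Y x)) = v (gg Z X) + v (gg Z Y)"
  using TS_gg_add_left[OF assms] TS_gg_sym[OF assms(1,2) assms(5,3)] TS_gg_sym[OF assms(1,2) assms(5,4)]
    TS_gg_sym[OF assms(1,2) assms(5) VF_add[OF assms(3,4)]] by simp

lemma TS_gg_scale_right:
  assumes "v \<in> TS p" "p \<in> U" "SF U f" "Y \<in> VF U" "Z \<in> VF U"
  shows "v (gg Z (fscale f Y)) = v f * gg Y Z p + f p * v (gg Z Y)"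
  using TS_gg_scale_left[OF assms] TS_gg_sym[OF assms(1,2) assms(5,4)]
    TS_gg_sym[OF assms(1,2) assms(5) VF_scale[OF assms(3,4)]] by simp

context
  fixes X Y Z :: "'a vfield" and p :: 'a assumes p: "p \<in> U" and X: "X \<in> VF U" and Y: "Y \<in> VF U" and Z: "Z \<in> VF U"
begin

lemma koszul_TS: "X p \<in> TS p" "Y p \<in> TS p" "Z p \<in> TS p" "bracket X Y p \<in> TS p" "bracket X Z p \<in> TS p"
  "bracket Y Z p \<in> TS p" "bracket Y X p \<in> TS p" "bracket Z X p \<in> TS p" "bracket Z Y p \<in> TS p"
  by (intro VF_TS[OF _ p] X Y Z bracket_VF U)+

lemma g_bracket_scale:
  assumes f: "SF U f" and V: "V \<in> VF U" and W: "W \<in> VF U" and u: "u \<in> TS p"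
  shows "g p (bracket (fscale f V) W p) u = f p * g p (bracket V W p) u - W p f * g p (V p) u"
    "g p (bracket V (fscale f W) p) u = V p f * g p (W p) u + f p * g p (bracket V W p) u"
proof -
  have T: "V p \<in> TS p" "W p \<in> TS p" "bracket V W p \<in> TS p"
    using V W VF_TS[OF _ p] bracket_VF[OF V W U] by auto
  show "g p (bracket (fscale f V) W p) u = f p * g p (bracket V W p) u - W p f * g p (V p) u"
    unfolding bracket_scale_left[OF V W f U p]
    by (simp add: g_diff_left g_scale_left TS_scale T u)
  show "g p (bracket V (fscale f W) p) u = V p f * g p (W p) u + f p * g p (bracket V W p) u"
    unfolding bracket_scale_right[OF V W f U p]
    by (simp add: g_add_left g_scale_left TS_scale T u)
qed

lemma koszul_scale1:
  assumes f: "SF U f"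
  shows "koszul (fscale f X) Y Z p = f p * koszul X Y Z p"
proof -
  note T = koszul_TS
  have "Y p (gg (fscale f X) Z) = Y p f * g p (X p) (Z p) + f p * Y p (gg X Z)"
    "Z p (gg (fscale f X) Y) = Z p f * g p (X p) (Y p) + f p * Z p (gg X Y)"
    by (rule TS_gg_scale_left[OF _ p f X]; intro T Y Z)+
  moreover have "g p (bracket Y Z p) (tscale (f p) (X p)) = f p * g p (bracket Y Z p) (X p)"
    by (intro g_scale_right T)
  ultimately show ?thesis
    unfolding koszul_def tscale_apply g_bracket_scale(1)[OF f X Y T(3)] g_bracket_scale(1)[OF f X Z T(2)]
    by (simp add: algebra_simps)
qed

lemma koszul_scale2:
  assumes f: "SF U f"
  shows "koszul X (fscale f Y) Z p = f p * koszul X Y Z p + 2 * X p f * g p (Y p) (Z p)"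
proof -
  note T = koszul_TS
  have "X p (gg (fscale f Y) Z) = X p f * g p (Y p) (Z p) + f p * X p (gg Y Z)"
    by (rule TS_gg_scale_left[OF _ p f Y]; intro T Z)
  moreover have "Z p (gg X (fscale f Y)) = Z p f * g p (Y p) (X p) + f p * Z p (gg X Y)"
    by (rule TS_gg_scale_right[OF _ p f Y]; intro T X)
  moreover have "g p (bracket X Z p) (tscale (f p) (Y p)) = f p * g p (bracket X Z p) (Y p)"
    by (intro g_scale_right T)
  ultimately show ?thesis
    unfolding koszul_def tscale_apply g_bracket_scale(2)[OF f X Y T(3)] g_bracket_scale(1)[OF f Y Z T(1)]
    by (simp add: algebra_simps)
qed

lemma koszul_scale3:
  assumes f: "SF U f"
  shows "koszul X Y (fscale f Z) p = f p * koszul X Y Z p"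
proof -
  note T = koszul_TS
  have "X p (gg Y (fscale f Z)) = X p f * g p (Z p) (Y p) + f p * X p (gg Y Z)"
    "Y p (gg X (fscale f Z)) = Y p f * g p (Z p) (X p) + f p * Y p (gg X Z)"
    by (rule TS_gg_scale_right[OF _ p f Z]; intro T X Y)+
  moreover have "g p (bracket X Y p) (tscale (f p) (Z p)) = f p * g p (bracket X Y p) (Z p)"
    by (intro g_scale_right T)
  ultimately show ?thesis
    unfolding koszul_def tscale_apply g_bracket_scale(2)[OF f X Z T(2)] g_bracket_scale(2)[OF f Y Z T(1)]
    by (simp add: algebra_simps)
qed

lemma koszul_torsion: "koszul X Y Z p - koszul Y X Z p = 2 * g p (bracket X Y p) (Z p)"
  using bracket_antisym[of Y X p]
  by (simp add: koszul_def koszul_TS g_uminus_left TS_gg_sym[OF _ p Y X])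

lemma koszul_metric: "koszul X Y Z p + koszul X Z Y p = 2 * X p (gg Y Z)"
  using bracket_antisym[of Z Y p]
  by (simp add: koszul_def koszul_TS g_uminus_left TS_gg_sym[OF _ p Z Y])

end

lemma koszul_add:
  assumes p: "p \<in> U" and X: "X \<in> VF U" and Y: "Y \<in> VF U" and Z: "Z \<in> VF U" and V: "V \<in> VF U"
  shows "koszul (X + V) Y Z p = koszul X Y Z p + koszul V Y Z p"
    "koszul Y (X + V) Z p = koszul Y X Z p + koszul Y V Z p"
    "koszul Y Z (X + V) p = koszul Y Z X p + koszul Y Z V p"
  using X Y Z V
  by (simp_all add: koszul_def TS_gg_add_left[OF _ p] TS_gg_add_right[OF _ p] VF_TS[OF _ p] bracket_VF[OF _ _ U]
      bracket_add_left[OF _ _ _ U p] bracket_add_right[OF _ _ _ U p] g_add_left g_add_right)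

lemma koszul_zero3: "p \<in> U \<Longrightarrow> X \<in> VF U \<Longrightarrow> Y \<in> VF U \<Longrightarrow> koszul X Y 0 p = 0"
  using koszul_add(3)[of p 0 X Y 0] VF_zero by simp

lemma koszul_sum3:
  "p \<in> U \<Longrightarrow> X \<in> VF U \<Longrightarrow> Y \<in> VF U \<Longrightarrow> (\<And>i. i \<in> I \<Longrightarrow> Z i \<in> VF U) \<Longrightarrow>
    koszul X Y (\<Sum>i\<in>I. Z i) p = (\<Sum>i\<in>I. koszul X Y (Z i) p)"
  by (induction I rule: infinite_finite_induct) (auto simp: koszul_zero3 koszul_add VF_sum)

lemma koszul_cong:
  assumes p: "p \<in> U" and XYZ: "X \<in> VF U" "Y \<in> VF U" "Z \<in> VF U"
    and eq: "\<And>x. x \<in> U \<Longrightarrow> X x = X' x" "\<And>x. x \<in> U \<Longrightarrow> Y x = Y' x" "\<And>x. x \<in> U \<Longrightarrow> Z x = Z' x"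
  shows "koszul X Y Z p = koszul X' Y' Z' p"
proof -
  have "X p (gg Y Z) = X p (gg Y' Z')" "Y p (gg X Z) = Y p (gg X' Z')" "Z p (gg X Y) = Z p (gg X' Y')"
    by (rule TS_cong[OF VF_TS[OF _ p] U p]; simp add: XYZ eq)+
  moreover have "bracket X Y p = bracket X' Y' p" "bracket X Z p = bracket X' Z' p" "bracket Y Z p = bracket Y' Z' p"
    by (rule bracket_cong[OF U p]; simp add: XYZ eq)+
  ultimately show ?thesis using eq p by (simp add: koszul_def)
qed

lemma koszul_SF: "X \<in> VF U \<Longrightarrow> Y \<in> VF U \<Longrightarrow> Z \<in> VF U \<Longrightarrow> SF U (koszul X Y Z)"
  unfolding koszul_def[abs_def]
  by (rule SF_diff[OF U] SF_add[OF U] gg_SF[OF _ _ U] bracket_VF[OF _ _ U] VF_SF[OF _ U order_refl] | assumption)+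

end

subsection \<open>Existence of the Levi-Civita connection\<close>

text \<open>
  The neighbourhood \<open>W\<close> is quantified because the connection takes fields without a domain, and its
  value at \<open>p\<close> must not depend on a choice of one.
\<close>

definition koszul_represents :: "'a vfield \<Rightarrow> 'a vfield \<Rightarrow> 'a \<Rightarrow> 'a tvec \<Rightarrow> bool" where
  "koszul_represents X Y p w \<longleftrightarrow> w \<in> TS p \<and> (\<forall>W Z. open W \<and> p \<in> W \<and> X \<in> VF W \<and> Y \<in> VF W \<and> Z \<in> VF W \<longrightarrow>
     2 * g p w (Z p) = koszul X Y Z p)"

definition koszul_conn :: "'a vfield \<Rightarrow> 'a vfield \<Rightarrow> 'a vfield" where
  "koszul_conn X Y p = (THE w. koszul_represents X Y p w)"

text \<open>Since \<open>koszul\<close> is linear over functions in \<open>Z\<close>, testing against the members of a frame is enough.\<close>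

lemma koszul_represents_frame:
  assumes U: "open U" "p \<in> U" and X: "X \<in> VF U" and Y: "Y \<in> VF U" and E: "\<And>i::'n. E i \<in> VF U"
    and on: "\<And>x. x \<in> U \<Longrightarrow> orthonormal x UNIV (\<lambda>i. E i x)"
    and sp: "\<And>x v. x \<in> U \<Longrightarrow> v \<in> TS x \<Longrightarrow> spanned UNIV (\<lambda>i. E i x) v"
  shows "koszul_represents X Y p (\<Sum>i\<in>UNIV. tscale (koszul X Y (E i) p / 2) (E i p))"
    (is "koszul_represents X Y p ?w")
  unfolding koszul_represents_def
proof (intro conjI allI impI)
  note Ep = VF_TS[OF E U(2)]
  show "?w \<in> TS p" by (intro TS_sum_mem TS_scale Ep)
  fix W Z assume "open W \<and> p \<in> W \<and> X \<in> VF W \<and> Y \<in> VF W \<and> Z \<in> VF W"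
  then have W: "open W" "p \<in> W" and Z: "Z \<in> VF W" by auto
  let ?V = "U \<inter> W"
  have V: "open ?V" "p \<in> ?V" using U W by auto
  have ZV: "Z \<in> VF ?V" by (rule VF_subset[OF Z]) simp
  have EV: "E i \<in> VF ?V" for i by (rule VF_subset[OF E]) simp
  note XV = VF_subset[OF X, of ?V, simplified] and YV = VF_subset[OF Y, of ?V, simplified]
  have c: "SF ?V (gg Z (E i))" for i by (rule gg_SF[OF ZV EV V(1)])
  have "koszul X Y Z p = koszul X Y (\<Sum>i\<in>UNIV. fscale (gg Z (E i)) (E i)) p"
  proof (rule koszul_cong[OF V(1,2) XV YV ZV refl refl])
    fix x assume x: "x \<in> ?V"
    then have "Z x = proj x UNIV (\<lambda>i. E i x) (Z x)"
      using proj_fix[OF on sp, of x "Z x"] VF_TS[OF ZV x] by simp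
    then show "Z x = (\<Sum>i\<in>UNIV. fscale (gg Z (E i)) (E i)) x" by (simp add: proj_def sum_fun_apply)
  qed
  also have "\<dots> = (\<Sum>i\<in>UNIV. g p (Z p) (E i p) * koszul X Y (E i) p)"
    by (simp add: koszul_sum3[OF V(1,2) XV YV] VF_scale[OF c EV] koszul_scale3[OF V(1,2) XV YV EV c])
  also have "\<dots> = 2 * g p ?w (Z p)"
    by (simp add: g_sum_left TS_scale Ep VF_TS[OF Z W(2)] g_scale_left g_sym[of "Z p"] sum_distrib_left mult.commute)
  finally show "2 * g p ?w (Z p) = koszul X Y Z p" by simp
qed

lemma koszul_represents_unique:
  assumes "koszul_represents X Y p v" "koszul_represents X Y p w" "open U" "p \<in> U" "X \<in> VF U" "Y \<in> VF U"
  shows "v = w"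
proof (rule g_eqI)
  show v: "v \<in> TS p" "w \<in> TS p" using assms(1,2) by (auto simp: koszul_represents_def)
  fix z assume z: "z \<in> TS p"
  obtain V Z where V: "open V" "p \<in> V" "Z \<in> VF V" "Z p = z" using VF_through[OF z] .
  have "open (U \<inter> V)" "p \<in> U \<inter> V" "X \<in> VF (U \<inter> V)" "Y \<in> VF (U \<inter> V)" "Z \<in> VF (U \<inter> V)"
    using assms V by (auto intro: VF_subset)
  then have "2 * g p v (Z p) = 2 * g p w (Z p)"
    using assms(1,2) unfolding koszul_represents_def by metis
  then show "g p v z = g p w z" using V(4) by simp
qed

lemma koszul_conn:
  assumes "open U" "p \<in> U" "X \<in> VF U" "Y \<in> VF U"
  shows "koszul_represents X Y p (koszul_conn X Y p)"
proof -
  obtain U' and E :: "'n \<Rightarrow> 'a vfield" where E: "open U'" "p \<in> U'" "\<And>i. E i \<in> VF U'"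
    "\<And>x. x \<in> U' \<Longrightarrow> orthonormal x UNIV (\<lambda>i. E i x)"
    "\<And>x v. x \<in> U' \<Longrightarrow> v \<in> TS x \<Longrightarrow> spanned UNIV (\<lambda>i. E i x) v"
    using orthonormal_frame_exists[of p] by metis
  have "koszul_represents X Y p (\<Sum>i\<in>UNIV. tscale (koszul X Y (E i) p / 2) (E i p))"
    by (rule koszul_represents_frame[of "U \<inter> U'"]) (use E assms in \<open>auto intro: VF_subset\<close>)
  then have "\<exists>!w. koszul_represents X Y p w" using koszul_represents_unique[OF _ _ assms] by blast
  then show ?thesis unfolding koszul_conn_def by (rule theI')
qed

lemma koszul_conn_g:
  assumes "open U" "p \<in> U" "X \<in> VF U" "Y \<in> VF U" "Z \<in> VF U"
  shows "2 * g p (koszul_conn X Y p) (Z p) = koszul X Y Z p"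
  using koszul_conn[OF assms(1-4)] assms by (auto simp: koszul_represents_def)

lemma koszul_conn_VF:
  assumes U: "open U" and X: "X \<in> VF U" and Y: "Y \<in> VF U"
  shows "koszul_conn X Y \<in> VF U"
proof (rule VF_local)
  fix p assume p: "p \<in> U"
  obtain U' and E :: "'n \<Rightarrow> 'a vfield" where E: "open U'" "p \<in> U'" "\<And>i. E i \<in> VF U'"
    "\<And>x. x \<in> U' \<Longrightarrow> orthonormal x UNIV (\<lambda>i. E i x)"
    "\<And>x v. x \<in> U' \<Longrightarrow> v \<in> TS x \<Longrightarrow> spanned UNIV (\<lambda>i. E i x) v"
    using orthonormal_frame_exists[of p] by metis
  let ?V = "U \<inter> U'"
  have V: "open ?V" "p \<in> ?V" using U E p by auto
  have XV: "X \<in> VF ?V" and YV: "Y \<in> VF ?V" and EV: "\<And>i. E i \<in> VF ?V"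
    using X Y E(3) by (auto intro: VF_subset)
  have "(\<Sum>i\<in>UNIV. fscale (\<lambda>x. (1 / 2) * koszul X Y (E i) x) (E i)) \<in> VF ?V"
    by (intro VF_sum VF_scale SF_cmult koszul_SF V XV YV EV)
  moreover have "(\<Sum>i\<in>UNIV. fscale (\<lambda>x. (1 / 2) * koszul X Y (E i) x) (E i)) x = koszul_conn X Y x"
    if x: "x \<in> ?V" for x
    using koszul_represents_unique[OF koszul_represents_frame[OF V(1) x XV YV EV]
        koszul_conn[OF V(1) x XV YV] V(1) x XV YV] E x
    by (simp add: sum_fun_apply)
  ultimately have "koszul_conn X Y \<in> VF ?V" using VF_cong by blast
  then show "\<exists>W. open W \<and> p \<in> W \<and> koszul_conn X Y \<in> VF W" using V by blast
qed

lemma g_eqI_VF: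
  assumes "open U" "p \<in> U" "u \<in> TS p" "v \<in> TS p"
    "\<And>W Z. open W \<Longrightarrow> p \<in> W \<Longrightarrow> W \<subseteq> U \<Longrightarrow> Z \<in> VF W \<Longrightarrow> g p u (Z p) = g p v (Z p)"
  shows "u = v"
proof (rule g_eqI[OF assms(3,4)])
  fix z assume z: "z \<in> TS p"
  obtain V Z where "open V" "p \<in> V" "Z \<in> VF V" "Z p = z" using VF_through[OF z] .
  then show "g p u z = g p v z"
    using assms(5)[of "U \<inter> V" Z] assms(1,2) VF_subset[of Z V "U \<inter> V"] by auto
qed

text \<open>Every axiom becomes an identity for \<open>koszul\<close> after pairing with an arbitrary field.\<close>

lemma levi_civita_exists: "is_levi_civita A g koszul_conn"
  unfolding is_levi_civita_def
proof (intro allI impI ballI conjI)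
  fix U X Y assume U: "open U" and X: "X \<in> VF U" and Y: "Y \<in> VF U"
  show "koszul_conn X Y \<in> VF U" by (rule koszul_conn_VF[OF U X Y])
  have KT: "koszul_conn V W p \<in> TS p" if "V \<in> VF U" "W \<in> VF U" "p \<in> U" for V W p
    using VF_TS[OF koszul_conn_VF[OF U that(1,2)] that(3)] .
  note sub = VF_subset[OF X] VF_subset[OF Y]
  show "koszul_conn X Y p - koszul_conn Y X p = bracket X Y p" if p: "p \<in> U" for p
  proof (rule g_eqI_VF[OF U p])
    fix W Z assume W: "open W" "p \<in> W" "W \<subseteq> U" "Z \<in> VF W"
    have XW: "X \<in> VF W" and YW: "Y \<in> VF W" using sub W(3) by auto
    show "g p (koszul_conn X Y p - koszul_conn Y X p) (Z p) = g p (bracket X Y p) (Z p)"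
      using koszul_conn_g[OF W(1,2) XW YW W(4)] koszul_conn_g[OF W(1,2) YW XW W(4)]
        koszul_torsion[OF W(1,2) XW YW W(4)]
      by (simp add: g_diff_left KT X Y p VF_TS[OF W(4,2)])
  qed (intro TS_minus KT X Y p VF_TS[OF bracket_VF[OF X Y U]])+
  fix f p assume f: "SF U f" and p: "p \<in> U"
  note fX = VF_scale[OF f X] and fY = VF_scale[OF f Y]
  show "koszul_conn (fscale f X) Y p = tscale (f p) (koszul_conn X Y p)"
  proof (rule g_eqI_VF[OF U p])
    fix W Z assume W: "open W" "p \<in> W" "W \<subseteq> U" "Z \<in> VF W"
    have XW: "X \<in> VF W" and YW: "Y \<in> VF W" and fW: "SF W f" and fXW: "fscale f X \<in> VF W"
      using sub W(3) SF_subset[OF f] VF_subset[OF fX] by auto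
    show "g p (koszul_conn (fscale f X) Y p) (Z p) = g p (tscale (f p) (koszul_conn X Y p)) (Z p)"
      using koszul_conn_g[OF W(1,2) fXW YW W(4)]
      unfolding koszul_scale1[OF W(1,2) XW YW W(4) fW] koszul_conn_g[OF W(1,2) XW YW W(4), symmetric]
      by (simp add: g_scale_left KT X Y p VF_TS[OF W(4,2)])
  qed (intro TS_scale KT X Y fX p)+
  show "koszul_conn X (fscale f Y) p = tscale (X p f) (Y p) + tscale (f p) (koszul_conn X Y p)"
  proof (rule g_eqI_VF[OF U p])
    fix W Z assume W: "open W" "p \<in> W" "W \<subseteq> U" "Z \<in> VF W"
    have XW: "X \<in> VF W" and YW: "Y \<in> VF W" and fW: "SF W f" and fYW: "fscale f Y \<in> VF W"
      using sub W(3) SF_subset[OF f] VF_subset[OF fY] by auto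
    show "g p (koszul_conn X (fscale f Y) p) (Z p) =
        g p (tscale (X p f) (Y p) + tscale (f p) (koszul_conn X Y p)) (Z p)"
      using koszul_conn_g[OF W(1,2) XW fYW W(4)]
      unfolding koszul_scale2[OF W(1,2) XW YW W(4) fW] koszul_conn_g[OF W(1,2) XW YW W(4), symmetric]
      by (simp add: g_add_left TS_scale g_scale_left KT X Y p VF_TS[OF W(4,2)] VF_TS[OF Y p] algebra_simps)
  qed (intro TS_plus TS_scale KT X Y fY p VF_TS[OF Y])+
next
  fix U X Y Z p assume U: "open U" and X: "X \<in> VF U" and Y: "Y \<in> VF U" and Z: "Z \<in> VF U" and p: "p \<in> U"
  have KT: "koszul_conn V W p \<in> TS p" if "V \<in> VF U" "W \<in> VF U" for V W
    using VF_TS[OF koszul_conn_VF[OF U that] p] .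
  note sub = VF_subset[OF X] VF_subset[OF Y] VF_subset[OF Z]
  show "koszul_conn (X + Z) Y p = koszul_conn X Y p + koszul_conn Z Y p"
  proof (rule g_eqI_VF[OF U p])
    fix W V assume W: "open W" "p \<in> W" "W \<subseteq> U" "V \<in> VF W"
    have XW: "X \<in> VF W" and YW: "Y \<in> VF W" and ZW: "Z \<in> VF W" using sub W(3) by auto
    show "g p (koszul_conn (X + Z) Y p) (V p) = g p (koszul_conn X Y p + koszul_conn Z Y p) (V p)"
      using koszul_conn_g[OF W(1,2) XW YW W(4)] koszul_conn_g[OF W(1,2) ZW YW W(4)]
        koszul_conn_g[OF W(1,2) VF_add[OF XW ZW] YW W(4)] koszul_add(1)[OF W(1,2) XW YW W(4) ZW]
      by (simp add: g_add_left KT X Y Z VF_TS[OF W(4,2)])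
  qed (intro TS_plus KT X Y Z VF_add)+
  show "koszul_conn X (Y + Z) p = koszul_conn X Y p + koszul_conn X Z p"
  proof (rule g_eqI_VF[OF U p])
    fix W V assume W: "open W" "p \<in> W" "W \<subseteq> U" "V \<in> VF W"
    have XW: "X \<in> VF W" and YW: "Y \<in> VF W" and ZW: "Z \<in> VF W" using sub W(3) by auto
    show "g p (koszul_conn X (Y + Z) p) (V p) = g p (koszul_conn X Y p + koszul_conn X Z p) (V p)"
      using koszul_conn_g[OF W(1,2) XW YW W(4)] koszul_conn_g[OF W(1,2) XW ZW W(4)]
        koszul_conn_g[OF W(1,2) XW VF_add[OF YW ZW] W(4)] koszul_add(2)[OF W(1,2) YW XW W(4) ZW]
      by (simp add: g_add_left KT X Y Z VF_TS[OF W(4,2)])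
  qed (intro TS_plus KT X Y Z VF_add)+
  show "X p (gg Y Z) = g p (koszul_conn X Y p) (Z p) + g p (Y p) (koszul_conn X Z p)"
    using koszul_conn_g[OF U p X Y Z] koszul_conn_g[OF U p X Z Y] koszul_metric[OF U p X Y Z]
      g_sym[OF KT[OF X Z] VF_TS[OF Y p]] by simp
qed

abbreviation "LC \<equiv> levi_civita A g"

lemma levi_civita: "is_levi_civita A g LC"
  unfolding levi_civita_def by (rule someI[of "is_levi_civita A g", OF levi_civita_exists])

context
  fixes U :: "'a set" and X Y :: "'a vfield" assumes U: "open U" and X: "X \<in> VF U" and Y: "Y \<in> VF U"
begin

lemmas LC_axioms = bspec[OF bspec[OF mp[OF spec[OF levi_civita[unfolded is_levi_civita_def]] U] X] Y]

lemma LC_VF: "LC X Y \<in> VF U"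
  by (rule conjunct1[OF LC_axioms])

lemma LC_torsion: "p \<in> U \<Longrightarrow> LC X Y p - LC Y X p = bracket X Y p"
  by (rule bspec[OF conjunct1[OF conjunct2[OF LC_axioms]]])

lemma
  assumes f: "SF U f" and p: "p \<in> U"
  shows LC_scale_left: "LC (fscale f X) Y p = tscale (f p) (LC X Y p)"
    and LC_scale_right: "LC X (fscale f Y) p = tscale (X p f) (Y p) + tscale (f p) (LC X Y p)"
proof -
  note * = bspec[OF mp[OF spec[OF conjunct1[OF conjunct2[OF conjunct2[OF LC_axioms]]]] f] p]
  show "LC (fscale f X) Y p = tscale (f p) (LC X Y p)" by (rule conjunct1[OF *])
  show "LC X (fscale f Y) p = tscale (X p f) (Y p) + tscale (f p) (LC X Y p)" by (rule conjunct2[OF *])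
qed

lemma
  assumes Z: "Z \<in> VF U" and p: "p \<in> U"
  shows LC_add_left: "LC (X + Z) Y p = LC X Y p + LC Z Y p"
    and LC_add_right: "LC X (Y + Z) p = LC X Y p + LC X Z p"
    and LC_metric: "X p (gg Y Z) = g p (LC X Y p) (Z p) + g p (Y p) (LC X Z p)"
proof -
  note * = bspec[OF bspec[OF conjunct2[OF conjunct2[OF conjunct2[OF LC_axioms]]] Z] p]
  show "LC (X + Z) Y p = LC X Y p + LC Z Y p" by (rule conjunct1[OF *])
  show "LC X (Y + Z) p = LC X Y p + LC X Z p" by (rule conjunct1[OF conjunct2[OF *]])
  show "X p (gg Y Z) = g p (LC X Y p) (Z p) + g p (Y p) (LC X Z p)"
    by (rule conjunct2[OF conjunct2[OF *]])
qed

end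

text \<open>
  Torsion-freeness and compatibility with the metric determine the connection. As \<open>koszul\<close> only uses
  the fields near the point, so does every Levi-Civita connection.
\<close>

lemma LC_koszul:
  assumes U: "open U" and p: "p \<in> U" and X: "X \<in> VF U" and Y: "Y \<in> VF U" and Z: "Z \<in> VF U"
  shows "2 * g p (LC X Y p) (Z p) = koszul X Y Z p"
proof -
  have T: "LC V W p \<in> TS p" if "V \<in> VF U" "W \<in> VF U" for V W using VF_TS[OF LC_VF[OF U that] p] .
  have "g p (bracket V W p) u = g p (LC V W p) u - g p (LC W V p) u"
    if "V \<in> VF U" "W \<in> VF U" "u \<in> TS p" for V W u
    using LC_torsion[OF U that(1,2) p, symmetric] g_diff_left[OF T T] that by simp
  note b = this[OF X Y VF_TS[OF Z p]] this[OF X Z VF_TS[OF Y p]] this[OF Y Z VF_TS[OF X p]]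
  show ?thesis
    using LC_metric[OF U X Y Z p] LC_metric[OF U Y X Z p] LC_metric[OF U Z X Y p]
      g_sym[OF T[OF X Z] VF_TS[OF Y p]] g_sym[OF T[OF Y Z] VF_TS[OF X p]] g_sym[OF T[OF Z Y] VF_TS[OF X p]]
    unfolding koszul_def b by simp
qed

lemma LC_cong:
  assumes U: "open U" and p: "p \<in> U" and X: "X \<in> VF U" and Y: "Y \<in> VF U"
    and eq: "\<And>x. x \<in> U \<Longrightarrow> X x = X' x" "\<And>x. x \<in> U \<Longrightarrow> Y x = Y' x"
  shows "LC X Y p = LC X' Y' p"
proof -
  have X': "X' \<in> VF U" "Y' \<in> VF U" using VF_cong[OF eq(1) X] VF_cong[OF eq(2) Y] by auto
  show ?thesis
  proof (rule g_eqI_VF[OF U p])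
    fix W Z assume W: "open W" "p \<in> W" "W \<subseteq> U" "Z \<in> VF W"
    note sub = VF_subset[OF _ W(3)]
    show "g p (LC X Y p) (Z p) = g p (LC X' Y' p) (Z p)"
      using LC_koszul[OF W(1,2) sub[OF X] sub[OF Y] W(4)] LC_koszul[OF W(1,2) sub[OF X'(1)] sub[OF X'(2)] W(4)]
        koszul_cong[OF W(1,2) sub[OF X] sub[OF Y] W(4), of X' Y' Z] eq W(3) by (auto simp: subset_iff)
  qed (use VF_TS[OF LC_VF[OF U] p] X Y X' in auto)
qed

end

section \<open>Foliations and the transversal Levi-Civita connection\<close>

locale foliated_manifold = riemannian_manifold A g
  for A :: "('a::t2_space, 'n::finite) chart set" and g +
  fixes T :: "'n set" and F :: "('a, 'n) chart set"
  assumes foliation: "foliation A T F" and bundle_like: "bundle_like A T F g"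
begin

abbreviation "Lp \<equiv> L_space A T F"
abbreviation "Qp \<equiv> Q_space A T F g"
abbreviation "LS \<equiv> L_sections A T F"
abbreviation "QS \<equiv> Q_sections A T F g"
abbreviation "IA \<equiv> inf_automorphisms A T F"
abbreviation np :: "'a \<Rightarrow> 'a tvec \<Rightarrow> 'a tvec" where "np \<equiv> nproj A T F g"
abbreviation QP :: "'a vfield \<Rightarrow> 'a vfield" where "QP X \<equiv> (\<lambda>x. np x (X x))"
abbreviation LP :: "'a vfield \<Rightarrow> 'a vfield" where "LP X \<equiv> (\<lambda>x. X x - np x (X x))"
abbreviation conn :: "'a vfield \<Rightarrow> 'a vfield \<Rightarrow> 'a vfield" where "conn \<equiv> trans_conn A T F g"
abbreviation curv :: "'a vfield \<Rightarrow> 'a vfield \<Rightarrow> 'a vfield \<Rightarrow> 'a vfield" where "curv \<equiv> trans_curv A T F g"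

subsection \<open>The tangent bundle of the foliation\<close>

lemma F_admissible: "c \<in> F \<Longrightarrow> admissible c"
  using foliation by (auto simp: foliation_def admissible_def)

lemma F_chart_at: obtains U \<phi> where "(U, \<phi>) \<in> F" "p \<in> U"
proof -
  have "p \<in> (\<Union>c\<in>F. fst c)" using foliation by (simp add: foliation_def)
  then show ?thesis using that by auto
qed

lemma F_open: "(U, \<phi>) \<in> F \<Longrightarrow> open U"
  using chart_facts(1)[OF admissible_chart[OF F_admissible]] .

lemma near_F_coordinate: "(U, \<phi>) \<in> F \<Longrightarrow> p \<in> U \<Longrightarrow> near p (\<lambda>x. \<phi> x $ i)"
  by (rule nearI[OF F_open _ SF_coordinate[OF F_admissible F_open order_refl]])

lemma Lp_TS: "v \<in> Lp p \<Longrightarrow> v \<in> TS p"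
  by (simp add: L_space_def)

text \<open>
  A vector annihilating the transverse coordinates of one foliated chart is tangent to the plaques;
  the transverse coordinates of any other foliated chart are constant along these, so it annihilates
  them as well.
\<close>

lemma Lp_iff:
  assumes c: "(U, \<phi>) \<in> F" and p: "p \<in> U" and v: "v \<in> TS p"
  shows "v \<in> Lp p \<longleftrightarrow> (\<forall>i\<in>T. v (\<lambda>x. \<phi> x $ i) = 0)"
proof
  show "v \<in> Lp p \<Longrightarrow> \<forall>i\<in>T. v (\<lambda>x. \<phi> x $ i) = 0" using c p by (auto simp: L_space_def)
next
  assume 0: "\<forall>i\<in>T. v (\<lambda>x. \<phi> x $ i) = 0"
  note adm = F_admissible[OF c]
  note U = chart_facts[OF admissible_chart[OF adm]]
  let ?w = "vcoord \<phi> v"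
  have tc: "trans_coord T (\<phi> p + t *\<^sub>R ?w) = trans_coord T (\<phi> p)" for t
    using 0 by (auto simp: trans_coord_def vcoord_def vec_eq_iff)
  have "v (\<lambda>x. \<psi> x $ i) = 0" if d: "(V, \<psi>) \<in> F" and pV: "p \<in> V" and i: "i \<in> T" for V \<psi> i
  proof -
    have "\<exists>W h. open W \<and> p \<in> W \<and> W \<subseteq> U \<inter> V \<and> (\<forall>x\<in>W. trans_coord T (\<psi> x) = h (trans_coord T (\<phi> x)))"
      using bspec[OF bspec[OF conjunct2[OF conjunct2[OF foliation[unfolded foliation_def]]] c, unfolded prod.case] d]
        p pV by simp
    then obtain W h where W: "open W" "p \<in> W" "W \<subseteq> U \<inter> V"
      and h: "\<And>x. x \<in> W \<Longrightarrow> trans_coord T (\<psi> x) = h (trans_coord T (\<phi> x))" by blast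
    let ?G = "\<lambda>y. \<psi> (inv_into U \<phi> y) $ i"
    let ?D = "frechet_derivative ?G (at (\<phi> p))"
    have G: "(?G has_derivative ?D) (at (\<phi> p))"
      by (rule near_chart_derivative[OF adm p near_F_coordinate[OF d pV]])
    have oW: "open (\<phi> ` W)" using U(7)[OF W(1)] W(3) by simp
    let ?S = "{t. \<phi> p + t *\<^sub>R ?w \<in> \<phi> ` W}"
    have S: "open ?S"
      using open_vimage[OF oW, of "\<lambda>t. \<phi> p + t *\<^sub>R ?w"] by (simp add: vimage_def continuous_intros)
    have const: "?G (\<phi> p + t *\<^sub>R ?w) = h (trans_coord T (\<phi> p)) $ i" if t: "t \<in> ?S" for t
    proof -
      obtain x where x: "x \<in> W" "\<phi> p + t *\<^sub>R ?w = \<phi> x" using t by auto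
      then have "?G (\<phi> p + t *\<^sub>R ?w) = \<psi> x $ i" using U(5) W(3) by auto
      also have "\<dots> = trans_coord T (\<psi> x) $ i" using i by (simp add: trans_coord_def)
      also have "\<dots> = h (trans_coord T (\<phi> p)) $ i" using h[OF x(1)] tc x(2) by metis
      finally show ?thesis .
    qed
    have "((\<lambda>t. \<phi> p + t *\<^sub>R ?w) has_derivative (\<lambda>t. t *\<^sub>R ?w)) (at 0)"
      by (auto intro!: derivative_eq_intros)
    from has_derivative_compose[OF this, of ?G ?D] G
    have "((\<lambda>t. ?G (\<phi> p + t *\<^sub>R ?w)) has_derivative (\<lambda>t. ?D (t *\<^sub>R ?w))) (at 0)" by simp
    moreover have "((\<lambda>t. ?G (\<phi> p + t *\<^sub>R ?w)) has_derivative (\<lambda>t. 0)) (at 0)"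
      by (rule has_derivative_transform_within_open[OF has_derivative_const S]) (use W const in auto)
    ultimately have "(\<lambda>t. ?D (t *\<^sub>R ?w)) = (\<lambda>t. 0)" by (rule has_derivative_unique)
    from fun_cong[OF this, of 1] show ?thesis
      using TS_chart[OF adm p v near_F_coordinate[OF d pV]] by simp
  qed
  then show "v \<in> Lp p" using v by (auto simp: L_space_def)
qed

lemma Lp_zero: "0 \<in> Lp p"
  by (auto simp: L_space_def TS_zero)

lemma Lp_add: "v \<in> Lp p \<Longrightarrow> w \<in> Lp p \<Longrightarrow> v + w \<in> Lp p"
  by (fastforce simp: L_space_def TS_plus)

lemma Lp_scale: "v \<in> Lp p \<Longrightarrow> tscale c v \<in> Lp p"
  by (fastforce simp: L_space_def TS_scale)

lemma Lp_uminus: "v \<in> Lp p \<Longrightarrow> - v \<in> Lp p"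
  using Lp_scale[of v p "- 1"] by (simp add: tscale_def fun_Compl_def)

lemma Lp_diff: "v \<in> Lp p \<Longrightarrow> w \<in> Lp p \<Longrightarrow> v - w \<in> Lp p"
  using Lp_add[OF _ Lp_uminus, of v p w] by simp

lemma Lp_sum: "(\<And>i. i \<in> I \<Longrightarrow> v i \<in> Lp p) \<Longrightarrow> (\<Sum>i\<in>I. v i) \<in> Lp p"
  by (induction I rule: infinite_finite_induct) (auto intro: Lp_zero Lp_add)

lemma LS_VF: "X \<in> LS U \<Longrightarrow> X \<in> VF U"
  by (simp add: L_sections_def)

lemma LS_Lp: "X \<in> LS U \<Longrightarrow> p \<in> U \<Longrightarrow> X p \<in> Lp p"
  by (simp add: L_sections_def)

lemma LSI: "X \<in> VF U \<Longrightarrow> (\<And>p. p \<in> U \<Longrightarrow> X p \<in> Lp p) \<Longrightarrow> X \<in> LS U"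
  by (simp add: L_sections_def)

lemma LS_zero: "0 \<in> LS U"
  by (auto intro!: LSI VF_zero simp: Lp_zero)

lemma LS_add: "X \<in> LS U \<Longrightarrow> Y \<in> LS U \<Longrightarrow> X + Y \<in> LS U"
  by (auto intro!: LSI VF_add Lp_add simp: LS_VF LS_Lp)

lemma LS_scale: "SF U f \<Longrightarrow> X \<in> LS U \<Longrightarrow> fscale f X \<in> LS U"
  by (auto intro!: LSI VF_scale Lp_scale simp: LS_VF LS_Lp)

lemma LS_annihilates:
  assumes X: "X \<in> LS U" and c: "(V, \<phi>) \<in> F" and x: "x \<in> U" "x \<in> V" and i: "i \<in> T"
  shows "X x (\<lambda>x. \<phi> x $ i) = 0"
  using LS_Lp[OF X x(1)] c x i by (auto simp: L_space_def)

text \<open>The foliation is involutive: fields tangent to the leaves annihilate transverse coordinates.\<close>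

lemma bracket_LS:
  assumes X: "X \<in> LS U" and Y: "Y \<in> LS U" and U: "open U"
  shows "bracket X Y \<in> LS U"
proof (rule LSI[OF bracket_VF[OF LS_VF[OF X] LS_VF[OF Y] U]])
  fix p assume p: "p \<in> U"
  obtain V \<phi> where c: "(V, \<phi>) \<in> F" and pV: "p \<in> V" by (rule F_chart_at)
  have o: "open (U \<inter> V)" "p \<in> U \<inter> V" using U F_open[OF c] p pV by auto
  show "bracket X Y p \<in> Lp p"
    unfolding Lp_iff[OF c pV VF_TS[OF bracket_VF[OF LS_VF[OF X] LS_VF[OF Y] U] p]]
  proof
    fix i assume i: "i \<in> T"
    have 0: "Z p (\<lambda>x. Z' x (\<lambda>x. \<phi> x $ i)) = 0" if Z: "Z \<in> LS U" "Z' \<in> LS U" for Z Z'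
    proof -
      have "Z p (\<lambda>x. Z' x (\<lambda>x. \<phi> x $ i)) = Z p (\<lambda>x. 0)"
        by (rule TS_cong[OF VF_TS[OF LS_VF[OF Z(1)] p] o]) (use LS_annihilates[OF Z(2) c _ _ i] in auto)
      then show ?thesis using TS_const[OF VF_TS[OF LS_VF[OF Z(1)] p]] by simp
    qed
    show "bracket X Y p (\<lambda>x. \<phi> x $ i) = 0"
      by (simp add: bracket_apply[OF near_F_coordinate[OF c pV]] 0 X Y)
  qed
qed

text \<open>
  The coordinate fields of a foliated chart with index outside \<open>T\<close> span the tangent spaces of the
  leaves; Gram-Schmidt makes them orthonormal. The normal projection is smooth because it is given
  by such a frame.
\<close>

lemma leaf_frame_exists:
  obtains U and e :: "'n \<Rightarrow> 'a vfield" where "open U" "p \<in> U" "\<And>j. j \<in> - T \<Longrightarrow> e j \<in> LS U"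
    "\<And>x. x \<in> U \<Longrightarrow> orthonormal x (- T) (\<lambda>j. e j x)"
    "\<And>x v. x \<in> U \<Longrightarrow> v \<in> Lp x \<Longrightarrow> spanned (- T) (\<lambda>j. e j x) v"
proof -
  obtain U \<phi> where c: "(U, \<phi>) \<in> F" and p: "p \<in> U" by (rule F_chart_at)
  note adm = F_admissible[OF c] and U = F_open[OF c]
  let ?d = "\<lambda>i. chart_vector (U, \<phi>) (axis i 1)"
  have dL: "?d j \<in> LS U" if "j \<in> - T" for j
    using that
    by (intro LSI[OF chart_vector_VF[OF adm]])
      (auto simp: Lp_iff[OF c _ chart_vector_TS[OF adm]] chart_vector_coord[OF adm] axis_def)
  obtain e :: "'n \<Rightarrow> 'a vfield" where e: "\<And>j. j \<in> - T \<Longrightarrow> e j \<in> LS U"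
    "\<And>x. x \<in> U \<Longrightarrow> orthonormal x (- T) (\<lambda>j. e j x)"
    "\<And>x j. x \<in> U \<Longrightarrow> j \<in> - T \<Longrightarrow> spanned (- T) (\<lambda>j. e j x) (?d j x)"
  proof (rule gram_schmidt[where P = "\<lambda>Y. Y \<in> LS U" and R = "SF U" and U = U and S = "- T" and X = ?d])
    show "\<forall>i\<in>- T. c i = 0" if "x \<in> U" "(\<Sum>i\<in>- T. tscale (c i) (?d i x)) = 0" for x c
      using chart_vector_independent[OF adm that] by blast
    show "Y x \<in> TS x" if "Y \<in> LS U" "x \<in> U" for Y x by (rule VF_TS[OF LS_VF[OF that(1)] that(2)])
    show "SF U (gg Y Z)" if "Y \<in> LS U" "Z \<in> LS U" for Y Z by (rule gg_SF[OF LS_VF[OF that(1)] LS_VF[OF that(2)] U])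
    show "SF U (\<lambda>x. - r x)" if "SF U r" for r by (rule SF_uminus[OF U that])
    show "SF U (\<lambda>x. inverse (sqrt (r x)))" if "SF U r" "\<forall>x\<in>U. r x > 0" for r
      using SF_inverse_sqrt[OF U that(1)] that(2) by blast
  qed (rule LS_zero, erule (1) LS_add, erule (1) LS_scale, simp, erule dL, rule that)
  have "spanned (- T) (\<lambda>j. e j x) v" if x: "x \<in> U" and v: "v \<in> Lp x" for x v
  proof -
    have 0: "\<forall>i\<in>T. v (\<lambda>x. \<phi> x $ i) = 0" using Lp_iff[OF c x Lp_TS[OF v]] v by simp
    show ?thesis
    proof (subst TS_expansion[OF adm x Lp_TS[OF v]], rule spanned_sum)
      fix i show "spanned (- T) (\<lambda>j. e j x) (tscale (v (\<lambda>x. \<phi> x $ i)) (?d i x))"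
        using 0 e(3)[OF x, of i] by (cases "i \<in> T") (auto intro: spanned_zero spanned_scale)
    qed
  qed
  then show ?thesis using that[OF U p, of e] e by simp
qed

subsection \<open>The normal bundle\<close>

lemma Qp_TS: "v \<in> Qp p \<Longrightarrow> v \<in> TS p"
  by (simp add: Q_space_def)

lemma Qp_orthogonal: "v \<in> Qp p \<Longrightarrow> w \<in> Lp p \<Longrightarrow> g p v w = 0"
  by (simp add: Q_space_def)

lemma Qp_zero: "0 \<in> Qp p"
  by (auto simp: Q_space_def TS_zero g_zero_left Lp_TS)

lemma Qp_add: "v \<in> Qp p \<Longrightarrow> w \<in> Qp p \<Longrightarrow> v + w \<in> Qp p"
  by (auto simp: Q_space_def TS_plus g_add_left Lp_TS)

lemma Qp_scale: "v \<in> Qp p \<Longrightarrow> tscale c v \<in> Qp p"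
  by (auto simp: Q_space_def TS_scale g_scale_left Lp_TS)

lemma Qp_diff: "v \<in> Qp p \<Longrightarrow> w \<in> Qp p \<Longrightarrow> v - w \<in> Qp p"
  by (auto simp: Q_space_def TS_minus g_diff_left Lp_TS)


lemma Qp_Lp: "v \<in> Qp p \<Longrightarrow> v \<in> Lp p \<Longrightarrow> v = 0"
  using Qp_orthogonal[of v p v] g_eq_0_iff[OF Lp_TS] by auto

lemma np_eqI:
  assumes "w \<in> Qp p" "v - w \<in> Lp p"
  shows "np p v = w"
  unfolding nproj_def
proof (rule the_equality)
  show "w \<in> Qp p \<and> v - w \<in> Lp p" using assms by simp
  fix w' assume w': "w' \<in> Qp p \<and> v - w' \<in> Lp p"
  have "w' - w \<in> Lp p" using Lp_diff[OF assms(2), of "v - w'"] w' by simp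
  then show "w' = w" using Qp_Lp[OF Qp_diff[of w' p w]] w' assms(1) by simp
qed

lemma np_frame:
  assumes on: "orthonormal p I e" and eL: "\<And>j. j \<in> I \<Longrightarrow> e j \<in> Lp p"
    and sp: "\<And>v. v \<in> Lp p \<Longrightarrow> spanned I e v" and v: "v \<in> TS p"
  shows "v - proj p I e v \<in> Qp p" "np p v = v - proj p I e v"
proof -
  note D = TS_minus[OF v proj_TS[OF on, of v]]
  show Q: "v - proj p I e v \<in> Qp p"
    unfolding Q_space_def using D
    by (auto intro!: orthogonal_spanned[OF D _ _ sp] proj_orthogonal[OF on v] Lp_TS[OF eL])
  show "np p v = v - proj p I e v"
    by (rule np_eqI[OF Q]) (simp add: proj_def eL Lp_sum Lp_scale)
qed

lemma
  assumes v: "v \<in> TS p"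
  shows np_Qp: "np p v \<in> Qp p" and np_Lp: "v - np p v \<in> Lp p"
proof -
  obtain U and e :: "'n \<Rightarrow> 'a vfield" where e: "p \<in> U" "\<And>j. j \<in> - T \<Longrightarrow> e j \<in> LS U"
    "\<And>x. x \<in> U \<Longrightarrow> orthonormal x (- T) (\<lambda>j. e j x)"
    "\<And>x v. x \<in> U \<Longrightarrow> v \<in> Lp x \<Longrightarrow> spanned (- T) (\<lambda>j. e j x) v"
    using leaf_frame_exists[of p] by metis
  note f = np_frame[OF e(3)[OF e(1)] LS_Lp[OF e(2) e(1)] e(4)[OF e(1)] v]
  show "np p v \<in> Qp p" using f by simp
  show "v - np p v \<in> Lp p"
  proof -
    have "(\<Sum>j\<in>- T. tscale (g p v (e j p)) (e j p)) \<in> Lp p"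
      by (rule Lp_sum[OF Lp_scale[OF LS_Lp[OF e(2) e(1)]]])
    then show ?thesis using f(2) by (simp add: proj_def)
  qed
qed

lemma np_TS: "v \<in> TS p \<Longrightarrow> np p v \<in> TS p"
  by (rule Qp_TS[OF np_Qp])

lemma np_of_Qp: "v \<in> Qp p \<Longrightarrow> np p v = v"
  by (rule np_eqI) (auto intro: Lp_zero)

lemma np_of_Lp: "v \<in> Lp p \<Longrightarrow> np p v = 0"
  by (rule np_eqI) (auto intro: Qp_zero)

lemma np_eq_0: "v \<in> TS p \<Longrightarrow> np p v = 0 \<Longrightarrow> v \<in> Lp p"
  using np_Lp[of v p] by simp

lemma np_add: "v \<in> TS p \<Longrightarrow> w \<in> TS p \<Longrightarrow> np p (v + w) = np p v + np p w"
  by (rule np_eqI[OF Qp_add]) (use Lp_add[OF np_Lp np_Lp, of v p w] in \<open>auto simp: np_Qp algebra_simps\<close>)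

lemma np_diff: "v \<in> TS p \<Longrightarrow> w \<in> TS p \<Longrightarrow> np p (v - w) = np p v - np p w"
  by (rule np_eqI[OF Qp_diff]) (use Lp_diff[OF np_Lp np_Lp, of v p w] in \<open>auto simp: np_Qp algebra_simps\<close>)

lemma np_scale: "v \<in> TS p \<Longrightarrow> np p (tscale c v) = tscale c (np p v)"
  by (rule np_eqI[OF Qp_scale]) (use Lp_scale[OF np_Lp, of v p c] in \<open>auto simp: np_Qp tscale_diff\<close>)

lemma np_sum: "(\<And>i. i \<in> I \<Longrightarrow> v i \<in> TS p) \<Longrightarrow> np p (\<Sum>i\<in>I. v i) = (\<Sum>i\<in>I. np p (v i))"
  by (induction I rule: infinite_finite_induct) (auto simp: np_add TS_sum_mem np_of_Lp[OF Lp_zero])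

lemma g_np_left:
  assumes "v \<in> TS p" "w \<in> Qp p"
  shows "g p (np p v) w = g p v w"
  using g_diff_left[OF assms(1) np_TS[OF assms(1)] Qp_TS[OF assms(2)]] Qp_orthogonal[OF assms(2) np_Lp[OF assms(1)]]
    g_sym[OF Qp_TS[OF assms(2)] Lp_TS[OF np_Lp[OF assms(1)]]] by simp

lemma g_np_right: "v \<in> TS p \<Longrightarrow> w \<in> Qp p \<Longrightarrow> g p w (np p v) = g p w v"
  using g_np_left[of v p w] g_sym[OF Qp_TS np_TS, of w p v] g_sym[OF Qp_TS, of w p v] by simp

lemma QS_VF: "X \<in> QS U \<Longrightarrow> X \<in> VF U"
  by (simp add: Q_sections_def)

lemma QS_Qp: "X \<in> QS U \<Longrightarrow> p \<in> U \<Longrightarrow> X p \<in> Qp p"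
  by (simp add: Q_sections_def)

lemma QS_TS: "X \<in> QS U \<Longrightarrow> p \<in> U \<Longrightarrow> X p \<in> TS p"
  by (rule Qp_TS[OF QS_Qp])

lemma QSI: "X \<in> VF U \<Longrightarrow> (\<And>p. p \<in> U \<Longrightarrow> X p \<in> Qp p) \<Longrightarrow> X \<in> QS U"
  by (simp add: Q_sections_def)

lemma QS_subset: "X \<in> QS U \<Longrightarrow> W \<subseteq> U \<Longrightarrow> X \<in> QS W"
  by (auto simp: Q_sections_def intro: VF_subset)


lemma QS_zero: "0 \<in> QS U"
  by (auto intro!: QSI VF_zero simp: Qp_zero)

lemma QS_add: "X \<in> QS U \<Longrightarrow> Y \<in> QS U \<Longrightarrow> X + Y \<in> QS U"
  by (auto intro!: QSI VF_add Qp_add simp: QS_VF QS_Qp)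

lemma QS_diff: "X \<in> QS U \<Longrightarrow> Y \<in> QS U \<Longrightarrow> X - Y \<in> QS U"
  by (auto intro!: QSI VF_diff Qp_diff simp: QS_VF QS_Qp)

lemma QS_scale: "SF U f \<Longrightarrow> X \<in> QS U \<Longrightarrow> fscale f X \<in> QS U"
  by (auto intro!: QSI VF_scale Qp_scale simp: QS_VF QS_Qp)

lemma QS_sum: "(\<And>i. i \<in> I \<Longrightarrow> X i \<in> QS U) \<Longrightarrow> (\<Sum>i\<in>I. X i) \<in> QS U"
  by (induction I rule: infinite_finite_induct) (auto intro: QS_zero QS_add)

lemma bump_scale_QS:
  assumes "bump U W \<kappa>" "open U" "X \<in> QS U"
  shows "fscale \<kappa> X \<in> QS UNIV"
proof (rule QSI[OF bump_scale_VF[OF assms(1,2) QS_VF[OF assms(3)]]])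
  show "tscale (\<kappa> x) (X x) \<in> Qp x" for x
    using bump_zero[OF assms(1)] QS_Qp[OF assms(3)] by (cases "x \<in> U") (auto intro: Qp_scale Qp_zero)
qed

lemma bump_scale_LS:
  assumes "bump U W \<kappa>" "open U" "X \<in> LS U"
  shows "fscale \<kappa> X \<in> LS UNIV"
proof (rule LSI[OF bump_scale_VF[OF assms(1,2) LS_VF[OF assms(3)]]])
  show "tscale (\<kappa> x) (X x) \<in> Lp x" for x
    using bump_zero[OF assms(1)] LS_Lp[OF assms(3)] by (cases "x \<in> U") (auto intro: Lp_scale Lp_zero)
qed

lemma QP_QS:
  assumes U: "open U" and X: "X \<in> VF U"
  shows "QP X \<in> QS U"
proof (rule QSI)
  show "np p (X p) \<in> Qp p" if "p \<in> U" for p by (rule np_Qp[OF VF_TS[OF X that]])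
  show "QP X \<in> VF U"
  proof (rule VF_local)
    fix p assume p: "p \<in> U"
    obtain V and e :: "'n \<Rightarrow> 'a vfield" where V: "open V" "p \<in> V" and e: "\<And>j. j \<in> - T \<Longrightarrow> e j \<in> LS V"
      "\<And>x. x \<in> V \<Longrightarrow> orthonormal x (- T) (\<lambda>j. e j x)"
      "\<And>x v. x \<in> V \<Longrightarrow> v \<in> Lp x \<Longrightarrow> spanned (- T) (\<lambda>j. e j x) v"
      using leaf_frame_exists[of p] by metis
    let ?W = "U \<inter> V"
    have W: "open ?W" "p \<in> ?W" using U V p by auto
    have XW: "X \<in> VF ?W" by (rule VF_subset[OF X]) simp
    have eW: "e j \<in> VF ?W" if "j \<in> - T" for j by (rule VF_subset[OF LS_VF[OF e(1)[OF that]]]) simp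
    have "X - (\<Sum>j\<in>- T. fscale (gg X (e j)) (e j)) \<in> VF ?W"
      by (rule VF_diff[OF XW VF_sum[OF VF_scale[OF gg_SF[OF XW eW W(1)] eW]]])
    then have "QP X \<in> VF ?W"
    proof (rule VF_cong[rotated])
      fix x assume x: "x \<in> ?W"
      then have xV: "x \<in> V" by simp
      show "(X - (\<Sum>j\<in>- T. fscale (gg X (e j)) (e j))) x = np x (X x)"
        using np_frame(2)[OF e(2)[OF xV] LS_Lp[OF e(1) xV] e(3)[OF xV] VF_TS[OF XW x]]
        by (simp add: proj_def sum_fun_apply)
    qed
    then show "\<exists>W. open W \<and> p \<in> W \<and> QP X \<in> VF W" using W by blast
  qed
qed

lemma LP_LS:
  assumes U: "open U" and X: "X \<in> VF U"
  shows "LP X \<in> LS U"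
  using VF_diff[OF X QS_VF[OF QP_QS[OF assms]]] np_Lp[OF VF_TS[OF X]]
  by (auto simp: L_sections_def fun_diff_def)

lemmas QP_VF = QS_VF[OF QP_QS] and LP_VF = LS_VF[OF LP_LS]

subsection \<open>Bundle-like metrics and basic frames\<close>

text \<open>The defining identity only involves the germs at \<open>p\<close>, so it may be applied to bumped fields.\<close>

lemma bundle_like_local:
  assumes U: "open U" "p \<in> U" and Z: "Z \<in> LS U" and s: "s \<in> QS U" and t: "t \<in> QS U"
  shows "Z p (gg s t) = g p (np p (bracket Z s p)) (t p) + g p (s p) (np p (bracket Z t p))"
proof -
  obtain W \<kappa> where b: "bump U W \<kappa>" and pW: "p \<in> W" using bump_exists[OF U] .
  have W: "open W" "W \<subseteq> U" "\<And>x. x \<in> W \<Longrightarrow> \<kappa> x = 1" using b by (auto simp: bump_def)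
  let ?Z = "fscale \<kappa> Z" and ?s = "fscale \<kappa> s" and ?t = "fscale \<kappa> t"
  note G = bump_scale_LS[OF b U(1) Z] bump_scale_QS[OF b U(1) s] bump_scale_QS[OF b U(1) t]
  have "?Z p (gg ?s ?t) - g p (np p (bracket ?Z ?s p)) (?t p) - g p (?s p) (np p (bracket ?Z ?t p)) = 0"
    using spec[OF bspec[OF bspec[OF bspec[OF bundle_like[unfolded bundle_like_def trans_lie_def] G(1)] G(2)] G(3)], of p] .
  moreover have "bracket Z s p = bracket ?Z ?s p" "bracket Z t p = bracket ?Z ?t p"
    by (rule bracket_cong[OF W(1) pW]; use VF_subset[OF LS_VF[OF Z] W(2)] VF_subset[OF QS_VF[OF s] W(2)]
        VF_subset[OF QS_VF[OF t] W(2)] W(3) in simp)+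
  moreover have "Z p (gg s t) = Z p (gg ?s ?t)"
    by (rule TS_cong[OF VF_TS[OF LS_VF[OF Z] U(2)] W(1) pW]) (simp add: W(3))
  ultimately show ?thesis using W(3)[OF pW] by simp
qed

lemma IA_VF: "Y \<in> IA U \<Longrightarrow> Y \<in> VF U"
  by (simp add: inf_automorphisms_def)

lemma IA_bracket: "Y \<in> IA U \<Longrightarrow> Z \<in> LS U \<Longrightarrow> bracket Y Z \<in> LS U"
  by (simp add: inf_automorphisms_def)

lemma IAI:
  assumes "open U" "Y \<in> VF U" "\<And>Z p. Z \<in> LS U \<Longrightarrow> p \<in> U \<Longrightarrow> bracket Y Z p \<in> Lp p"
  shows "Y \<in> IA U"
  unfolding inf_automorphisms_def
  using assms LSI[OF bracket_VF[OF assms(2) LS_VF assms(1)]] by simp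

lemma LS_IA: "open U \<Longrightarrow> Z \<in> LS U \<Longrightarrow> Z \<in> IA U"
  using bracket_LS LS_VF by (simp add: inf_automorphisms_def)

lemma IA_add:
  assumes U: "open U" and X: "X \<in> IA U" and Y: "Y \<in> IA U"
  shows "X + Y \<in> IA U"
proof (rule IAI[OF U VF_add[OF IA_VF[OF X] IA_VF[OF Y]]])
  show "bracket (X + Y) Z p \<in> Lp p" if "Z \<in> LS U" "p \<in> U" for Z p
    using bracket_add_left[OF IA_VF[OF X] IA_VF[OF Y] LS_VF[OF that(1)] U that(2)]
      Lp_add[OF LS_Lp[OF IA_bracket[OF X that(1)] that(2)] LS_Lp[OF IA_bracket[OF Y that(1)] that(2)]] by simp
qed

text \<open>Multiplication by a function that is constant along the leaves preserves infinitesimal automorphisms.\<close>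

definition basic_fun :: "'a set \<Rightarrow> ('a \<Rightarrow> real) \<Rightarrow> bool" where
  "basic_fun U f \<longleftrightarrow> SF U f \<and> (\<forall>Z\<in>LS U. \<forall>x\<in>U. Z x f = 0)"

lemma IA_scale:
  assumes U: "open U" and f: "basic_fun U f" and X: "X \<in> IA U"
  shows "fscale f X \<in> IA U"
proof -
  have s: "SF U f" using f by (simp add: basic_fun_def)
  show ?thesis
  proof (rule IAI[OF U VF_scale[OF s IA_VF[OF X]]])
    fix Z p assume Z: "Z \<in> LS U" and p: "p \<in> U"
    have "Z p f = 0" using f Z p by (simp add: basic_fun_def)
    then show "bracket (fscale f X) Z p \<in> Lp p"
      using bracket_scale_left[OF IA_VF[OF X] LS_VF[OF Z] s U p] Lp_scale[OF LS_Lp[OF IA_bracket[OF X Z] p]]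
      by simp
  qed
qed

lemma basic_uminus:
  assumes U: "open U" and f: "basic_fun U f"
  shows "basic_fun U (\<lambda>x. - f x)"
proof -
  have "Z x (\<lambda>x. - f x) = 0" if Z: "Z \<in> LS U" and x: "x \<in> U" for Z x
  proof -
    have "Z x f = 0" "SF U f" using f Z x by (auto simp: basic_fun_def)
    then show ?thesis
      using TS_cmult[OF VF_TS[OF LS_VF[OF Z] x] nearI[OF U x], of f "- 1"] by simp
  qed
  then show ?thesis using f SF_uminus[OF U] by (simp add: basic_fun_def)
qed

lemma basic_inverse_sqrt:
  assumes U: "open U" and f: "basic_fun U f" and pos: "\<forall>x\<in>U. f x > 0"
  shows "basic_fun U (\<lambda>x. inverse (sqrt (f x)))"
proof -
  have s: "SF U f" and s': "SF U (\<lambda>x. inverse (sqrt (f x)))"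
    using f pos SF_inverse_sqrt[OF U, of f] by (auto simp: basic_fun_def)
  have "Z x (\<lambda>x. inverse (sqrt (f x))) = 0" if "Z \<in> LS U" "x \<in> U" for Z x
  proof -
    have "((\<lambda>y. inverse (sqrt y)) has_real_derivative
        - (inverse (sqrt (f x)) * (inverse (sqrt (f x)) / 2) * inverse (sqrt (f x)))) (at (f x))"
      using pos that by (auto intro!: derivative_eq_intros)
    from TS_compose[OF VF_TS[OF LS_VF[OF that(1)] that(2)] nearI[OF U that(2) s] nearI[OF U that(2) s'] this]
    show ?thesis using f that by (simp add: basic_fun_def)
  qed
  then show ?thesis using s' by (simp add: basic_fun_def)
qed

text \<open>Here the metric has to be bundle-like: normal parts of brackets with leaf fields vanish for both sections.\<close>

lemma basic_gg:
  assumes U: "open U" and s: "s \<in> QS U" "s \<in> IA U" and t: "t \<in> QS U" "t \<in> IA U"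
  shows "basic_fun U (gg s t)"
proof -
  have "Z x (gg s t) = 0" if Z: "Z \<in> LS U" and x: "x \<in> U" for Z x
  proof -
    have "np x (bracket Z u x) = 0" if "u \<in> IA U" for u
      using np_of_Lp[OF Lp_uminus[OF LS_Lp[OF IA_bracket[OF that Z] x]]] bracket_antisym[of Z u x] by simp
    then show ?thesis
      using bundle_like_local[OF U x Z s(1) t(1)] s t
      by (simp add: g_zero_left g_zero_right QS_TS[OF _ x])
  qed
  then show ?thesis using gg_SF[OF QS_VF[OF s(1)] QS_VF[OF t(1)] U] by (simp add: basic_fun_def)
qed

text \<open>
  Applied to a transverse coordinate, \<open>[X, Z]\<close> with \<open>X\<close> of constant coordinates and \<open>Z\<close> tangent to the
  leaves only differentiates constants.
\<close>

lemma coordinate_IA: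
  assumes c: "(U, \<phi>) \<in> F"
  shows "chart_vector (U, \<phi>) \<xi> \<in> IA U"
proof (rule IAI[OF F_open[OF c] chart_vector_VF[OF F_admissible[OF c]]])
  note adm = F_admissible[OF c] and U = F_open[OF c]
  let ?X = "chart_vector (U, \<phi>) \<xi>"
  fix Z p assume Z: "Z \<in> LS U" and p: "p \<in> U"
  note XT = chart_vector_TS[OF adm p] and ZT = VF_TS[OF LS_VF[OF Z] p]
  show "bracket ?X Z p \<in> Lp p"
    unfolding Lp_iff[OF c p bracket_TS[OF chart_vector_VF[OF adm] LS_VF[OF Z] U p]]
  proof
    fix i assume i: "i \<in> T"
    have "?X p (\<lambda>x. Z x (\<lambda>x. \<phi> x $ i)) = ?X p (\<lambda>x. 0)"
      by (rule TS_cong[OF XT U p]) (use LS_annihilates[OF Z c _ _ i] in auto)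
    moreover have "Z p (\<lambda>x. ?X x (\<lambda>x. \<phi> x $ i)) = Z p (\<lambda>x. \<xi> $ i)"
      by (rule TS_cong[OF ZT U p]) (rule chart_vector_coord[OF adm])
    ultimately show "bracket ?X Z p (\<lambda>x. \<phi> x $ i) = 0"
      by (simp add: bracket_apply[OF near_F_coordinate[OF c p]] TS_const[OF XT] TS_const[OF ZT])
  qed
qed

lemma QP_IA:
  assumes U: "open U" and Y: "Y \<in> IA U"
  shows "QP Y \<in> IA U"
proof -
  have "Y + fscale (\<lambda>x. - 1) (LP Y) \<in> IA U"
    by (rule IA_add[OF U Y LS_IA[OF U LS_scale[OF SF_const LP_LS[OF U IA_VF[OF Y]]]]])
  moreover have "Y + fscale (\<lambda>x. - 1) (LP Y) = QP Y" by (auto simp: fun_eq_iff)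
  ultimately show ?thesis by simp
qed

text \<open>
  The normal parts of the transverse coordinate fields are basic and span the normal bundle. Their
  inner products are basic functions, so Gram-Schmidt does not leave the class of basic sections.
\<close>

lemma basic_frame_exists:
  obtains U and E :: "'n \<Rightarrow> 'a vfield" where "p \<in> U" "orthonormal_basic_frame A T F g U E"
    "\<And>x. x \<in> U \<Longrightarrow> orthonormal x T (\<lambda>a. E a x)"
    "\<And>x w. x \<in> U \<Longrightarrow> w \<in> Qp x \<Longrightarrow> spanned T (\<lambda>a. E a x) w"
proof -
  obtain U \<phi> where c: "(U, \<phi>) \<in> F" and p: "p \<in> U" by (rule F_chart_at)
  note adm = F_admissible[OF c] and U = F_open[OF c]
  let ?d = "\<lambda>i. chart_vector (U, \<phi>) (axis i 1)"
  let ?P = "\<lambda>Y. Y \<in> QS U \<and> Y \<in> IA U"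
  have dT: "?d i x \<in> TS x" if "x \<in> U" for i x by (rule chart_vector_TS[OF adm that])
  obtain E :: "'n \<Rightarrow> 'a vfield" where E: "\<And>a. a \<in> T \<Longrightarrow> ?P (E a)"
    "\<And>x. x \<in> U \<Longrightarrow> orthonormal x T (\<lambda>a. E a x)"
    "\<And>x a. x \<in> U \<Longrightarrow> a \<in> T \<Longrightarrow> spanned T (\<lambda>a. E a x) (QP (?d a) x)"
  proof (rule gram_schmidt[where P = ?P and R = "basic_fun U" and U = U and S = T and X = "\<lambda>a. QP (?d a)"])
    show "?P (QP (?d a))" for a
      using QP_QS[OF U chart_vector_VF[OF adm]] QP_IA[OF U coordinate_IA[OF c]] by blast
    show "\<forall>a\<in>T. r a = 0" if x: "x \<in> U" and 0: "(\<Sum>a\<in>T. tscale (r a) (QP (?d a) x)) = 0" for x r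
    proof
      fix j assume j: "j \<in> T"
      let ?v = "\<Sum>a\<in>T. tscale (r a) (?d a x)"
      have v: "?v \<in> TS x" by (intro TS_sum_mem TS_scale dT x)
      have "np x ?v = 0" using 0 by (simp add: np_sum np_scale TS_scale dT x)
      then have "?v (\<lambda>x. \<phi> x $ j) = 0" using Lp_iff[OF c x v] np_eq_0[OF v] j by blast
      then show "r j = 0"
        using j by (simp add: sum_fun_apply chart_vector_coord[OF adm x] axis_def if_distrib cong: if_cong)
    qed
    show "?P 0" using LS_IA[OF U LSI[OF VF_zero]] Lp_zero by (simp add: QS_zero)
    show "?P (X + Y)" if "?P X" "?P Y" for X Y using that by (simp add: QS_add IA_add U)
    show "?P (fscale r X)" if "basic_fun U r" "?P X" for r X
      using that IA_scale[OF U] QS_scale by (auto simp: basic_fun_def)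
    show "basic_fun U (gg X Y)" if "?P X" "?P Y" for X Y using that basic_gg[OF U] by blast
    show "basic_fun U (\<lambda>x. - r x)" if "basic_fun U r" for r by (rule basic_uminus[OF U that])
    show "basic_fun U (\<lambda>x. inverse (sqrt (r x)))" if "basic_fun U r" "\<forall>x\<in>U. r x > 0" for r
      by (rule basic_inverse_sqrt[OF U that])
    show "X x \<in> TS x" if "?P X" "x \<in> U" for X x using that QS_TS by blast
  qed (simp, rule that)
  have "spanned T (\<lambda>a. E a x) w" if x: "x \<in> U" and w: "w \<in> Qp x" for x w
  proof -
    have "w = np x (\<Sum>i\<in>UNIV. tscale (w (\<lambda>x. \<phi> x $ i)) (?d i x))"
      using TS_expansion[OF adm x Qp_TS[OF w]] np_of_Qp[OF w] by simp
    also have "\<dots> = (\<Sum>i\<in>UNIV. tscale (w (\<lambda>x. \<phi> x $ i)) (np x (?d i x)))"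
      by (simp add: np_sum np_scale TS_scale dT x)
    finally have w': "w = (\<Sum>i\<in>UNIV. tscale (w (\<lambda>x. \<phi> x $ i)) (np x (?d i x)))" .
    show ?thesis
    proof (subst w', rule spanned_sum, rule spanned_scale)
      fix i show "spanned T (\<lambda>a. E a x) (np x (?d i x))"
      proof (cases "i \<in> T")
        case False
        then have "?d i x \<in> Lp x"
          unfolding Lp_iff[OF c x dT[OF x]] chart_vector_coord[OF adm x] by (auto simp: axis_def)
        then show ?thesis by (simp add: np_of_Lp spanned_zero)
      qed (rule E(3)[OF x])
    qed
  qed
  moreover have "orthonormal_basic_frame A T F g U E"
    using U E(1,2) by (simp add: orthonormal_basic_frame_def orthonormal_def)
  ultimately show ?thesis using that[OF p] E(2) by blast
qed

text \<open>Any orthonormal family of the right size spans, by comparison with a basic frame.\<close>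

lemma Qp_spanned:
  assumes e: "orthonormal p T e" and eQ: "\<And>a. a \<in> T \<Longrightarrow> e a \<in> Qp p" and w: "w \<in> Qp p"
  shows "spanned T e w"
proof -
  obtain U and E :: "'n \<Rightarrow> 'a vfield" where "p \<in> U"
    "\<And>x. x \<in> U \<Longrightarrow> orthonormal x T (\<lambda>a. E a x)"
    "\<And>x w. x \<in> U \<Longrightarrow> w \<in> Qp x \<Longrightarrow> spanned T (\<lambda>a. E a x) w"
    using basic_frame_exists[of p] by metis
  then show ?thesis using orthonormal_complete[of p T "\<lambda>a. E a p" e w] e eQ w by blast
qed

subsection \<open>The transversal connection\<close>

context
  fixes U :: "'a set" and X s :: "'a vfield"
  assumes U: "open U" and X: "X \<in> VF U" and s: "s \<in> QS U"
begin

lemma conn_parts: "bracket (LP X) s \<in> VF U" "LC (QP X) s \<in> VF U"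
  using bracket_VF[OF LP_VF[OF U X] QS_VF[OF s] U] LC_VF[OF U QP_VF[OF U X] QS_VF[OF s]] by auto

lemma conn_QS: "conn X s \<in> QS U"
proof -
  have "QP (bracket (LP X) s) + QP (LC (QP X) s) \<in> QS U"
    by (intro QS_add QP_QS U conn_parts)
  then show ?thesis by (simp add: trans_conn_def[abs_def] plus_fun_def)
qed

lemma conn_cong:
  assumes "\<And>x. x \<in> U \<Longrightarrow> X x = X' x" "\<And>x. x \<in> U \<Longrightarrow> s x = s' x" and p: "p \<in> U"
  shows "conn X s p = conn X' s' p"
proof -
  have "bracket (LP X) s p = bracket (LP X') s' p"
    by (rule bracket_cong[OF U p LP_VF[OF U X] QS_VF[OF s]]) (simp_all add: assms)
  moreover have "LC (QP X) s p = LC (QP X') s' p"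
    by (rule LC_cong[OF U p QP_VF[OF U X] QS_VF[OF s]]) (simp_all add: assms)
  ultimately show ?thesis by (simp add: trans_conn_def)
qed

lemma conn_L:
  assumes "\<And>x. x \<in> U \<Longrightarrow> X x \<in> Lp x" and p: "p \<in> U"
  shows "conn X s p = np p (bracket X s p)"
proof -
  have "LC (QP X) s p = LC (fscale (\<lambda>x. 0) X) s p"
    by (rule LC_cong[OF U p QP_VF[OF U X] QS_VF[OF s]]) (simp_all add: np_of_Lp assms)
  also have "\<dots> = 0" using LC_scale_left[OF U X QS_VF[OF s] SF_const[of U 0] p] by simp
  finally have "np p (LC (QP X) s p) = 0" by (simp add: np_of_Lp Lp_zero)
  moreover have "bracket (LP X) s p = bracket X s p"
    by (rule bracket_cong[OF U p LP_VF[OF U X] QS_VF[OF s]]) (simp_all add: np_of_Lp assms)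
  ultimately show ?thesis by (simp add: trans_conn_def)
qed

end

lemma curv_cong:
  assumes U: "open U" "p \<in> U" and X: "X \<in> VF U" "Z \<in> VF U" and s: "s \<in> QS U"
    and eq: "\<And>x. x \<in> U \<Longrightarrow> X x = X' x" "\<And>x. x \<in> U \<Longrightarrow> Z x = Z' x" "\<And>x. x \<in> U \<Longrightarrow> s x = s' x"
  shows "curv X Z s p = curv X' Z' s' p"
proof -
  have "conn X (conn Z s) p = conn X' (conn Z' s') p"
    by (rule conn_cong[OF U(1) X(1) conn_QS[OF U(1) X(2) s] eq(1) conn_cong[OF U(1) X(2) s eq(2,3)] U(2)])
  moreover have "conn Z (conn X s) p = conn Z' (conn X' s') p"
    by (rule conn_cong[OF U(1) X(2) conn_QS[OF U(1) X(1) s] eq(2) conn_cong[OF U(1) X(1) s eq(1,3)] U(2)])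
  moreover have "conn (bracket X Z) s p = conn (bracket X' Z') s' p"
    by (rule conn_cong[OF U(1) bracket_VF[OF X U(1)] s bracket_cong[OF U(1) _ X eq(1,2)] eq(3) U(2)])
  ultimately show ?thesis by (simp add: trans_curv_def)
qed

text \<open>
  From here on all fields are global, so that identities between them are equations of functions.
\<close>

abbreviation "VG \<equiv> VF UNIV"
abbreviation "QG \<equiv> QS UNIV"

lemma global_TS: "X \<in> VG \<Longrightarrow> X x \<in> TS x"
  by (rule VF_TS) auto

lemma QG_Qp: "s \<in> QG \<Longrightarrow> s x \<in> Qp x"
  by (rule QS_Qp) auto

lemma QG_QP: "s \<in> QG \<Longrightarrow> QP s = s"
  by (rule ext) (rule np_of_Qp[OF QG_Qp])

lemma QP_QG: "X \<in> VG \<Longrightarrow> QP X \<in> QG"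
  by (rule QP_QS) auto

lemma LP_VG: "X \<in> VG \<Longrightarrow> LP X \<in> VG"
  by (rule LP_VF) auto

lemma QP_VG: "X \<in> VG \<Longrightarrow> QP X \<in> VG"
  by (rule QP_VF) auto

lemma bracket_VG: "X \<in> VG \<Longrightarrow> Y \<in> VG \<Longrightarrow> bracket X Y \<in> VG"
  by (rule bracket_VF) auto

lemma LC_VG: "X \<in> VG \<Longrightarrow> Y \<in> VG \<Longrightarrow> LC X Y \<in> VG"
  by (rule LC_VF) auto

lemma conn_QG: "X \<in> VG \<Longrightarrow> s \<in> QG \<Longrightarrow> conn X s \<in> QG"
  by (rule conn_QS) auto

lemma QP_add: "X \<in> VG \<Longrightarrow> Y \<in> VG \<Longrightarrow> QP (X + Y) = QP X + QP Y"
  by (rule ext) (simp add: np_add global_TS)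

lemma QP_scale: "X \<in> VG \<Longrightarrow> QP (fscale f X) = fscale f (QP X)"
  by (rule ext) (simp add: np_scale global_TS)

lemma LP_add: "X \<in> VG \<Longrightarrow> Y \<in> VG \<Longrightarrow> LP (X + Y) = LP X + LP Y"
  by (rule ext) (simp add: np_add global_TS)

lemma LP_scale: "X \<in> VG \<Longrightarrow> LP (fscale f X) = fscale f (LP X)"
  by (rule ext) (simp add: np_scale global_TS tscale_diff)

lemma LP_Lp: "X \<in> VG \<Longrightarrow> LP X x \<in> Lp x"
  by (rule np_Lp[OF global_TS])

lemma conn_add_left:
  assumes X: "X \<in> VG" and Z: "Z \<in> VG" and s: "s \<in> QG"
  shows "conn (X + Z) s = conn X s + conn Z s"
proof
  fix p
  note T = global_TS[OF bracket_VG[OF LP_VG QS_VF[OF s]]] global_TS[OF LC_VG[OF QP_VG QS_VF[OF s]]]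
  show "conn (X + Z) s p = (conn X s + conn Z s) p"
    unfolding trans_conn_def LP_add[OF X Z] QP_add[OF X Z] plus_fun_apply[of "conn X s"]
      bracket_add_left[OF LP_VG[OF X] LP_VG[OF Z] QS_VF[OF s] open_UNIV UNIV_I]
      LC_add_left[OF open_UNIV QP_VG[OF X] QS_VF[OF s] QP_VG[OF Z] UNIV_I]
    using X Z by (simp add: np_add T)
qed

lemma conn_scale_left:
  assumes f: "SF UNIV f" and X: "X \<in> VG" and s: "s \<in> QG"
  shows "conn (fscale f X) s = fscale f (conn X s)"
proof
  fix p
  note T = global_TS[OF bracket_VG[OF LP_VG QS_VF[OF s]]] global_TS[OF LC_VG[OF QP_VG QS_VF[OF s]]]
  show "conn (fscale f X) s p = tscale (f p) (conn X s p)"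
    unfolding trans_conn_def LP_scale[OF X] QP_scale[OF X]
      bracket_scale_left[OF LP_VG[OF X] QS_VF[OF s] f open_UNIV UNIV_I]
      LC_scale_left[OF open_UNIV QP_VG[OF X] QS_VF[OF s] f UNIV_I]
    using X np_of_Lp[OF LP_Lp[OF X, of p]]
    by (simp add: np_diff np_scale T TS_scale global_TS[OF LP_VG] tscale_add)
qed

lemma conn_add_right:
  assumes X: "X \<in> VG" and s: "s \<in> QG" and t: "t \<in> QG"
  shows "conn X (s + t) = conn X s + conn X t"
proof
  fix p
  note T = global_TS[OF bracket_VG[OF LP_VG[OF X]]] global_TS[OF LC_VG[OF QP_VG[OF X]]]
  show "conn X (s + t) p = (conn X s + conn X t) p"
    unfolding trans_conn_def plus_fun_apply[of "conn X s"]
      bracket_add_right[OF QS_VF[OF s] QS_VF[OF t] LP_VG[OF X] open_UNIV UNIV_I]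
      LC_add_right[OF open_UNIV QP_VG[OF X] QS_VF[OF s] QS_VF[OF t] UNIV_I]
    by (simp add: np_add T QS_VF s t)
qed

lemma conn_scale_right:
  assumes f: "SF UNIV f" and X: "X \<in> VG" and s: "s \<in> QG"
  shows "conn X (fscale f s) = fscale (\<lambda>x. X x f) s + fscale f (conn X s)"
proof
  fix p
  note T = global_TS[OF bracket_VG[OF LP_VG[OF X] QS_VF[OF s]]] global_TS[OF LC_VG[OF QP_VG[OF X] QS_VF[OF s]]]
    global_TS[OF QS_VF[OF s]]
  have n: "np p (tscale c (s p) + tscale d v) = tscale c (s p) + tscale d (np p v)" if "v \<in> TS p" for c d v
    using that T(3) by (simp add: np_add np_scale TS_scale np_of_Qp[OF QG_Qp[OF s]])
  show "conn X (fscale f s) p = (fscale (\<lambda>x. X x f) s + fscale f (conn X s)) p"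
    unfolding trans_conn_def plus_fun_apply[of "fscale (\<lambda>x. X x f) s"]
      bracket_scale_right[OF LP_VG[OF X] QS_VF[OF s] f open_UNIV UNIV_I]
      LC_scale_right[OF open_UNIV QP_VG[OF X] QS_VF[OF s] f UNIV_I]
      n[OF T(1)] n[OF T(2)]
    by (simp add: tscale_left_diff tscale_add)
qed

lemma conn_diff_right:
  assumes X: "X \<in> VG" and s: "s \<in> QG" and t: "t \<in> QG"
  shows "conn X (s - t) = conn X s - conn X t"
  using conn_add_right[OF X QS_diff[OF s t] t] by simp

lemma conn_diff_left:
  assumes X: "X \<in> VG" and Z: "Z \<in> VG" and s: "s \<in> QG"
  shows "conn (X - Z) s = conn X s - conn Z s"
  using conn_add_left[OF VF_diff[OF X Z] Z s] by simp

text \<open>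
  Decompose both fields into parts along and normal to the leaves. The bracket of the two tangent
  parts is tangent; mixed brackets are the leafwise derivatives by definition; for the normal parts
  this is torsion-freeness of the Levi-Civita connection.
\<close>

lemma conn_torsion:
  assumes X: "X \<in> VG" and Z: "Z \<in> VG"
  shows "conn X (QP Z) - conn Z (QP X) = QP (bracket X Z)"
proof
  fix p
  note V = LP_VG[OF X] LP_VG[OF Z] QP_VG[OF X] QP_VG[OF Z]
  note T = global_TS[OF bracket_VG] global_TS[OF LC_VG]
  have dec: "LP V + QP V = V" for V by (auto simp: fun_eq_iff)
  have br: "bracket (V + V') W p = bracket V W p + bracket V' W p"
    "bracket W (V + V') p = bracket W V p + bracket W V' p" if "V \<in> VG" "V' \<in> VG" "W \<in> VG" for V V' W
    using bracket_add_left[OF that open_UNIV UNIV_I] bracket_add_right[OF that open_UNIV UNIV_I] by auto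
  have "bracket X Z p = bracket (LP X + QP X) (LP Z + QP Z) p" by (simp only: dec)
  also have "\<dots> = bracket (LP X) (LP Z) p + bracket (QP X) (LP Z) p +
      (bracket (LP X) (QP Z) p + bracket (QP X) (QP Z) p)"
    by (simp only: br V VF_add)
  also have "bracket (QP X) (LP Z) p = - bracket (LP Z) (QP X) p" by (rule bracket_antisym)
  also have "bracket (QP X) (QP Z) p = LC (QP X) (QP Z) p - LC (QP Z) (QP X) p"
    using LC_torsion[OF open_UNIV V(3,4), of p] by simp
  finally have e: "bracket X Z p = bracket (LP X) (LP Z) p + - bracket (LP Z) (QP X) p +
      (bracket (LP X) (QP Z) p + (LC (QP X) (QP Z) p - LC (QP Z) (QP X) p))" .
  have "np p (bracket (LP X) (LP Z) p) = 0"
    by (rule np_of_Lp[OF LS_Lp[OF bracket_LS[OF LP_LS[OF _ X] LP_LS[OF _ Z]]]]) auto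
  moreover have "np p (- bracket (LP Z) (QP X) p) = - np p (bracket (LP Z) (QP X) p)"
    using np_scale[OF T(1)[OF V(2,3)], of p "- 1"] by (simp add: tscale_def fun_Compl_def)
  ultimately show "(conn X (QP Z) - conn Z (QP X)) p = np p (bracket X Z p)"
    unfolding e by (simp add: np_add np_diff T V TS_plus TS_minus TS_uminus trans_conn_def)
qed

text \<open>
  Along the leaves this is the bundle-like condition, in normal directions the compatibility of the
  Levi-Civita connection, whose leafwise component is orthogonal to the other section.
\<close>

lemma conn_metric:
  assumes X: "X \<in> VG" and s: "s \<in> QG" and t: "t \<in> QG"
  shows "X p (gg s t) = g p (conn X s p) (t p) + g p (s p) (conn X t p)"
proof -
  note Q = QG_Qp[OF s, of p] QG_Qp[OF t, of p] and G = QS_VF[OF s] QS_VF[OF t]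
  note T = global_TS[OF bracket_VG[OF LP_VG[OF X]]] global_TS[OF LC_VG[OF QP_VG[OF X]]]
  have "X p (gg s t) = LP X p (gg s t) + QP X p (gg s t)" by simp
  also have "LP X p (gg s t) = g p (np p (bracket (LP X) s p)) (t p) + g p (s p) (np p (bracket (LP X) t p))"
    using bundle_like_local[OF open_UNIV UNIV_I LP_LS[OF open_UNIV X] s t] .
  also have "QP X p (gg s t) = g p (LC (QP X) s p) (t p) + g p (s p) (LC (QP X) t p)"
    using LC_metric[OF open_UNIV QP_VG[OF X] G UNIV_I] .
  also have "\<dots> = g p (np p (LC (QP X) s p)) (t p) + g p (s p) (np p (LC (QP X) t p))"
    by (simp add: g_np_left g_np_right T G Q)
  finally have "X p (gg s t) = g p (np p (bracket (LP X) s p)) (t p) + g p (s p) (np p (bracket (LP X) t p)) +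
      (g p (np p (LC (QP X) s p)) (t p) + g p (s p) (np p (LC (QP X) t p)))" .
  moreover have "g p (conn X s p) (t p) = g p (np p (bracket (LP X) s p)) (t p) + g p (np p (LC (QP X) s p)) (t p)"
    "g p (s p) (conn X t p) = g p (s p) (np p (bracket (LP X) t p)) + g p (s p) (np p (LC (QP X) t p))"
    unfolding trans_conn_def by (rule g_add_left g_add_right; intro np_TS T G Qp_TS Q)+
  ultimately show ?thesis by (simp only: add_ac)
qed

text \<open>
  The normal part of an infinitesimal automorphism is again one, and \<open>\<nabla>\<close> along the leaves is the
  normal part of the bracket.
\<close>

lemma conn_L_IA:
  assumes V: "V \<in> LS UNIV" and Y: "Y \<in> IA UNIV"
  shows "conn V (QP Y) = 0"
proof
  fix p
  have "conn V (QP Y) p = np p (bracket V (QP Y) p)"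
    by (rule conn_L[OF open_UNIV LS_VF[OF V] QP_QG[OF IA_VF[OF Y]] LS_Lp[OF V] UNIV_I])
  also have "\<dots> = np p (- bracket (QP Y) V p)" using bracket_antisym[of V "QP Y" p] by simp
  also have "\<dots> = 0"
    by (intro np_of_Lp Lp_uminus LS_Lp[OF IA_bracket[OF QP_IA[OF open_UNIV Y] V]] UNIV_I)
  finally show "conn V (QP Y) p = 0 p" by simp
qed

subsection \<open>The transversal curvature\<close>

lemma curv_QG:
  assumes X: "X \<in> VG" and Z: "Z \<in> VG" and s: "s \<in> QG"
  shows "curv X Z s \<in> QG"
proof -
  have "conn X (conn Z s) - conn Z (conn X s) - conn (bracket X Z) s \<in> QG"
    by (intro QS_diff conn_QG X Z s bracket_VG)
  then show ?thesis by (simp add: trans_curv_def[abs_def] fun_diff_def)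
qed

lemma curv_eq: "curv X Z s = conn X (conn Z s) - conn Z (conn X s) - conn (bracket X Z) s"
  by (rule ext) (simp add: trans_curv_def)

lemma curv_antisym:
  assumes X: "X \<in> VG" and Z: "Z \<in> VG" and s: "s \<in> QG"
  shows "curv X Z s = - curv Z X s"
proof -
  have "bracket X Z = 0 - bracket Z X" by (rule ext) (simp add: bracket_antisym[of X Z])
  then have "conn (bracket X Z) s = conn 0 s - conn (bracket Z X) s"
    using conn_diff_left[OF VF_zero bracket_VG[OF Z X] s] by simp
  moreover have "conn 0 s = 0" using conn_add_left[OF VF_zero VF_zero s] by simp
  ultimately show ?thesis unfolding curv_eq by simp
qed

text \<open>
  The connection is torsion-free in the sense of \<open>conn_torsion\<close>, hence the first Bianchi identity
  follows from the Jacobi identity.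
\<close>

lemma bianchi:
  assumes X: "X \<in> QG" and Z: "Z \<in> QG" and W: "W \<in> QG"
  shows "curv X Z W + curv Z W X + curv W X Z = 0"
proof -
  have tor: "conn P R - conn R P = QP (bracket P R)" if "P \<in> QG" "R \<in> QG" for P R
    using conn_torsion[OF QS_VF[OF that(1)] QS_VF[OF that(2)]] by (simp only: QG_QP that)
  have step: "conn P (conn R S) - conn P (conn S R) - conn (bracket R S) P = QP (bracket P (bracket R S))"
    if P: "P \<in> QG" and R: "R \<in> QG" and S: "S \<in> QG" for P R S
  proof -
    have "conn P (conn R S) - conn P (conn S R) = conn P (QP (bracket R S))"
      by (simp only: tor[OF R S, symmetric] conn_diff_right[OF QS_VF[OF P] conn_QG[OF QS_VF[OF R] S] conn_QG[OF QS_VF[OF S] R]])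
    then show ?thesis
      using conn_torsion[OF QS_VF[OF P] bracket_VG[OF QS_VF[OF R] QS_VF[OF S]]] by (simp only: QG_QP P)
  qed
  have "curv X Z W + curv Z W X + curv W X Z =
      QP (bracket X (bracket Z W)) + QP (bracket Z (bracket W X)) + QP (bracket W (bracket X Z))"
    unfolding curv_eq step[OF X Z W, symmetric] step[OF Z W X, symmetric] step[OF W X Z, symmetric]
    by (simp add: algebra_simps)
  also have "\<dots> = 0"
  proof
    fix p
    note V = QS_VF[OF X] QS_VF[OF Z] QS_VF[OF W]
    have "np p (bracket X (bracket Z W) p + bracket Z (bracket W X) p + bracket W (bracket X Z) p) = 0"
      using jacobi[OF V open_UNIV UNIV_I, of p] by (simp add: np_of_Lp Lp_zero)
    then show "(QP (bracket X (bracket Z W)) + QP (bracket Z (bracket W X)) + QP (bracket W (bracket X Z))) p = 0 p"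
      by (simp add: np_add TS_plus global_TS bracket_VG V)
  qed
  finally show ?thesis .
qed

lemma curv_scale_middle:
  assumes f: "SF UNIV f" and X: "X \<in> VG" and Z: "Z \<in> VG" and s: "s \<in> QG"
  shows "curv X (fscale f Z) s = fscale f (curv X Z s)"
proof -
  have "bracket X (fscale f Z) = fscale (\<lambda>x. X x f) Z + fscale f (bracket X Z)"
    by (rule ext) (simp add: bracket_scale_right[OF X Z f open_UNIV])
  moreover have Xf: "SF UNIV (\<lambda>x. X x f)" by (rule VF_SF[OF X]) (auto intro: f)
  ultimately have "conn (bracket X (fscale f Z)) s = fscale (\<lambda>x. X x f) (conn Z s) + fscale f (conn (bracket X Z) s)"
    by (simp only: conn_add_left[OF VF_scale[OF Xf Z] VF_scale[OF f bracket_VG[OF X Z]] s]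
        conn_scale_left[OF Xf Z s] conn_scale_left[OF f bracket_VG[OF X Z] s])
  then show ?thesis
    unfolding curv_eq conn_scale_left[OF f Z s] conn_scale_left[OF f Z conn_QG[OF X s]]
      conn_scale_right[OF f X conn_QG[OF Z s]]
    by (auto simp: fun_eq_iff algebra_simps)
qed

lemma curv_add_middle:
  assumes X: "X \<in> VG" and Z: "Z \<in> VG" and V: "V \<in> VG" and s: "s \<in> QG"
  shows "curv X (Z + V) s = curv X Z s + curv X V s"
proof -
  have "bracket X (Z + V) = bracket X Z + bracket X V"
    by (rule ext) (simp only: bracket_add_right[OF Z V X open_UNIV UNIV_I] plus_fun_apply)
  then show ?thesis
    unfolding curv_eq
    by (simp add: conn_add_left[OF Z V] conn_add_left[OF bracket_VG[OF X Z] bracket_VG[OF X V]] conn_QG X Z V s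
        conn_add_right)
qed

lemma curv_add_right:
  assumes X: "X \<in> VG" and Z: "Z \<in> VG" and s: "s \<in> QG" and t: "t \<in> QG"
  shows "curv X Z (s + t) = curv X Z s + curv X Z t"
  unfolding curv_eq by (simp add: conn_add_right conn_QG bracket_VG X Z s t)

text \<open>The first derivatives of \<open>f\<close> cancel in pairs, the second ones by definition of the bracket.\<close>

lemma curv_scale_right:
  assumes f: "SF UNIV f" and X: "X \<in> VG" and Z: "Z \<in> VG" and s: "s \<in> QG"
  shows "curv X Z (fscale f s) = fscale f (curv X Z s)"
proof -
  have d: "SF UNIV (\<lambda>x. V x f)" if "V \<in> VG" for V by (rule VF_SF[OF that]) (auto intro: f)
  have c: "conn V (conn W (fscale f s)) = fscale (\<lambda>x. V x (\<lambda>x. W x f)) s + fscale (\<lambda>x. W x f) (conn V s) +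
      (fscale (\<lambda>x. V x f) (conn W s) + fscale f (conn V (conn W s)))" if V: "V \<in> VG" and W: "W \<in> VG" for V W
    by (simp only: conn_scale_right[OF f W s] conn_scale_right[OF d[OF W] V s]
        conn_scale_right[OF f V conn_QG[OF W s]]
        conn_add_right[OF V QS_scale[OF d[OF W] s] QS_scale[OF f conn_QG[OF W s]]])
  have b: "bracket X Z x f = X x (\<lambda>x. Z x f) - Z x (\<lambda>x. X x f)" for x
    by (rule bracket_apply[OF nearI[OF open_UNIV UNIV_I f]])
  show ?thesis
    unfolding curv_eq c[OF X Z] c[OF Z X] conn_scale_right[OF f bracket_VG[OF X Z] s] b
    by (auto simp: fun_eq_iff algebra_simps)
qed

end

section \<open>Traces of tensors and the transversal Ricci operator\<close>

context foliated_manifold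
begin

text \<open>Bilinearity over the smooth functions on \<open>M\<close>.\<close>

definition tensorial :: "('a vfield \<Rightarrow> 'a vfield \<Rightarrow> 'a vfield) \<Rightarrow> bool" where
  "tensorial S \<longleftrightarrow> (\<forall>X\<in>QG. \<forall>Z\<in>QG.
     (\<forall>V\<in>QG. S (X + V) Z = S X Z + S V Z \<and> S X (Z + V) = S X Z + S X V) \<and>
     (\<forall>f. SF UNIV f \<longrightarrow> S (fscale f X) Z = fscale f (S X Z) \<and> S X (fscale f Z) = fscale f (S X Z)))"

lemma
  assumes S: "tensorial S" and X: "X \<in> QG" and Z: "Z \<in> QG"
  shows tensorial_add_left: "V \<in> QG \<Longrightarrow> S (X + V) Z = S X Z + S V Z"
    and tensorial_scale_left: "SF UNIV f \<Longrightarrow> S (fscale f X) Z = fscale f (S X Z)"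
proof -
  note * = bspec[OF bspec[OF S[unfolded tensorial_def] X] Z]
  show "V \<in> QG \<Longrightarrow> S (X + V) Z = S X Z + S V Z"
    by (rule conjunct1[OF bspec[OF conjunct1[OF *]]])
  show "SF UNIV f \<Longrightarrow> S (fscale f X) Z = fscale f (S X Z)"
    by (rule conjunct1[OF mp[OF spec[OF conjunct2[OF *]]]])
qed

lemma tensorial_flip: "tensorial S \<Longrightarrow> tensorial (\<lambda>X Z. S Z X)"
  by (simp add: tensorial_def)

text \<open>
  The members are global sections, so that the calculus of global fields applies to them; they form
  an orthonormal frame on \<open>W\<close> only.
\<close>

definition adapted_frame :: "'a set \<Rightarrow> ('n \<Rightarrow> 'a vfield) \<Rightarrow> bool" where
  "adapted_frame W E \<longleftrightarrow> open W \<and> (\<forall>a\<in>T. E a \<in> QG) \<and> (\<forall>x\<in>W. orthonormal x T (\<lambda>a. E a x))"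

lemma adapted_frame_spanned: "adapted_frame W E \<Longrightarrow> x \<in> W \<Longrightarrow> w \<in> Qp x \<Longrightarrow> spanned T (\<lambda>a. E a x) w"
  by (rule Qp_spanned) (auto simp: adapted_frame_def intro: QG_Qp)

text \<open>A tensor only depends on the values of its arguments near the point: multiply with a bump function.\<close>

lemma tensorial_zero_near:
  assumes S: "tensorial S" and X: "X \<in> QG" and Z: "Z \<in> QG" and W: "open W" "p \<in> W" and 0: "\<And>x. x \<in> W \<Longrightarrow> X x = 0"
  shows "S X Z p = 0"
proof -
  obtain V \<kappa> where b: "bump W V \<kappa>" and p: "p \<in> V" using bump_exists[OF W] .
  have \<kappa>: "SF UNIV \<kappa>" "\<kappa> p = 1" using b p by (auto simp: bump_def)
  have "fscale \<kappa> X = fscale (\<lambda>x. 0) X"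
  proof
    show "tscale (\<kappa> x) (X x) = tscale 0 (X x)" for x
      using 0 bump_zero[OF b, of x] by (cases "x \<in> W") auto
  qed
  then have "fscale \<kappa> (S X Z) = fscale (\<lambda>x. 0) (S X Z)"
    using tensorial_scale_left[OF S X Z \<kappa>(1)] tensorial_scale_left[OF S X Z SF_const[of UNIV 0]] by simp
  from fun_cong[OF this, of p] show ?thesis using \<kappa>(2) by simp
qed

lemma tensorial_expand:
  assumes S: "tensorial S" and X: "X \<in> QG" and Z: "Z \<in> QG" and E: "adapted_frame W E" and p: "p \<in> W"
  shows "S X Z p = (\<Sum>a\<in>T. tscale (g p (X p) (E a p)) (S (E a) Z p))"
proof -
  have EQ: "E a \<in> QG" if "a \<in> T" for a using E that by (simp add: adapted_frame_def)
  have c: "SF UNIV (gg X (E a))" if "a \<in> T" for a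
    by (rule gg_SF[OF QS_VF[OF X] QS_VF[OF EQ[OF that]] open_UNIV])
  have EQ': "fscale (gg X (E a)) (E a) \<in> QG" if "a \<in> T" for a by (rule QS_scale[OF c[OF that] EQ[OF that]])
  have S0: "S 0 Z = 0" using tensorial_add_left[OF S QS_zero Z QS_zero] by simp
  have sum: "S (\<Sum>a\<in>I. V a) Z = (\<Sum>a\<in>I. S (V a) Z)" if "\<And>a. a \<in> I \<Longrightarrow> V a \<in> QG" for I and V :: "'n \<Rightarrow> 'a vfield"
    using that
  proof (induction I rule: infinite_finite_induct)
    case (insert a I)
    then have "S (V a + (\<Sum>a\<in>I. V a)) Z = S (V a) Z + S (\<Sum>a\<in>I. V a) Z"
      by (intro tensorial_add_left[OF S _ Z] QS_sum) auto
    also have "S (\<Sum>a\<in>I. V a) Z = (\<Sum>a\<in>I. S (V a) Z)"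
      by (rule insert.IH) (use insert.prems in blast)
    finally show ?case by (simp only: sum.insert[OF insert.hyps])
  qed (simp_all add: S0)
  let ?X = "\<Sum>a\<in>T. fscale (gg X (E a)) (E a)"
  have XQ: "?X \<in> QG" by (rule QS_sum[OF EQ'])
  have W: "open W" using E by (simp add: adapted_frame_def)
  have "S (X - ?X) Z p = 0"
  proof (rule tensorial_zero_near[OF S QS_diff[OF X XQ] Z W p])
    fix x assume x: "x \<in> W"
    have "proj x T (\<lambda>a. E a x) (X x) = X x"
      using E x adapted_frame_spanned[OF E x QG_Qp[OF X]] by (intro proj_fix) (auto simp: adapted_frame_def)
    then show "(X - ?X) x = 0" by (simp add: proj_def sum_fun_apply)
  qed
  moreover have "S ((X - ?X) + ?X) Z = S (X - ?X) Z + S ?X Z"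
    by (rule tensorial_add_left[OF S QS_diff[OF X XQ] Z XQ])
  ultimately have "S X Z p = S ?X Z p" by simp
  also have "\<dots> = (\<Sum>a\<in>T. S (fscale (gg X (E a)) (E a)) Z p)" by (simp only: sum[OF EQ'] sum_fun_apply)
  also have "\<dots> = (\<Sum>a\<in>T. tscale (g p (X p) (E a p)) (S (E a) Z p))"
  proof (rule sum.cong)
    fix a assume a: "a \<in> T"
    have "S (fscale (gg X (E a)) (E a)) Z = fscale (gg X (E a)) (S (E a) Z)"
      by (rule tensorial_scale_left[OF S EQ[OF a] Z c[OF a]])
    then show "S (fscale (gg X (E a)) (E a)) Z p = tscale (g p (X p) (E a p)) (S (E a) Z p)" by simp
  qed simp
  finally show ?thesis .
qed

text \<open>
  The matrix that expresses one orthonormal frame in terms of the other is orthogonal. The second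
  family needs to be orthonormal at \<open>p\<close> only, because tensors can be evaluated pointwise.
\<close>

lemma trace_invariance:
  assumes S: "tensorial S" and E: "adapted_frame W E" and p: "p \<in> W"
    and e: "\<And>a. a \<in> T \<Longrightarrow> e a \<in> QG" and on: "orthonormal p T (\<lambda>a. e a p)"
  shows "(\<Sum>a\<in>T. S (e a) (e a) p) = (\<Sum>a\<in>T. S (E a) (E a) p)"
proof
  fix f
  have EQ: "E a \<in> QG" if "a \<in> T" for a using E that by (simp add: adapted_frame_def)
  have ET: "E a p \<in> TS p" if "a \<in> T" for a by (rule Qp_TS[OF QG_Qp[OF EQ[OF that]]])
  have eT: "e a p \<in> TS p" if "a \<in> T" for a by (rule Qp_TS[OF QG_Qp[OF e[OF that]]])
  have Eon: "orthonormal p T (\<lambda>a. E a p)" using E p by (simp add: adapted_frame_def)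
  let ?r = "\<lambda>a b. g p (e a p) (E b p)"
  have "S (e a) (e a) p f = (\<Sum>b\<in>T. \<Sum>c\<in>T. ?r a b * ?r a c * S (E b) (E c) p f)" if a: "a \<in> T" for a
  proof -
    have "S (E b) (e a) p = (\<Sum>c\<in>T. tscale (?r a c) (S (E b) (E c) p))" if "b \<in> T" for b
      using tensorial_expand[OF tensorial_flip[OF S] e[OF a] EQ[OF that] E p] .
    then show ?thesis
      using tensorial_expand[OF S e[OF a] e[OF a] E p]
      by (simp add: sum_fun_apply sum_distrib_left mult.assoc)
  qed
  then have "(\<Sum>a\<in>T. S (e a) (e a) p f) = (\<Sum>a\<in>T. \<Sum>b\<in>T. \<Sum>c\<in>T. ?r a b * ?r a c * S (E b) (E c) p f)"
    by (rule sum.cong[OF refl])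
  also have "\<dots> = (\<Sum>b\<in>T. \<Sum>a\<in>T. \<Sum>c\<in>T. ?r a b * ?r a c * S (E b) (E c) p f)" by (rule sum.swap)
  also have "\<dots> = (\<Sum>b\<in>T. \<Sum>c\<in>T. \<Sum>a\<in>T. ?r a b * ?r a c * S (E b) (E c) p f)"
    by (intro sum.cong refl sum.swap)
  also have "\<dots> = (\<Sum>b\<in>T. \<Sum>c\<in>T. (if b = c then 1 else 0) * S (E b) (E c) p f)"
  proof (intro sum.cong refl)
    fix b c assume b: "b \<in> T" and c: "c \<in> T"
    have "(\<Sum>a\<in>T. ?r a b * ?r a c) = (\<Sum>a\<in>T. g p (E b p) (e a p) * g p (E c p) (e a p))"
      using g_sym[OF eT ET] b c by (intro sum.cong) auto
    also have "\<dots> = g p (E b p) (E c p)"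
      by (rule parseval[OF on ET[OF b] ET[OF c] Qp_spanned[OF on QG_Qp[OF e] QG_Qp[OF EQ[OF b]]], symmetric])
    also have "\<dots> = (if b = c then 1 else 0)" using Eon b c by (simp add: orthonormal_def)
    finally show "(\<Sum>a\<in>T. ?r a b * ?r a c * S (E b) (E c) p f) = (if b = c then 1 else 0) * S (E b) (E c) p f"
      by (simp only: sum_distrib_right[symmetric])
  qed
  also have "\<dots> = (\<Sum>b\<in>T. S (E b) (E b) p f)"
    by (intro sum.cong refl) (simp add: if_distrib[of "\<lambda>r. r * _"] cong: if_cong)
  finally show "(\<Sum>a\<in>T. S (e a) (e a) p) f = (\<Sum>a\<in>T. S (E a) (E a) p) f" by (simp add: sum_fun_apply)
qed

lemma globalize_frame:
  assumes E: "orthonormal_basic_frame A T F g U E" and p: "p \<in> U"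
  obtains W E' where "adapted_frame W E'" "p \<in> W" "W \<subseteq> U" "\<And>a x. x \<in> W \<Longrightarrow> E' a x = E a x"
proof -
  have U: "open U" and EQ: "\<And>a. a \<in> T \<Longrightarrow> E a \<in> QS U"
    and on: "\<And>x a b. x \<in> U \<Longrightarrow> a \<in> T \<Longrightarrow> b \<in> T \<Longrightarrow> g x (E a x) (E b x) = (if a = b then 1 else 0)"
    using E by (auto simp: orthonormal_basic_frame_def)
  obtain W \<kappa> where b: "bump U W \<kappa>" and pW: "p \<in> W" using bump_exists[OF U p] .
  have W: "open W" "W \<subseteq> U" and \<kappa>: "\<And>x. x \<in> W \<Longrightarrow> \<kappa> x = 1" using b by (auto simp: bump_def)
  have "adapted_frame W (\<lambda>a. fscale \<kappa> (E a))"
    unfolding adapted_frame_def orthonormal_def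
    using W \<kappa> on QS_TS[OF EQ] bump_scale_QS[OF b U EQ] by (auto simp: subset_iff)
  then show ?thesis using that[of W "\<lambda>a. fscale \<kappa> (E a)"] pW W(2) \<kappa> by simp
qed

lemma adapted_frame_exists:
  obtains W E where "adapted_frame W E" "p \<in> W"
proof -
  obtain U and E :: "'n \<Rightarrow> 'a vfield" where "p \<in> U" "orthonormal_basic_frame A T F g U E"
    using basic_frame_exists[of p] by metis
  then show ?thesis using globalize_frame that by metis
qed

lemma curv_tensorial: "s \<in> QG \<Longrightarrow> tensorial (\<lambda>X Z. curv s X Z)"
  unfolding tensorial_def
  by (simp add: curv_add_middle curv_add_right curv_scale_middle curv_scale_right QS_VF)

text \<open>
  The Ricci operator is defined by some local frame. It can be computed in any adapted frame, since
  curvature is local and tensorial.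
\<close>

lemma trans_ricci_frame:
  assumes s: "s \<in> QG" and E: "adapted_frame W E" and p: "p \<in> W"
  shows "trans_ricci A T F g s p = (\<Sum>a\<in>T. curv s (E a) (E a) p)"
proof -
  let ?E = "SOME E. \<exists>U. p \<in> U \<and> orthonormal_basic_frame A T F g U E"
  have "\<exists>E. \<exists>U. p \<in> U \<and> orthonormal_basic_frame A T F g U E"
    using basic_frame_exists[of p] by metis
  from someI_ex[OF this] obtain U where U: "p \<in> U" "orthonormal_basic_frame A T F g U ?E" by blast
  obtain V E' where V: "adapted_frame V E'" "p \<in> V" "V \<subseteq> U" "\<And>a x. x \<in> V \<Longrightarrow> E' a x = ?E a x"
    by (rule globalize_frame[OF U(2,1)]) (rule that)
  have oV: "open V" and E': "\<And>a. a \<in> T \<Longrightarrow> E' a \<in> QG" using V(1) by (auto simp: adapted_frame_def)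
  have "curv s (?E a) (?E a) p = curv s (E' a) (E' a) p" if a: "a \<in> T" for a
  proof (rule curv_cong[OF oV V(2), symmetric])
    show "s \<in> VF V" "E' a \<in> VF V" "E' a \<in> QS V"
      using QS_subset[OF s] QS_subset[OF E'[OF a]] QS_VF by auto
  qed (simp_all add: V(4))
  then have "trans_ricci A T F g s p = (\<Sum>a\<in>T. curv s (E' a) (E' a) p)"
    by (simp add: trans_ricci_def Let_def)
  also have "\<dots> = (\<Sum>a\<in>T. curv s (E a) (E a) p)"
    by (rule trace_invariance[OF curv_tensorial[OF s] E p E'])
      (use V in \<open>simp_all add: adapted_frame_def\<close>)
  finally show ?thesis .
qed

end

section \<open>Transversally holomorphic fields on Kaehler foliations\<close>

locale kaehler_foliated_manifold = foliated_manifold A g T F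
  for A :: "('a::t2_space, 'n::finite) chart set" and g T F +
  fixes J :: "'a \<Rightarrow> 'a tvec \<Rightarrow> 'a tvec"
  assumes kaehler: "kaehler_foliation A T F g J"
begin

abbreviation JS :: "'a vfield \<Rightarrow> 'a vfield" where "JS s \<equiv> (\<lambda>x. J x (s x))"

lemma almost_complex: "almost_complex_structure A T F g J"
  using kaehler unfolding kaehler_foliation_def by (elim conjE)

lemma
  assumes v: "v \<in> Qp p"
  shows J_Qp: "J p v \<in> Qp p" and J_J: "J p (J p v) = - v"
    and J_add: "w \<in> Qp p \<Longrightarrow> J p (v + w) = J p v + J p w"
  using almost_complex v unfolding almost_complex_structure_def by blast+

lemma J_diff: "v \<in> Qp p \<Longrightarrow> w \<in> Qp p \<Longrightarrow> J p (v - w) = J p v - J p w"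
  using J_add[of "v - w" p w] Qp_diff[of v p w] by simp

lemma J_g: "v \<in> Qp p \<Longrightarrow> w \<in> Qp p \<Longrightarrow> g p (J p v) (J p w) = g p v w"
  using kaehler unfolding kaehler_foliation_def by blast

lemma JS_QG: "s \<in> QG \<Longrightarrow> JS s \<in> QG"
  using almost_complex open_UNIV unfolding almost_complex_structure_def by blast

lemma JS_JS: "s \<in> QG \<Longrightarrow> JS (JS s) = - s"
  by (rule ext) (simp add: J_J QG_Qp)

lemma JS_add: "s \<in> QG \<Longrightarrow> t \<in> QG \<Longrightarrow> JS (s + t) = JS s + JS t"
  by (rule ext) (simp add: J_add QG_Qp)

lemma JS_diff: "s \<in> QG \<Longrightarrow> t \<in> QG \<Longrightarrow> JS (s - t) = JS s - JS t"
  by (rule ext) (simp add: J_diff QG_Qp)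

lemma conn_JS:
  assumes X: "X \<in> VG" and s: "s \<in> QG"
  shows "conn X (JS s) = JS (conn X s)"
proof
  fix p
  have "\<forall>X\<in>VG. \<forall>s\<in>QG. \<forall>p. conn X (JS s) p - J p (conn X s p) = 0"
    using kaehler unfolding kaehler_foliation_def by (elim conjE)
  then have "conn X (JS s) p - J p (conn X s p) = 0" using X s by blast
  then show "conn X (JS s) p = J p (conn X s p)" by simp
qed

lemma curv_JS:
  assumes X: "X \<in> VG" and Z: "Z \<in> VG" and s: "s \<in> QG"
  shows "curv X Z (JS s) = JS (curv X Z s)"
proof -
  note c = conn_QG[OF X conn_QG[OF Z s]] conn_QG[OF Z conn_QG[OF X s]] conn_QG[OF bracket_VG[OF X Z] s]
  have "curv X Z (JS s) = JS (conn X (conn Z s)) - JS (conn Z (conn X s)) - JS (conn (bracket X Z) s)"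
    unfolding curv_eq by (simp only: conn_JS X Z s bracket_VG conn_QG)
  also have "\<dots> = JS (conn X (conn Z s) - conn Z (conn X s) - conn (bracket X Z) s)"
    by (simp only: JS_diff[OF QS_diff[OF c(1,2)] c(3)] JS_diff[OF c(1,2)])
  finally show ?thesis by (simp only: curv_eq)
qed

lemma curv_uminus_right:
  assumes "X \<in> VG" "Z \<in> VG" "s \<in> QG"
  shows "curv X Z (- s) = - curv X Z s"
proof -
  have "- t = fscale (\<lambda>x. - 1) t" for t :: "'a vfield" by (auto simp: fun_eq_iff)
  then show ?thesis using curv_scale_right[OF SF_const assms, of "- 1"] by simp
qed

context
  fixes Y :: "'a vfield"
  assumes Y: "Y \<in> IA UNIV" and holomorphic: "transversally_holomorphic A T F g J Y"
begin

abbreviation "N \<equiv> QP Y"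

lemma N_QG: "N \<in> QG"
  by (rule QP_QG[OF IA_VF[OF Y]])

text \<open>
  By torsion-freeness \<open>\<theta>(Y)s = \<nabla>\<^sub>Y s - \<nabla>\<^sub>s N\<close>, and \<open>\<nabla>\<^sub>Y\<close> commutes with \<open>J\<close>.
\<close>

lemma conn_N_JS:
  assumes s: "s \<in> QG"
  shows "conn (JS s) N = JS (conn s N)"
proof
  fix p
  note Js = JS_QG[OF s] and YV = IA_VF[OF Y]
  have lie: "trans_lie A T F g Y t = conn Y t - conn t N" if "t \<in> QG" for t
    using conn_torsion[OF YV QS_VF[OF that]] unfolding QG_QP[OF that]
    by (simp add: trans_lie_def[abs_def])
  have "trans_lie A T F g Y (JS s) p = J p (trans_lie A T F g Y s p)"
    using holomorphic s unfolding transversally_holomorphic_def trans_lie_endo_def by fastforce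
  then have "conn Y (JS s) p - conn (JS s) N p = J p (conn Y s p - conn s N p)"
    by (simp add: lie s Js)
  also have "\<dots> = J p (conn Y s p) - J p (conn s N p)"
    by (intro J_diff QG_Qp conn_QG YV s N_QG QS_VF)
  finally show "conn (JS s) N p = J p (conn s N p)" by (simp add: conn_JS[OF YV s])
qed

text \<open>The second covariant derivative of \<open>N\<close>.\<close>

definition hess :: "'a vfield \<Rightarrow> 'a vfield \<Rightarrow> 'a vfield" where
  "hess X Z = conn X (conn Z N) - conn (conn X Z) N"

lemma hess_QG: "X \<in> QG \<Longrightarrow> Z \<in> QG \<Longrightarrow> hess X Z \<in> QG"
  unfolding hess_def by (intro QS_diff conn_QG QS_VF N_QG)

lemma hess_JS:
  assumes X: "X \<in> QG" and Z: "Z \<in> QG"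
  shows "hess X (JS Z) = JS (hess X Z)"
  unfolding hess_def
  by (simp only: conn_N_JS X Z conn_QG QS_VF conn_JS N_QG JS_diff)

text \<open>Derivatives of \<open>N\<close> along the leaves vanish, so only the curvature term survives.\<close>

lemma hess_commute:
  assumes X: "X \<in> QG" and Z: "Z \<in> QG"
  shows "hess X Z - hess Z X = curv X Z N"
proof -
  note XV = QS_VF[OF X] and ZV = QS_VF[OF Z]
  note B = bracket_VG[OF XV ZV]
  have "conn X Z - conn Z X = QP (bracket X Z)"
    using conn_torsion[OF XV ZV] unfolding QG_QP[OF X] QG_QP[OF Z] .
  then have "conn (conn X Z) N - conn (conn Z X) N = conn (QP (bracket X Z)) N"
    using conn_diff_left[OF QS_VF[OF conn_QG[OF XV Z]] QS_VF[OF conn_QG[OF ZV X]] N_QG] by simp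
  moreover have "conn (bracket X Z) N - conn (QP (bracket X Z)) N = 0"
    using conn_diff_left[OF B QP_VG[OF B] N_QG] conn_L_IA[OF LP_LS[OF open_UNIV B] Y]
    by (simp add: fun_diff_def)
  ultimately show ?thesis unfolding hess_def curv_eq by (simp add: algebra_simps)
qed

lemma hess_tensorial: "tensorial hess"
  unfolding tensorial_def
proof (intro ballI conjI allI impI)
  fix X Z assume X: "X \<in> QG" and Z: "Z \<in> QG"
  note XV = QS_VF[OF X] and ZV = QS_VF[OF Z] and c = conn_QG[OF QS_VF[OF X]] conn_QG[OF QS_VF[OF Z]]
  {
    fix V assume V: "V \<in> QG"
    note VV = QS_VF[OF V]
    show "hess (X + V) Z = hess X Z + hess V Z"
      unfolding hess_def
      by (simp only: conn_add_left XV VV ZV c N_QG conn_QG Z QS_VF) simp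
    show "hess X (Z + V) = hess X Z + hess X V"
      unfolding hess_def
      by (simp only: conn_add_left conn_add_right XV VV ZV c N_QG conn_QG Z V QS_VF) simp
  }
  fix f assume f: "SF UNIV f"
  have Xf: "SF UNIV (\<lambda>x. X x f)" by (rule VF_SF[OF XV]) (auto intro: f)
  show "hess (fscale f X) Z = fscale f (hess X Z)"
    unfolding hess_def
    by (simp only: conn_scale_left[OF f] XV c N_QG conn_QG Z QS_VF) (simp add: fun_eq_iff algebra_simps)
  show "hess X (fscale f Z) = fscale f (hess X Z)"
    unfolding hess_def
    by (simp only: conn_scale_left[OF f ZV N_QG] conn_scale_right[OF f XV c(2)[OF N_QG]] conn_scale_right[OF f XV Z]
        conn_add_left[OF VF_scale[OF Xf ZV] VF_scale[OF f QS_VF[OF c(1)[OF Z]]] N_QG]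
        conn_scale_left[OF Xf ZV N_QG] conn_scale_left[OF f QS_VF[OF c(1)[OF Z]] N_QG])
      (simp add: fun_eq_iff algebra_simps)
qed

text \<open>
  Commuting \<open>J\<close> through both slots of the second derivative costs a curvature term, which the
  Bianchi identity turns into two terms of Ricci type.
\<close>

lemma hess_JS_JS:
  assumes X: "X \<in> QG"
  shows "hess (JS X) (JS X) = - hess X X - curv N X X - curv N (JS X) (JS X)"
proof -
  note JX = JS_QG[OF X] and N = N_QG
  note V = QS_VF[OF X] QS_VF[OF JX] QS_VF[OF N]
  have "curv (JS X) X N = - curv X N (JS X) - curv N (JS X) X"
    using bianchi[OF JX X N] by (simp add: eq_neg_iff_add_eq_0 algebra_simps)
  also have "\<dots> = curv N X (JS X) + curv N (JS X) (JS (JS X))"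
    using curv_antisym[OF V(1,3) JX] curv_uminus_right[OF V(3,2) X] by (simp add: JS_JS[OF X])
  also have "\<dots> = JS (curv N X X) + JS (curv N (JS X) (JS X))"
    by (simp only: curv_JS V X JX)
  finally have c: "curv (JS X) X N = JS (curv N X X) + JS (curv N (JS X) (JS X))" .
  have cQ: "curv N X X \<in> QG" "curv N (JS X) (JS X) \<in> QG" by (intro curv_QG V X JX)+
  have "hess (JS X) (JS X) = JS (hess (JS X) X)" by (rule hess_JS[OF JX X])
  also have "hess (JS X) X = hess X (JS X) + curv (JS X) X N"
    using hess_commute[OF JX X] by (simp add: algebra_simps)
  also have "\<dots> = JS (hess X X) + (JS (curv N X X) + JS (curv N (JS X) (JS X)))"
    by (simp only: hess_JS[OF X X] c)
  also have "JS \<dots> = JS (JS (hess X X)) + (JS (JS (curv N X X)) + JS (JS (curv N (JS X) (JS X))))"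
    by (simp only: JS_add JS_QG QS_add cQ hess_QG[OF X X])
  also have "\<dots> = - hess X X - curv N X X - curv N (JS X) (JS X)"
    by (simp only: JS_JS cQ hess_QG[OF X X]) simp
  finally show ?thesis .
qed

text \<open>
  Sum \<open>hess_JS_JS\<close> over a frame \<open>E\<close>: both \<open>hess\<close> and \<open>curv N\<close> have the same trace with respect to \<open>E\<close> and
  to the orthonormal family \<open>JE\<close>. So twice the trace of \<open>hess\<close> is minus twice the Ricci operator.
\<close>

lemma weitzenboeck:
  assumes E: "adapted_frame W E" and p: "p \<in> W"
  shows "(\<Sum>a\<in>T. hess (E a) (E a) p) = - trans_ricci A T F g N p"
proof
  fix f
  have EQ: "E a \<in> QG" if "a \<in> T" for a using E that by (simp add: adapted_frame_def)
  have on: "orthonormal p T (\<lambda>a. E a p)" using E p by (simp add: adapted_frame_def)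
  have J: "orthonormal p T (\<lambda>a. JS (E a) p)"
    using on J_g[OF QG_Qp[OF EQ] QG_Qp[OF EQ]] Qp_TS[OF J_Qp[OF QG_Qp[OF EQ]]]
    by (simp add: orthonormal_def)
  note tr = trace_invariance[OF _ E p JS_QG[OF EQ] J]
  have "(\<Sum>a\<in>T. hess (E a) (E a) p) = (\<Sum>a\<in>T. hess (JS (E a)) (JS (E a)) p)"
    by (rule tr[OF hess_tensorial, symmetric])
  also have "\<dots> = (\<Sum>a\<in>T. - hess (E a) (E a) p - curv N (E a) (E a) p - curv N (JS (E a)) (JS (E a)) p)"
    by (rule sum.cong) (simp_all add: hess_JS_JS EQ)
  also have "\<dots> = - (\<Sum>a\<in>T. hess (E a) (E a) p) - (\<Sum>a\<in>T. curv N (E a) (E a) p)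
      - (\<Sum>a\<in>T. curv N (JS (E a)) (JS (E a)) p)"
    by (simp add: sum_subtractf sum_negf)
  also have "(\<Sum>a\<in>T. curv N (JS (E a)) (JS (E a)) p) = (\<Sum>a\<in>T. curv N (E a) (E a) p)"
    by (rule tr[OF curv_tensorial[OF N_QG]])
  finally have "(\<Sum>a\<in>T. hess (E a) (E a) p) f =
      (- (\<Sum>a\<in>T. hess (E a) (E a) p) - (\<Sum>a\<in>T. curv N (E a) (E a) p) - (\<Sum>a\<in>T. curv N (E a) (E a) p)) f"
    by (rule fun_cong)
  then show "(\<Sum>a\<in>T. hess (E a) (E a) p) f = (- trans_ricci A T F g N p) f"
    unfolding trans_ricci_frame[OF N_QG E p] by simp
qed

lemma gg_N_derivative:
  assumes X: "X \<in> VG"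
  shows "X p (gg N N) = 2 * g p (conn X N p) (N p)"
proof -
  have "conn X N p \<in> TS p" "N p \<in> TS p"
    using Qp_TS[OF QG_Qp[OF conn_QG[OF X N_QG]]] Qp_TS[OF QG_Qp[OF N_QG]] by blast+
  then show ?thesis using conn_metric[OF X N_QG N_QG] g_sym by simp
qed

text \<open>Differentiate \<open>g(N, N)\<close> twice along each \<open>E\<^sub>a\<close> and insert \<open>weitzenboeck\<close>.\<close>

lemma bochner:
  assumes E: "adapted_frame W E" and p: "p \<in> W"
  shows "(\<Sum>a\<in>T. E a p (\<lambda>x. E a x (gg N N))) - (\<Sum>a\<in>T. conn (E a) (E a) p (gg N N)) =
    2 * (\<Sum>a\<in>T. g p (conn (E a) N p) (conn (E a) N p)) - 2 * g p (trans_ricci A T F g N p) (N p)"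
proof -
  have EQ: "E a \<in> QG" if "a \<in> T" for a using E that by (simp add: adapted_frame_def)
  have TQ: "s p \<in> TS p" if "s \<in> QG" for s by (rule Qp_TS[OF QG_Qp[OF that]])
  have *: "E a p (\<lambda>x. E a x (gg N N)) - conn (E a) (E a) p (gg N N) =
      2 * g p (conn (E a) N p) (conn (E a) N p) + 2 * g p (hess (E a) (E a) p) (N p)" if a: "a \<in> T" for a
  proof -
    note X = QS_VF[OF EQ[OF a]]
    note c = conn_QG[OF X N_QG] conn_QG[OF X EQ[OF a]]
    have "E a p (\<lambda>x. E a x (gg N N)) = E a p (\<lambda>x. 2 * gg (conn (E a) N) N x)"
      by (simp only: gg_N_derivative[OF X])
    also have "\<dots> = 2 * E a p (gg (conn (E a) N) N)"
      by (rule TS_cmult[OF global_TS[OF X] gg_near[OF QS_VF[OF c(1)] QS_VF[OF N_QG] open_UNIV UNIV_I]])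
    also have "E a p (gg (conn (E a) N) N) =
        g p (conn (E a) (conn (E a) N) p) (N p) + g p (conn (E a) N p) (conn (E a) N p)"
      by (rule conn_metric[OF X c(1) N_QG])
    finally show ?thesis
      unfolding gg_N_derivative[OF QS_VF[OF c(2)]] hess_def minus_apply
        g_diff_left[OF TQ[OF conn_QG[OF X c(1)]] TQ[OF conn_QG[OF QS_VF[OF c(2)] N_QG]] TQ[OF N_QG]]
      by simp
  qed
  have "(\<Sum>a\<in>T. E a p (\<lambda>x. E a x (gg N N))) - (\<Sum>a\<in>T. conn (E a) (E a) p (gg N N)) =
      (\<Sum>a\<in>T. 2 * g p (conn (E a) N p) (conn (E a) N p) + 2 * g p (hess (E a) (E a) p) (N p))"
    unfolding sum_subtractf[symmetric] by (rule sum.cong[OF refl *])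
  also have "\<dots> = 2 * (\<Sum>a\<in>T. g p (conn (E a) N p) (conn (E a) N p)) + 2 * g p (\<Sum>a\<in>T. hess (E a) (E a) p) (N p)"
    using g_sum_left[of T "\<lambda>a. hess (E a) (E a) p" p "N p"] TQ[OF hess_QG[OF EQ EQ]] TQ[OF N_QG]
    by (simp add: sum.distrib sum_distrib_left)
  also have "g p (\<Sum>a\<in>T. hess (E a) (E a) p) (N p) = - g p (trans_ricci A T F g N p) (N p)"
  proof -
    have "trans_ricci A T F g N p \<in> TS p"
      unfolding trans_ricci_frame[OF N_QG E p]
      by (intro TS_sum_mem TQ curv_QG QS_VF N_QG EQ)
    then show ?thesis unfolding weitzenboeck[OF E p] using g_uminus_left TQ[OF N_QG] by blast
  qed
  finally show ?thesis by simp
qed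

lemma leaf_derivative_zero:
  assumes V: "V \<in> LS U" and U: "open U" and p: "p \<in> U"
  shows "V p (gg N N) = 0"
proof -
  obtain W \<kappa> where b: "bump U W \<kappa>" and pW: "p \<in> W" using bump_exists[OF U p] .
  have "fscale \<kappa> V p (gg N N) = 0"
    using conn_L_IA[OF bump_scale_LS[OF b U V] Y] gg_N_derivative[OF LS_VF[OF bump_scale_LS[OF b U V]]]
      g_zero_left[OF Qp_TS[OF QG_Qp[OF N_QG]]] by simp
  then show ?thesis using b pW by (simp add: bump_def)
qed

end

end

section \<open>The strong maximum principle\<close>

text \<open>Reduce to the line through \<open>y\<close>; a positive second derivative would make \<open>F\<close> increase on it at first.\<close>

lemma second_derivative_nonpos:
  fixes F :: "'e::euclidean_space \<Rightarrow> real"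
  assumes S: "open S" "y \<in> S" and F: "smooth_on F S" and max: "\<And>z. z \<in> S \<Longrightarrow> F z \<le> F y"
  shows "frechet_derivative (\<lambda>z. frechet_derivative F (at z) \<xi>) (at y) \<xi> \<le> 0"
proof (rule ccontr)
  let ?G = "\<lambda>z. frechet_derivative F (at z) \<xi>"
  let ?c = "frechet_derivative ?G (at y) \<xi>"
  assume "\<not> ?c \<le> 0"
  then have c: "?c > 0" by simp
  have line: "((\<lambda>t. y + t *\<^sub>R \<xi>) has_derivative (\<lambda>t. t *\<^sub>R \<xi>)) (at t)" for t
    by (auto intro!: derivative_eq_intros)
  have real_deriv: "((\<lambda>t. H (y + t *\<^sub>R \<xi>)) has_real_derivative frechet_derivative H (at (y + t *\<^sub>R \<xi>)) \<xi>) (at t)"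
    if H: "smooth_on H S" and t: "y + t *\<^sub>R \<xi> \<in> S" for H :: "'e \<Rightarrow> real" and t
  proof -
    note D = smooth_on_has_derivative[OF H t]
    have "linear (frechet_derivative H (at (y + t *\<^sub>R \<xi>)))"
      using D by (intro linear_frechet_derivative) (rule differentiableI)
    then show ?thesis
      using has_derivative_compose[OF line D]
      by (simp add: has_field_derivative_def linear_scale mult_commute_abs)
  qed
  let ?I = "(\<lambda>t. y + t *\<^sub>R \<xi>) -` S"
  have "open ?I" by (intro open_vimage S continuous_intros)
  moreover have "0 \<in> ?I" using S by simp
  ultimately obtain d where "d > 0" "ball 0 d \<subseteq> ?I" using openE by blast
  then have d: "d > 0" "\<And>t. \<bar>t\<bar> < d \<Longrightarrow> y + t *\<^sub>R \<xi> \<in> S" by (auto simp: subset_iff dist_real_def)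
  have "frechet_derivative F (at y) = (\<lambda>v. 0)"
    by (rule differential_zero_maxmin[OF S(2,1) smooth_on_has_derivative[OF F S(2)]]) (use max in blast)
  then have G0: "?G y = 0" by simp
  have "((\<lambda>t. ?G (y + t *\<^sub>R \<xi>)) has_real_derivative ?c) (at 0)"
    using real_deriv[OF smooth_on_frechet_derivative[OF F], of 0] S by simp
  from DERIV_pos_inc_right[OF this c] obtain e where e: "e > 0"
    "\<And>h. 0 < h \<Longrightarrow> h < e \<Longrightarrow> 0 < ?G (y + h *\<^sub>R \<xi>)" using G0 by auto
  define h where "h = min d e / 2"
  have h: "0 < h" "h < d" "h < e" using d e by (auto simp: h_def)
  have "F (y + 0 *\<^sub>R \<xi>) < F (y + h *\<^sub>R \<xi>)"
  proof (rule DERIV_pos_imp_increasing_open[OF h(1)])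
    fix t assume t: "0 < t" "t < h"
    then have "y + t *\<^sub>R \<xi> \<in> S" using d(2)[of t] h by simp
    then show "\<exists>l. ((\<lambda>t. F (y + t *\<^sub>R \<xi>)) has_real_derivative l) (at t) \<and> 0 < l"
      using real_deriv[OF F] e(2)[of t] t h by fastforce
  next
    show "continuous_on {0..h} (\<lambda>t. F (y + t *\<^sub>R \<xi>))"
    proof (rule continuous_on_compose2[OF smooth_on_continuous[OF F]])
      show "(\<lambda>t. y + t *\<^sub>R \<xi>) ` {0..h} \<subseteq> S" using d(2) h by auto
    qed (intro continuous_intros)
  qed
  moreover have "y + h *\<^sub>R \<xi> \<in> S" using d(2)[of h] h by simp
  ultimately show False using max[of "y + h *\<^sub>R \<xi>"] by simp
qed

context smooth_manifold
begin

lemma local_max_first: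
  assumes W: "open W" "p \<in> W" and u: "SF W u" and max: "\<And>x. x \<in> W \<Longrightarrow> u x \<le> u p" and v: "v \<in> TS p"
  shows "v u = 0"
proof -
  obtain U \<phi> where adm: "admissible (U, \<phi>)" and p: "p \<in> U" by (rule admissible_chart_at)
  note U = chart_facts[OF admissible_chart[OF adm]]
  note n = nearI[OF W u]
  have o: "open (\<phi> ` (U \<inter> W))" using U(1,7) W(1) by auto
  have "frechet_derivative (\<lambda>y. u (inv_into U \<phi> y)) (at (\<phi> p)) = (\<lambda>w. 0)"
  proof (rule differential_zero_maxmin[OF _ o near_chart_derivative[OF adm p n]])
    show "\<phi> p \<in> \<phi> ` (U \<inter> W)" using p W by auto
    have "u (inv_into U \<phi> y) \<le> u (inv_into U \<phi> (\<phi> p))" if "y \<in> \<phi> ` (U \<inter> W)" for y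
      using that max U(5) p by auto
    then show "(\<forall>y\<in>\<phi> ` (U \<inter> W). u (inv_into U \<phi> y) \<le> u (inv_into U \<phi> (\<phi> p))) \<or>
        (\<forall>y\<in>\<phi> ` (U \<inter> W). u (inv_into U \<phi> (\<phi> p)) \<le> u (inv_into U \<phi> y))" by blast
  qed
  then show ?thesis using TS_chart[OF adm p v n] by simp
qed

text \<open>
  Replacing \<open>V\<close> by the field with constant coordinates and the same value at \<open>p\<close> changes \<open>V(Vu)\<close> by
  \<open>V(Xu)\<close> for a field \<open>X\<close> that vanishes at \<open>p\<close>; this is \<open>[V, X]u = 0\<close> at a maximum point.
\<close>

lemma local_max_second:
  assumes W: "open W" "p \<in> W" and u: "SF W u" and max: "\<And>x. x \<in> W \<Longrightarrow> u x \<le> u p" and V: "V \<in> VF W"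
  shows "V p (\<lambda>x. V x u) \<le> 0"
proof -
  obtain U \<phi> where adm: "admissible (U, \<phi>)" and p: "p \<in> U" by (rule admissible_chart_at)
  note U = chart_facts[OF admissible_chart[OF adm]]
  define W' where "W' = U \<inter> W"
  have W': "open W'" "p \<in> W'" "W' \<subseteq> U" "W' \<subseteq> W" using U(1) W p by (auto simp: W'_def)
  note u' = SF_subset[OF u W'(4)] and V' = VF_subset[OF V W'(4)]
  note n = nearI[OF W u]
  define \<xi> where "\<xi> = vcoord \<phi> (V p)"
  let ?C = "chart_vector (U, \<phi>) \<xi>"
  have C: "?C \<in> VF W'" by (rule VF_subset[OF chart_vector_VF[OF adm] W'(3)])
  have Vp: "V p = ?C p"
    by (rule TS_eqI[OF adm p VF_TS[OF V W(2)] chart_vector_TS[OF adm p]])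
      (simp add: chart_vector_coord[OF adm p] \<xi>_def vcoord_def)
  let ?X = "V - ?C"
  have X: "?X \<in> VF W'" by (rule VF_diff[OF V' C])
  have "bracket V ?X p u = 0"
    using local_max_first[OF W'(1,2) u' _ bracket_TS[OF V' X W'(1,2)]] max W'(4) by blast
  then have "V p (\<lambda>x. ?X x u) = ?X p (\<lambda>x. V x u)" by (simp add: bracket_apply[OF n])
  also have "\<dots> = 0" by (simp add: Vp)
  finally have "V p (\<lambda>x. V x u - ?C x u) = 0" by simp
  then have "V p (\<lambda>x. V x u) = V p (\<lambda>x. ?C x u)"
    using TS_diff[OF VF_TS[OF V W(2)] VF_near[OF V' W'(1,2) n] VF_near[OF C W'(1,2) n]] by simp
  also have "\<dots> = ?C p (\<lambda>x. ?C x u)" by (simp only: Vp)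
  also have "\<dots> = frechet_derivative (\<lambda>y. ?C (inv_into U \<phi> y) u) (at (\<phi> p)) \<xi>"
    using VF_near[OF C W'(1,2) n] by (simp add: chart_vector_def[of _ _ p])
  also have "frechet_derivative (\<lambda>y. ?C (inv_into U \<phi> y) u) (at (\<phi> p)) =
      frechet_derivative (\<lambda>y. frechet_derivative (\<lambda>y. u (inv_into U \<phi> y)) (at y) \<xi>) (at (\<phi> p))"
  proof -
    have "((\<lambda>y. frechet_derivative (\<lambda>y. u (inv_into U \<phi> y)) (at y) \<xi>) has_derivative
        frechet_derivative (\<lambda>y. ?C (inv_into U \<phi> y) u) (at (\<phi> p))) (at (\<phi> p))"
    proof (rule has_derivative_transform_within_open[OF near_chart_derivative[OF adm p VF_near[OF C W'(1,2) n]] U(7)[OF W'(1,3)]])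
      show "\<phi> p \<in> \<phi> ` W'" using W' by blast
      fix y assume "y \<in> \<phi> ` W'"
      then obtain x where x: "x \<in> W'" "y = \<phi> x" by auto
      have "near x u" by (rule nearI[OF W'(1) x(1) u'])
      then show "?C (inv_into U \<phi> y) u = frechet_derivative (\<lambda>y. u (inv_into U \<phi> y)) (at y) \<xi>"
        using x U(5)[of x] W'(3) by (auto simp: chart_vector_def)
    qed
    then show ?thesis by (rule frechet_derivative_at)
  qed
  also have "\<dots> \<xi> \<le> 0"
  proof (rule second_derivative_nonpos[OF U(7)[OF W'(1,3)]])
    show "\<phi> p \<in> \<phi> ` W'" using W' by blast
    show "smooth_on (\<lambda>y. u (inv_into U \<phi> y)) (\<phi> ` W')" using u' SF_iff_chart[OF adm W'(1,3)] by blast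
    show "u (inv_into U \<phi> z) \<le> u (inv_into U \<phi> (\<phi> p))" if z: "z \<in> \<phi> ` W'" for z
      using z max U(5)[OF subsetD[OF W'(3)]] U(5)[OF p] W'(4) by auto
  qed
  finally show ?thesis .
qed

text \<open>
  Hopf's argument. If \<open>f < m\<close> somewhere near a point where \<open>f = m\<close>, there is in the chart a closed ball
  with centre \<open>c\<close> on which \<open>f = m\<close> only at one boundary point \<open>z\<^sub>0\<close>. For large \<open>\<alpha>\<close> the operator is
  positive on \<open>h = exp (- \<alpha> \<bar>y - c\<bar>\<^sup>2) - exp (- \<alpha> r\<^sup>2)\<close> near \<open>z\<^sub>0\<close>. For small \<open>\<epsilon> > 0\<close> the function
  \<open>f + \<epsilon> h\<close> is less than \<open>m\<close> on a small sphere around \<open>z\<^sub>0\<close>: inside the first ball because \<open>f < m\<close>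
  there, outside because \<open>h < 0\<close>. As it equals \<open>m\<close> at \<open>z\<^sub>0\<close>, it has an interior maximum, where the
  operator cannot be positive.
\<close>

lemma strong_maximum_principle:
  assumes adm: "admissible (U, \<phi>)" and W: "open W" "W \<subseteq> U"
    and E: "\<And>i. i \<in> I \<Longrightarrow> E i \<in> VF W" and B: "B \<in> VF W"
    and sp: "\<And>x v. x \<in> W \<Longrightarrow> v \<in> TS x \<Longrightarrow> spanned I (\<lambda>i. E i x) v"
    and f: "SF W f" and sub: "\<And>x. x \<in> W \<Longrightarrow> (\<Sum>i\<in>I. E i x (\<lambda>y. E i y f)) + B x f \<ge> 0"
    and le: "\<And>x. x \<in> W \<Longrightarrow> f x \<le> m" and p: "p \<in> W" "f p = m"
  shows "\<exists>W'. open W' \<and> p \<in> W' \<and> (\<forall>x\<in>W'. f x = m)"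
proof -
  note c = admissible_chart[OF adm]
  note U = chart_facts[OF c]
  let ?O = "\<phi> ` W" and ?inv = "inv_into U \<phi>"
  define G where "G y = f (?inv y)" for y
  have inv: "?inv y \<in> W" "\<phi> (?inv y) = y" if "y \<in> ?O" for y
    using that U(5) W(2) by auto
  have O: "open ?O" by (rule U(7)[OF W])
  have G_le: "G y \<le> m" if "y \<in> ?O" for y using le[OF inv(1)[OF that]] by (simp add: G_def)
  have "smooth_on G ?O" using f SF_iff_chart[OF adm W] unfolding G_def[abs_def] by simp
  then have Gc: "continuous_on ?O G" by (rule smooth_on_continuous)
  have Gp: "G (\<phi> p) = m" using U(5) p W(2) by (auto simp: G_def)
  obtain R where R: "R > 0" "ball (\<phi> p) R \<subseteq> ?O"
    using O p(1) by (metis image_eqI open_contains_ball)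
  have main: "G y = m" if y: "y \<in> ball (\<phi> p) (R / 2)" for y
  proof (rule ccontr)
    assume ne: "G y \<noteq> m"
    define r0 where "r0 = dist y (\<phi> p)"
    have r0: "r0 < R / 2" using y by (simp add: r0_def dist_commute)
    have sub0: "cball y r0 \<subseteq> ?O"
    proof
      fix z assume "z \<in> cball y r0"
      then have "dist (\<phi> p) z < R"
        using dist_triangle[of "\<phi> p" z y] r0 by (simp add: r0_def dist_commute)
      then show "z \<in> ?O" using R(2) by auto
    qed
    let ?K = "{z \<in> cball y r0. G z = m}"
    have "closed ?K"
      by (rule continuous_closed_preimage_constant[OF continuous_on_subset[OF Gc sub0] closed_cball])
    moreover have pK: "\<phi> p \<in> ?K" using Gp by (simp add: r0_def)
    ultimately obtain z0 where z0: "z0 \<in> ?K" "\<And>z. z \<in> ?K \<Longrightarrow> dist y z0 \<le> dist y z"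
      using distance_attains_inf[of ?K y] by blast
    define r where "r = dist y z0 / 2"
    have r: "r > 0" using z0(1) ne by (auto simp: r_def)
    \<comment> \<open>halving the ball about \<open>y\<close> towards \<open>z0\<close> leaves \<open>z0\<close> as its only contact point with \<open>{G = m}\<close>\<close>
    define c0 where "c0 = (1 / 2) *\<^sub>R (y + z0)"
    have yc: "y - c0 = c0 - z0"
      by (simp add: c0_def algebra_simps flip: scaleR_left_distrib)
    have "y - z0 = 2 *\<^sub>R (y - c0)" using yc by (simp add: scaleR_2 algebra_simps)
    then have nyc: "norm (y - c0) = r" by (simp add: r_def dist_norm)
    have z0O: "z0 \<in> ?O" and Gz0: "G z0 = m" using z0(1) sub0 by auto
    have inner: "z \<in> ?O \<and> G z < m" if z: "z \<in> cball c0 r" "z \<noteq> z0" for z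
    proof -
      have nz: "norm (c0 - z) \<le> r" using z(1) by (simp add: dist_norm)
      have "dist y z \<le> 2 * r"
        using norm_triangle_ineq[of "y - c0" "c0 - z"] nz nyc by (simp add: dist_norm)
      then have "z \<in> cball y r0" using z0(1) by (auto simp: r_def)
      then have zO: "z \<in> ?O" using sub0 by auto
      moreover have "G z \<noteq> m"
      proof
        assume "G z = m"
        then have "dist y z \<ge> 2 * r" using z0(2)[of z] \<open>z \<in> cball y r0\<close> by (auto simp: r_def)
        then have "(norm ((y - c0) + (c0 - z)))\<^sup>2 \<ge> (2 * r)\<^sup>2"
          using r by (intro power_mono) (auto simp: dist_norm)
        moreover have "(norm (c0 - z))\<^sup>2 \<le> r\<^sup>2" using nz by (intro power_mono) auto
        \<comment> \<open>strict convexity of the norm, by the parallelogram law\<close>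
        moreover have "(norm ((y - c0) + (c0 - z)))\<^sup>2 + (norm ((y - c0) - (c0 - z)))\<^sup>2 =
            2 * (norm (y - c0))\<^sup>2 + 2 * (norm (c0 - z))\<^sup>2"
          unfolding power2_norm_eq_inner
          by (simp only: inner_add_left inner_add_right inner_diff_left inner_diff_right inner_commute) simp
        moreover have "(2 * r)\<^sup>2 = 4 * r\<^sup>2" by (simp add: power_mult_distrib)
        ultimately have "(norm ((y - c0) - (c0 - z)))\<^sup>2 \<le> 0" unfolding nyc by linarith
        then have "y - c0 = c0 - z"
          by (simp only: power2_less_eq_zero_iff norm_eq_zero right_minus_eq)
        then show False using yc z(2) by simp
      qed
      ultimately show ?thesis using G_le[OF zO] by simp
    qed
    define sq where "sq z = (z - c0) \<bullet> (z - c0)" for z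
    define q where "q x = sq (\<phi> x)" for x
    have sq_sum: "sq z = (\<Sum>b\<in>Basis. ((z \<bullet> b) + (- (c0 \<bullet> b))) * ((z \<bullet> b) + (- (c0 \<bullet> b))))" for z
    proof -
      have "sq z = (\<Sum>b\<in>Basis. ((z - c0) \<bullet> b) * ((z - c0) \<bullet> b))" unfolding sq_def by (rule euclidean_inner)
      then show ?thesis by (simp add: inner_diff_left)
    qed
    have sq_smooth: "smooth_on sq UNIV"
      unfolding sq_sum[abs_def] smooth_on_def
      by (intro allI Ck_on_sum Ck_on_mult Ck_on_add Ck_on_const Ck_on_bounded_linear[OF _ bounded_linear_inner_left] Ck_on_id)
        auto
    have q: "SF W q" unfolding q_def[abs_def] by (rule SF_chart_compose[OF adm W sq_smooth]) simp
    have sqz0: "sq z0 = r\<^sup>2"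
      using nyc yc by (simp add: sq_def power2_norm_eq_inner[symmetric] norm_minus_commute)
    define x0 where "x0 = ?inv z0"
    have x0: "x0 \<in> W" "\<phi> x0 = z0" using inv[OF z0O] by (auto simp: x0_def)
    define Q where "Q x = (\<Sum>i\<in>I. E i x q * E i x q)" for x
    define P where "P u x = (\<Sum>i\<in>I. E i x (\<lambda>y. E i y u)) + B x u" for u x
    have EiSF: "SF W (\<lambda>x. E i x u)" if "i \<in> I" "SF W u" for i u
      by (rule VF_SF[OF E[OF that(1)] W(1) order_refl that(2)])
    have Q_SF: "SF W Q" unfolding Q_def[abs_def] by (intro SF_sum SF_mult W(1) EiSF q)
    have P_SF: "SF W (P q)"
      unfolding P_def[abs_def] by (intro SF_add SF_sum W(1) EiSF q VF_SF[OF B W(1) order_refl])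
    \<comment> \<open>ellipticity: the fields span, and the differential of \<open>q\<close> is not zero off the centre\<close>
    have Q0: "Q x0 > 0"
    proof (rule ccontr)
      assume "\<not> Q x0 > 0"
      then have "Q x0 = 0" unfolding Q_def using sum_nonneg[of I "\<lambda>i. E i x0 q * E i x0 q"] by force
      let ?v = "chart_vector (U, \<phi>) (z0 - c0) x0"
      have vT: "?v \<in> TS x0" using chart_vector_TS[OF adm] x0(1) W(2) by blast
      have "((\<lambda>z. (z - c0) \<bullet> (z - c0)) has_derivative (\<lambda>w. 2 * ((z0 - c0) \<bullet> w))) (at z0)"
        by (auto intro!: derivative_eq_intros simp: inner_commute)
      then have "((\<lambda>z. q (?inv z)) has_derivative (\<lambda>w. 2 * ((z0 - c0) \<bullet> w))) (at z0)"
        by (rule has_derivative_transform_within_open[OF _ O z0O]) (use inv in \<open>auto simp: q_def sq_def\<close>)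
      from frechet_derivative_at[OF this, symmetric]
      have "?v q = 2 * ((z0 - c0) \<bullet> (z0 - c0))"
        using nearI[OF W(1) x0(1) q] x0(2) by (simp add: chart_vector_def)
      then have "?v q \<noteq> 0" using sqz0 r by (simp add: sq_def)
      moreover have "?v q = 0"
      proof (cases "finite I")
        case True
        then have "E i x0 q = 0" if "i \<in> I" for i
          using \<open>Q x0 = 0\<close> sum_nonneg_eq_0_iff[OF True, of "\<lambda>i. E i x0 q * E i x0 q"] that by (auto simp: Q_def)
        then show ?thesis using sp[OF x0(1) vT] by (auto simp: spanned_def sum_fun_apply)
      next
        case False
        then show ?thesis using sp[OF x0(1) vT] by (auto simp: spanned_def)
      qed
      ultimately show False by simp
    qed
    \<comment> \<open>\<open>P h = \<alpha> exp (- \<alpha> q) (\<alpha> Q - P q)\<close>, see below, so this \<open>\<alpha>\<close> makes \<open>P h\<close> positive at \<open>x0\<close> and hence nearby\<close>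
    define \<alpha> where "\<alpha> = (\<bar>P q x0\<bar> + 1) / Q x0"
    have \<alpha>: "\<alpha> > 0" "\<alpha> * Q x0 - P q x0 > 0" using Q0 by (auto simp: \<alpha>_def)
    let ?V = "{x \<in> W. \<alpha> * Q x - P q x > 0}"
    have "SF W (\<lambda>x. \<alpha> * Q x - P q x)" by (intro SF_diff SF_cmult W(1) Q_SF P_SF)
    then have "continuous_on W (\<lambda>x. \<alpha> * Q x - P q x)" by (rule SF_continuous[OF W(1)])
    from continuous_open_preimage[OF this W(1) open_greaterThan[of 0]]
    have "open ?V" by (simp add: vimage_def Int_def)
    then have "open (\<phi> ` ?V)" by (rule U(7)) (use W(2) in auto)
    moreover have "z0 \<in> \<phi> ` ?V" using x0 \<alpha>(2) by auto
    ultimately obtain \<delta> where \<delta>: "\<delta> > 0" "cball z0 \<delta> \<subseteq> \<phi> ` ?V" by (auto simp: open_contains_cball)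
    have \<delta>O: "cball z0 \<delta> \<subseteq> ?O" using \<delta>(2) by auto
    define h where "h x = exp (- \<alpha> * q x) - exp (- \<alpha> * r\<^sup>2)" for x
    define H where "H z = exp (- \<alpha> * sq z) - exp (- \<alpha> * r\<^sup>2)" for z
    have hH: "h (?inv z) = H z" if "z \<in> ?O" for z using inv(2)[OF that] by (simp add: h_def H_def q_def)
    have e_SF: "SF W (\<lambda>x. exp (- \<alpha> * q x))"
      by (rule SF_compose[OF W(1) SF_cmult[OF W(1) q] open_UNIV _ smooth_on_exp]) simp
    have h_SF: "SF W h" unfolding h_def[abs_def] by (intro SF_diff W(1) e_SF SF_const)
    have Ph: "P h x = \<alpha> * exp (- \<alpha> * q x) * (\<alpha> * Q x - P q x)" if x: "x \<in> W" for x
    proof -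
      note nq = nearI[OF W(1) _ q] and ne' = nearI[OF W(1) _ e_SF] and nh = nearI[OF W(1) _ h_SF]
      have d: "v h = - \<alpha> * exp (- \<alpha> * q y) * v q" "v (\<lambda>x. exp (- \<alpha> * q x)) = - \<alpha> * exp (- \<alpha> * q y) * v q"
        if y: "y \<in> W" and v: "v \<in> TS y" for v y
      proof -
        have "((\<lambda>s. exp (- \<alpha> * s)) has_real_derivative - \<alpha> * exp (- \<alpha> * q y)) (at (q y))"
          by (auto intro!: derivative_eq_intros)
        from TS_compose[OF v nq[OF y] ne'[OF y] this]
        show e: "v (\<lambda>x. exp (- \<alpha> * q x)) = - \<alpha> * exp (- \<alpha> * q y) * v q" .
        show "v h = - \<alpha> * exp (- \<alpha> * q y) * v q"
          unfolding h_def[abs_def] using TS_diff[OF v ne'[OF y] near_const] TS_const[OF v] e by simp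
      qed
      have "E i x (\<lambda>y. E i y h) = exp (- \<alpha> * q x) * (\<alpha> * \<alpha> * (E i x q * E i x q) - \<alpha> * E i x (\<lambda>y. E i y q))"
        if i: "i \<in> I" for i
      proof -
        note T = VF_TS[OF E[OF i]]
        have "E i x (\<lambda>y. E i y h) = E i x (\<lambda>y. - \<alpha> * (exp (- \<alpha> * q y) * E i y q))"
          by (rule TS_cong[OF T[OF x] W(1) x]) (simp add: d(1)[OF _ T])
        also have "\<dots> = - \<alpha> * E i x (\<lambda>y. exp (- \<alpha> * q y) * E i y q)"
          by (intro TS_cmult[OF T[OF x]] near_mult ne' x nearI[OF W(1) x EiSF[OF i q]])
        also have "E i x (\<lambda>y. exp (- \<alpha> * q y) * E i y q) =
            exp (- \<alpha> * q x) * E i x (\<lambda>y. E i y q) + E i x q * (- \<alpha> * exp (- \<alpha> * q x) * E i x q)"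
          unfolding d(2)[OF x T[OF x], symmetric]
          by (rule TS_mult[OF T[OF x] ne'[OF x] nearI[OF W(1) x EiSF[OF i q]]])
        finally show ?thesis by (simp add: algebra_simps)
      qed
      then have "(\<Sum>i\<in>I. E i x (\<lambda>y. E i y h)) =
          (\<Sum>i\<in>I. exp (- \<alpha> * q x) * (\<alpha> * \<alpha> * (E i x q * E i x q) - \<alpha> * E i x (\<lambda>y. E i y q)))"
        by (rule sum.cong[OF refl])
      then show ?thesis
        unfolding P_def Q_def d(1)[OF x VF_TS[OF B x]]
        by (simp add: sum_subtractf sum_distrib_left algebra_simps)
    qed
    let ?S = "sphere z0 \<delta> \<inter> cball c0 r"
    have H_le: "H z \<le> 1" for z
    proof -
      have "exp (- \<alpha> * sq z) \<le> 1" using \<alpha>(1) by (simp add: sq_def)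
      moreover have "exp (- \<alpha> * r\<^sup>2) > 0" by simp
      ultimately show ?thesis unfolding H_def by linarith
    qed
    have sphereO: "sphere z0 \<delta> \<subseteq> ?O" using \<delta>O sphere_cball by blast
    have "\<exists>\<epsilon>>0. \<forall>z\<in>?S. G z + \<epsilon> * H z < m"
    proof (cases "?S = {}")
      case True
      then show ?thesis by (intro exI[of _ 1]) auto
    next
      case False
      have "compact ?S" by (intro compact_Int_closed compact_sphere closed_cball)
      moreover have "continuous_on ?S G" by (rule continuous_on_subset[OF Gc]) (use sphereO in auto)
      ultimately obtain s where s: "s \<in> ?S" "\<And>z. z \<in> ?S \<Longrightarrow> G z \<le> G s"
        using continuous_attains_sup[of ?S G] False by blast
      have "s \<noteq> z0" using s(1) \<delta>(1) by auto
      then have "G s < m" using inner s(1) by auto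
      define \<epsilon> where "\<epsilon> = (m - G s) / 2"
      have \<epsilon>: "\<epsilon> > 0" "G s + \<epsilon> < m" using \<open>G s < m\<close> by (auto simp: \<epsilon>_def field_simps)
      have "G z + \<epsilon> * H z < m" if "z \<in> ?S" for z
      proof -
        have "\<epsilon> * H z \<le> \<epsilon> * 1" using H_le[of z] \<epsilon>(1) by (intro mult_left_mono) auto
        then show ?thesis using s(2)[OF that] \<epsilon>(2) by linarith
      qed
      then show ?thesis using \<epsilon>(1) by blast
    qed
    then obtain \<epsilon> where \<epsilon>: "\<epsilon> > 0" "\<And>z. z \<in> ?S \<Longrightarrow> G z + \<epsilon> * H z < m" by blast
    have bd: "G z + \<epsilon> * H z < m" if z: "z \<in> sphere z0 \<delta>" for z
    proof (cases "z \<in> cball c0 r")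
      case True
      then show ?thesis using \<epsilon>(2) z by blast
    next
      case False
      then have "r < norm (z - c0)" by (simp add: dist_norm norm_minus_commute)
      then have "r\<^sup>2 < (norm (z - c0))\<^sup>2" using r by (intro power_strict_mono) auto
      then have "r\<^sup>2 < sq z" by (simp add: sq_def power2_norm_eq_inner)
      then have "H z < 0" using \<alpha>(1) by (simp add: H_def)
      then have "\<epsilon> * H z < 0" using \<epsilon>(1) by (simp add: mult_pos_neg)
      then show ?thesis using G_le[of z] z sphereO by force
    qed
    have "continuous_on (cball z0 \<delta>) (\<lambda>z. G z + \<epsilon> * H z)"
      unfolding H_def sq_def by (intro continuous_intros continuous_on_subset[OF Gc \<delta>O])
    then obtain z1 where z1: "z1 \<in> cball z0 \<delta>" "\<And>z. z \<in> cball z0 \<delta> \<Longrightarrow> G z + \<epsilon> * H z \<le> G z1 + \<epsilon> * H z1"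
      using continuous_attains_sup[of "cball z0 \<delta>" "\<lambda>z. G z + \<epsilon> * H z"] \<delta>(1) by force
    have "G z0 + \<epsilon> * H z0 = m" using Gz0 sqz0 by (simp add: H_def)
    then have "G z1 + \<epsilon> * H z1 \<ge> m" using z1(2)[of z0] \<delta>(1) by simp
    then have "z1 \<notin> sphere z0 \<delta>" using bd by force
    then have z1b: "z1 \<in> ball z0 \<delta>" using z1(1) by (auto simp: less_le)
    define x1 where "x1 = ?inv z1"
    have z1O: "z1 \<in> ?O" using z1(1) \<delta>O by blast
    have x1: "x1 \<in> W" "\<phi> x1 = z1" using inv[OF z1O] by (auto simp: x1_def)
    have "x1 \<in> ?V"
    proof -
      obtain x where "x \<in> ?V" "\<phi> x = z1" using z1(1) \<delta>(2) by auto
      moreover have "x = x1" using calculation U(5) W(2) by (auto simp: x1_def)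
      ultimately show ?thesis by simp
    qed
    then have Phpos: "P h x1 > 0" using Ph[OF x1(1)] \<alpha>(1) by simp
    define u where "u x = f x + \<epsilon> * h x" for x
    have u: "SF W u" unfolding u_def[abs_def] by (intro SF_add SF_cmult W(1) f h_SF)
    let ?W1 = "{x \<in> U. \<phi> x \<in> ball z0 \<delta>} \<inter> W"
    have W1: "open ?W1" "x1 \<in> ?W1" "?W1 \<subseteq> W"
      using open_Int[OF open_chart_preimage[OF c open_ball] W(1)] x1 z1b W(2) by auto
    have u_le: "u x \<le> u x1" if x: "x \<in> ?W1" for x
    proof -
      have "?inv (\<phi> x) = x" using U(5) x by simp
      then have "G (\<phi> x) + \<epsilon> * H (\<phi> x) = u x"
        using hH[of "\<phi> x"] x by (simp add: G_def u_def)
      moreover have "G z1 + \<epsilon> * H z1 = u x1" using hH[OF z1O] by (simp add: G_def u_def x1_def)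
      ultimately show ?thesis using z1(2)[of "\<phi> x"] x by simp
    qed
    note u1 = SF_subset[OF u W1(3)]
    have lin: "v u = v f + \<epsilon> * v h" if "y \<in> W" "v \<in> TS y" for v y
    proof -
      note n = nearI[OF W(1) that(1)]
      show ?thesis
        unfolding u_def[abs_def] using TS_add[OF that(2) n[OF f] near_cmult[OF n[OF h_SF]]] TS_cmult[OF that(2) n[OF h_SF]]
        by simp
    qed
    have "P u x1 = P f x1 + \<epsilon> * P h x1"
    proof -
      have "E i x1 (\<lambda>y. E i y u) = E i x1 (\<lambda>y. E i y f) + \<epsilon> * E i x1 (\<lambda>y. E i y h)" if i: "i \<in> I" for i
      proof -
        note T = VF_TS[OF E[OF i]] and n = nearI[OF W(1) x1(1) EiSF[OF i]]
        have "E i x1 (\<lambda>y. E i y u) = E i x1 (\<lambda>y. E i y f + \<epsilon> * E i y h)"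
          by (rule TS_cong[OF T[OF x1(1)] W(1) x1(1)]) (rule lin[OF _ T])
        then show ?thesis
          using TS_add[OF T[OF x1(1)] n[OF f] near_cmult[OF n[OF h_SF]]] TS_cmult[OF T[OF x1(1)] n[OF h_SF]] by simp
      qed
      then show ?thesis
        by (simp add: P_def lin[OF x1(1) VF_TS[OF B x1(1)]] sum.distrib sum_distrib_left algebra_simps)
    qed
    moreover have "P f x1 \<ge> 0" using sub[OF x1(1)] by (simp add: P_def)
    moreover have "\<epsilon> * P h x1 > 0" using \<epsilon>(1) Phpos by simp
    moreover have "P u x1 \<le> 0"
    proof -
      have "E i x1 (\<lambda>y. E i y u) \<le> 0" if "i \<in> I" for i
        by (rule local_max_second[OF W1(1,2) u1 u_le VF_subset[OF E[OF that] W1(3)]])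
      moreover have "B x1 u = 0"
        by (rule local_max_first[OF W1(1,2) u1 u_le VF_TS[OF B x1(1)]])
      ultimately show ?thesis by (simp add: P_def sum_nonpos)
    qed
    ultimately show False by simp
  qed
  let ?W' = "{x \<in> U. \<phi> x \<in> ball (\<phi> p) (R / 2)}"
  have "open ?W'" by (rule open_chart_preimage[OF c open_ball])
  moreover have "p \<in> ?W'" using p(1) W(2) R(1) by auto
  moreover have "f x = m" if "x \<in> ?W'" for x
    using main[of "\<phi> x"] U(5)[of x] that by (simp add: G_def)
  ultimately show ?thesis by blast
qed

end

section \<open>The vanishing theorem\<close>

context kaehler_foliated_manifold
begin

text \<open>
  On a neighbourhood of a maximum point the frame consists of an adapted frame, for the indices in
  \<open>T\<close>, and of a leaf frame, for the others; the latter only serves to make the operator elliptic.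
\<close>

lemma normal_part_vanishes:
  assumes comp: "compact (UNIV :: 'a set)" and con: "connected (UNIV :: 'a set)"
    and nonpos: "\<And>p. ricci_nonpos_at A T F g p" and neg: "ricci_neg_at A T F g p0"
    and Y: "Y \<in> IA UNIV" and hol: "transversally_holomorphic A T F g J Y"
  shows "np p (Y p) = 0"
proof -
  let ?N = "QP Y"
  let ?f = "gg ?N ?N"
  note N = N_QG[OF Y hol]
  note bochner = bochner[OF Y hol] and leaf0 = leaf_derivative_zero[OF Y hol]
  have NT: "?N x \<in> TS x" for x by (rule Qp_TS[OF QG_Qp[OF N]])
  have f: "SF UNIV ?f" by (rule gg_SF[OF QS_VF[OF N] QS_VF[OF N] open_UNIV])
  have fc: "continuous_on UNIV ?f" by (rule SF_continuous[OF open_UNIV f])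
  obtain x0 where x0: "\<And>x. ?f x \<le> ?f x0"
    using continuous_attains_sup[OF comp _ fc] by auto
  define m where "m = ?f x0"
  let ?M = "{x. ?f x = m}"
  have "closed ?M" using continuous_closed_preimage_constant[OF fc closed_UNIV, of m] by simp
  moreover have "open ?M"
  proof (subst open_subopen, intro ballI)
    fix p assume "p \<in> ?M"
    then have pm: "?f p = m" by simp
    obtain U \<phi> where c: "(U, \<phi>) \<in> F" and pU: "p \<in> U" by (rule F_chart_at)
    obtain W1 E where E: "adapted_frame W1 E" "p \<in> W1" by (rule adapted_frame_exists)
    obtain W2 and e :: "'n \<Rightarrow> 'a vfield" where W2: "open W2" "p \<in> W2" and e: "\<And>j. j \<in> - T \<Longrightarrow> e j \<in> LS W2"
      and spe: "\<And>x v. x \<in> W2 \<Longrightarrow> v \<in> Lp x \<Longrightarrow> spanned (- T) (\<lambda>j. e j x) v"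
      using leaf_frame_exists[of p] by metis
    define W where "W = U \<inter> W1 \<inter> W2"
    have W: "open W" "W \<subseteq> U" "W \<subseteq> W1" "W \<subseteq> W2" "p \<in> W"
      using F_open[OF c] E pU W2 by (auto simp: W_def adapted_frame_def)
    have EQ: "E a \<in> QG" if "a \<in> T" for a using E(1) that by (simp add: adapted_frame_def)
    define X where "X i = (if i \<in> T then E i else e i)" for i
    define B where "B = (\<Sum>a\<in>T. fscale (\<lambda>x. - 1) (conn (E a) (E a)))"
    have XW: "X i \<in> VF W" for i
    proof (cases "i \<in> T")
      case True
      then show ?thesis using VF_subset[OF QS_VF[OF EQ[OF True]], of W] by (simp add: X_def)
    next
      case False
      then show ?thesis using VF_subset[OF LS_VF[OF e, of i] W(4)] by (simp add: X_def)
    qed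
    have "B \<in> VG"
      unfolding B_def by (intro VF_sum VF_scale SF_const QS_VF[OF conn_QG] QS_VF EQ)
    then have BW: "B \<in> VF W" by (rule VF_subset) simp
    have Bf: "B x ?f = - (\<Sum>a\<in>T. conn (E a) (E a) x ?f)" for x
      by (simp add: B_def sum_fun_apply sum_negf)
    have span: "spanned UNIV (\<lambda>i. X i x) v" if x: "x \<in> W" and v: "v \<in> TS x" for x v
    proof -
      have XE: "spanned UNIV (\<lambda>i. X i x) (X i x)" for i by (rule spanned_member) auto
      have XT: "X a = E a" if "a \<in> T" for a using that by (simp add: X_def)
      have XL: "X j = e j" if "j \<in> - T" for j using that by (simp add: X_def)
      have x1: "x \<in> W1" and x2: "x \<in> W2" using x W by auto
      have "spanned UNIV (\<lambda>i. X i x) (np x v)"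
      proof (rule spanned_trans[OF adapted_frame_spanned[OF E(1) x1 np_Qp[OF v]]])
        show "spanned UNIV (\<lambda>i. X i x) (E a x)" if "a \<in> T" for a using XE[of a] unfolding XT[OF that] .
      qed
      moreover have "spanned UNIV (\<lambda>i. X i x) (v - np x v)"
      proof (rule spanned_trans[OF spe[OF x2 np_Lp[OF v]]])
        show "spanned UNIV (\<lambda>i. X i x) (e j x)" if "j \<in> - T" for j using XE[of j] unfolding XL[OF that] .
      qed
      ultimately show ?thesis using spanned_add[of UNIV "\<lambda>i. X i x" "np x v" "v - np x v"] by simp
    qed
    have sub: "(\<Sum>i\<in>UNIV. X i x (\<lambda>y. X i y ?f)) + B x ?f \<ge> 0" if x: "x \<in> W" for x
    proof -
      have x1: "x \<in> W1" and x2: "x \<in> W2" using x W by auto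
      have "(\<Sum>i\<in>UNIV. X i x (\<lambda>y. X i y ?f)) =
          (\<Sum>i\<in>T. X i x (\<lambda>y. X i y ?f)) + (\<Sum>i\<in>- T. X i x (\<lambda>y. X i y ?f))"
        using sum.union_disjoint[of T "- T" "\<lambda>i. X i x (\<lambda>y. X i y ?f)"] by (simp add: Compl_partition)
      also have "(\<Sum>i\<in>- T. X i x (\<lambda>y. X i y ?f)) = 0"
      proof (rule sum.neutral, rule ballI)
        fix j assume j: "j \<in> - T"
        have "e j x (\<lambda>y. e j y ?f) = e j x (\<lambda>y. 0)"
          by (rule TS_cong[OF VF_TS[OF LS_VF[OF e[OF j]] x2] W2(1) x2]) (rule leaf0[OF e[OF j] W2(1)])
        then show "X j x (\<lambda>y. X j y ?f) = 0"
          using j TS_const[OF VF_TS[OF LS_VF[OF e[OF j]] x2]] by (simp add: X_def)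
      qed
      also have "(\<Sum>i\<in>T. X i x (\<lambda>y. X i y ?f)) = (\<Sum>a\<in>T. E a x (\<lambda>y. E a y ?f))"
        by (rule sum.cong) (simp_all add: X_def)
      finally have "(\<Sum>i\<in>UNIV. X i x (\<lambda>y. X i y ?f)) + B x ?f =
          2 * (\<Sum>a\<in>T. g x (conn (E a) ?N x) (conn (E a) ?N x)) - 2 * g x (trans_ricci A T F g ?N x) (?N x)"
        using bochner[OF E(1) x1] Bf by simp
      moreover have "(\<Sum>a\<in>T. g x (conn (E a) ?N x) (conn (E a) ?N x)) \<ge> 0"
        by (intro sum_nonneg g_nonneg Qp_TS QG_Qp conn_QG QS_VF[OF EQ] N)
      moreover have "g x (trans_ricci A T F g ?N x) (?N x) \<le> 0"
        using nonpos[of x] N unfolding ricci_nonpos_at_def by blast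
      ultimately show ?thesis by linarith
    qed
    have "\<exists>W'. open W' \<and> p \<in> W' \<and> (\<forall>x\<in>W'. ?f x = m)"
    proof (rule strong_maximum_principle[OF F_admissible[OF c] W(1,2) XW BW span _ sub _ W(5) pm])
      show "SF W ?f" by (rule SF_subset[OF f subset_UNIV])
      show "?f x \<le> m" for x unfolding m_def by (rule x0)
    qed
    then obtain W' where W': "open W'" "p \<in> W'" "\<forall>x\<in>W'. ?f x = m" by (elim exE conjE)
    then show "\<exists>T. open T \<and> p \<in> T \<and> T \<subseteq> ?M" by (intro exI[of _ W'] conjI subsetI CollectI) simp_all
  qed
  ultimately have "?M \<inter> UNIV = {} \<or> - ?M \<inter> UNIV = {}"
    by (intro connectedD[OF con]) auto
  moreover have "x0 \<in> ?M" by (simp add: m_def)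
  ultimately have const: "?f x = m" for x by auto
  obtain W E where E: "adapted_frame W E" "p0 \<in> W" by (rule adapted_frame_exists)
  have EQ: "E a \<in> QG" if "a \<in> T" for a using E(1) that by (simp add: adapted_frame_def)
  have f_const: "?f = (\<lambda>x. m)" by (rule ext) (rule const)
  have v0: "v ?f = 0" if "v \<in> TS x" for v x unfolding f_const by (rule TS_const[OF that])
  have v0': "E a x ?f = 0" if "a \<in> T" for a x by (rule v0[OF global_TS[OF QS_VF[OF EQ[OF that]]]])
  have "(\<Sum>a\<in>T. E a p0 (\<lambda>x. E a x ?f)) = 0"
    using TS_const[OF global_TS[OF QS_VF[OF EQ]]] by (intro sum.neutral) (simp add: v0')
  moreover have "(\<Sum>a\<in>T. conn (E a) (E a) p0 ?f) = 0"
    by (intro sum.neutral ballI v0[OF Qp_TS[OF QG_Qp[OF conn_QG[OF QS_VF[OF EQ] EQ]]]])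
  moreover have "(\<Sum>a\<in>T. g p0 (conn (E a) ?N p0) (conn (E a) ?N p0)) \<ge> 0"
    by (intro sum_nonneg g_nonneg Qp_TS QG_Qp conn_QG QS_VF[OF EQ] N)
  ultimately have "g p0 (trans_ricci A T F g ?N p0) (?N p0) \<ge> 0"
    using bochner[OF E] by simp
  then have "?N p0 = 0" using neg N unfolding ricci_neg_at_def by fastforce
  then have "m = 0" using const[of p0] g_zero_left[OF TS_zero] by simp
  then show ?thesis using const[of p] g_eq_0_iff[OF NT] by simp
qed

end

theorem theorem5p4:
  fixes A F :: "('a::{t2_space, second_countable_topology}, 'n::finite) chart set"
    and T :: "'n set"
    and g :: "'a \<Rightarrow> 'a tvec \<Rightarrow> 'a tvec \<Rightarrow> real"
    and J :: "'a \<Rightarrow> 'a tvec \<Rightarrow> 'a tvec"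
  assumes "smooth_atlas A"
    and "compact (UNIV :: 'a set)"
    and "connected (UNIV :: 'a set)"
    and "riemannian_metric A g"
    and "kaehler_foliation A T F g J"
    and "\<forall>p. ricci_nonpos_at A T F g p"
    and "\<exists>p. ricci_neg_at A T F g p"
  shows "\<forall>Y\<in>inf_automorphisms A T F UNIV. transversally_holomorphic A T F g J Y \<longrightarrow>
           Y \<in> L_sections A T F UNIV \<and> (\<forall>p. nproj A T F g p (Y p) = 0)"
proof (intro ballI impI)
  have fol: "foliation A T F" "bundle_like A T F g"
    using assms(5) by (auto simp: kaehler_foliation_def)
  interpret kaehler_foliated_manifold A g T F J
    by unfold_locales (use assms fol in auto)
  obtain p0 where neg: "ricci_neg_at A T F g p0" using assms(7) by blast
  fix Y assume Y: "Y \<in> inf_automorphisms A T F UNIV" and hol: "transversally_holomorphic A T F g J Y"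
  have 0: "nproj A T F g p (Y p) = 0" for p
    by (rule normal_part_vanishes[OF assms(2,3) _ neg Y hol]) (use assms(6) in blast)
  have "Y \<in> L_sections A T F UNIV"
    by (rule LSI[OF IA_VF[OF Y]]) (rule np_eq_0[OF global_TS[OF IA_VF[OF Y]] 0])
  then show "Y \<in> L_sections A T F UNIV \<and> (\<forall>p. nproj A T F g p (Y p) = 0)" using 0 by simp
qed

end
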